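(* Let $n\ge 1$, let $U\subset\mathbb{C}^n$ be a domain (connected open set), let $\pi:\widetilde U\to U$ be a Riemann domain over $U$ (a holomorphic unramified covering, $\widetilde U$ connected), and let $F$ be a nondegenerate holomorphic function on $\widetilde U$. Let $J$, $g$, $\nabla$, $\tilde z^i$, $\tilde x^i$, $\tilde u^i$, $\tilde y_j$, $F_{\tilde z^k}$ be the associated objects on $\widetilde U$ defined in the context. Then: (1) $M(F)=(\widetilde U,J,g,\nabla)$ is a special Kähler manifold with Kähler form $$\omega = g(\cdot,J\cdot)=2\sum_{i=1}^n d\tilde x^i\wedge d\tilde y_i .$$ (2) The immersion $\varphi_F:\widetilde U\to\mathbb{R}^{2n+1}$ defined by $$\varphi_F := \bigl(\operatorname{Re}\tilde z,\ \operatorname{Re}F_{\tilde z},\ 2\operatorname{Im}F-2\sum_{k=1}^n(\operatorname{Re}F_{\tilde z^k})\operatorname{Im}\tilde z^k\bigr)=\bigl(\tilde x^1,\ldots,\tilde x^n,\tilde y_1,\ldots,\tilde y_n,\ 2\operatorname{Im}F-2\sum_{k=1}^n\tilde y_k\tilde u^k\bigr)$$ is, with respect to the parallel volume form $\mathrm{vol}:=2^n\det$ on $\mathbb{R}^{2n+1}$, a special parabolic hypersphere with affine normal $\xi=\partial_{2n+1}$, Blaschke metric $g$, induced connection $\nabla$ and compatible almost complex structure $J$. (3) The immersion $\varphi_F$ is unique up to unimodular affine transformations of $\mathbb{R}^{2n+1}$: if $\psi:\widetilde U\to\mathbb{R}^{2n+1}$ is any special parabolic hypersphere (with respect to $\mathrm{vol}$)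 with Blaschke metric $g$, induced connection $\nabla$ and compatible almost complex structure $J$, then $\psi=A\circ\varphi_F$ for some unimodular affine transformation $A$ of $\mathbb{R}^{2n+1}$.
   Context: **Objects attached to $F$.** On $T^*\mathbb{C}^n$ use canonical coordinates $(z^1,\ldots,z^n,w_1,\ldots,w_n)$, the complex symplectic form $\Omega=\sum_i dz^i\wedge dw_i$ (with $\alpha\wedge\beta=\alpha\otimes\beta-\beta\otimes\alpha$) and the Hermitian form $\gamma:=\sqrt{-1}\,\Omega(\cdot,\bar\cdot)$, i.e. $\gamma(X,Y)=\sqrt{-1}\sum_i\bigl(dz^i(X)\overline{dw_i(Y)}-dw_i(X)\overline{dz^i(Y)}\bigr)$. $J$ denotes the complex structure of $\widetilde U$. A holomorphic function $F$ on $\widetilde U$ defines a holomorphic Lagrangian immersion $$\phi:\widetilde U\to T^*U\subset T^*\mathbb{C}^n,\qquad \phi(p):=dF_p\circ(\pi_*|_{T_p\widetilde U})^{-1}\in T^*_{\pi(p)}U .$$ Put $\tilde z^i:=\phi^*z^i$ (so $\tilde z^i=z^i\circ\pi$) and $\tilde w_j:=\phi^*w_j$. The $\tilde z^i$ form a local holomorphic coordinate system near every point of $\widetilde U$. Write $\tilde z=(\tilde z^1,\ldots,\tilde z^n)$ and $F_{\tilde z}=(F_{\tilde z^1},\ldots,F_{\tilde z^n})=(\partial F/\partial\tilde z^1,\ldots,\partial F/\partial\tilde z^n)$, so that $\tilde w_j=F_{\tilde z^j}$. Let $\partial^2F$ be the matrix $(\partial^2F/\partial\tilde z^i\partial\tilde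 z^j)$. $F$ is called *nondegenerate* if the real matrix $\operatorname{Im}\partial^2F$ is invertible at every point of $\widetilde U$. Put $\tilde x^i:=\operatorname{Re}\tilde z^i$, $\tilde u^i:=\operatorname{Im}\tilde z^i$, $\tilde y_j:=\operatorname{Re}\tilde w_j$, $\tilde v_j:=\operatorname{Im}\tilde w_j$. For nondegenerate $F$, $g:=\operatorname{Re}\phi^*\gamma$ is a pseudo-Kähler metric on $(\widetilde U,J)$, and $(\tilde x^1,\ldots,\tilde x^n,\tilde y_1,\ldots,\tilde y_n)$ is a real local coordinate system near every point; $\nabla$ is the flat torsionfree connection on $\widetilde U$ for which all the functions $\tilde x^i,\tilde y_j$ are affine (i.e. $\nabla d\tilde x^i=0=\nabla d\tilde y_j$). **Special Kähler manifold.** A special Kähler manifold $(M,J,g,\nabla)$ is a (pseudo-)Kähler manifold $(M,J,g)$ (the metric may be indefinite) endowed with a flat torsionfree connection $\nabla$ such that $\nabla J$ is symmetric, i.e. $(\nabla_XJ)Y=(\nabla_YJ)X$, and $\nabla\omega=0$, where $\omega$ is the Kähler form (the condition does not depend on the sign convention $\omega=g(\cdot,J\cdot)$ or $\omega=g(J\cdot,\cdot)$). **Affine hypersurfaces.** Consider $\mathbb{R}^{m+1}$, $m>1$, with its standard flat connection $\widetilde\nabla$ and a parallel volume form $\mathrm{vol}$. A hypersurface is an immersion $\varphi:M\to\mathbb{R}^{m+1}$ of a connected $m$-manifold. A transversal vector field $\xi$ along $\varphi$ induces on $M$ the volume form $\nu=\mathrm{vol}(\xi,\ldots)$ and data $(\nabla,g,S,\theta)$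 (torsionfree connection, symmetric bilinear tensor field, endomorphism field, one-form) by $$\widetilde\nabla_XY=\nabla_XY+g(X,Y)\xi,\qquad \widetilde\nabla_X\xi=SX+\theta(X)\xi .$$ It is assumed that $g$ is nondegenerate (a condition independent of $\xi$). Once an orientation of $M$ is fixed, there is a unique transversal $\xi$, the *affine normal*, such that $\nu$ equals the metric volume form $\mathrm{vol}^g$ and $\nabla\nu=0$; for this $\xi$, $g$ is called the *Blaschke metric* and $\nabla$ the *induced connection*. The hypersurface is a *parabolic (improper) hypersphere* if its affine normal satisfies $\widetilde\nabla\xi=0$. A parabolic hypersphere is *special* if there is an almost complex structure $J$ on $M$ which is skew-symmetric with respect to the Blaschke metric $g$ and such that the 2-form $g(J\cdot,\cdot)$ is parallel with respect to the induced connection $\nabla$; such a $J$ is called *compatible*. **Conventions.** Here $m=2n$; $\widetilde U$ carries the orientation for which $d\tilde x^1\wedge\cdots\wedge d\tilde x^n\wedge d\tilde y_1\wedge\cdots\wedge d\tilde y_n$ is positive (equivalently, the orientation defined by $\mathrm{vol}(\partial_{2n+1},\ldots)$ along $\varphi_F$). $\partial_{2n+1}$ is the last standard coordinate vector field of $\mathbb{R}^{2n+1}$. An affine transformation of $\mathbb{R}^{2n+1}$ is unimodular if its linear part has determinant $1$. *)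

theory Defs
  imports "HOL-Analysis.Analysis"
begin

section \<open>Calculus on manifolds that are etale over a Euclidean space\<close>

text \<open>
  A manifold is a set \<open>M\<close> with a local homeomorphism \<open>\<pi>\<close> into a Euclidean space \<open>'e\<close>; its smooth
  structure is the one pulled back along \<open>\<pi>\<close>. The differential of \<open>\<pi>\<close> identifies every tangent
  space of \<open>M\<close> with \<open>'e\<close>, so a vector field is a map \<open>'a \<Rightarrow> 'e\<close>, a one-form is a map
  \<open>'a \<Rightarrow> 'e \<Rightarrow> real\<close>, an endomorphism field is a map \<open>'a \<Rightarrow> 'e \<Rightarrow> 'e\<close>, and so on. Values outside
  of \<open>M\<close> are irrelevant throughout.
\<close>

definition etale_manifold :: "'a::topological_space set \<Rightarrow> ('a \<Rightarrow> 'e::euclidean_space) \<Rightarrow> bool" where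
  "etale_manifold M \<pi> \<longleftrightarrow> Hausdorff_space (top_of_set M) \<and>
     (\<forall>p\<in>M. \<exists>W q. openin (top_of_set M) W \<and> p \<in> W \<and> open (\<pi> ` W) \<and> homeomorphism W (\<pi> ` W) \<pi> q)"

text \<open>The differential of \<open>f\<close> at \<open>p\<close>, as a map on \<open>'e\<close>, is the derivative of \<open>f \<circ> q\<close> at \<open>\<pi> p\<close>
  where \<open>q\<close> is a local inverse of \<open>\<pi>\<close> near \<open>p\<close>.\<close>

definition has_mderiv ::
  "'a::topological_space set \<Rightarrow> ('a \<Rightarrow> 'e::euclidean_space) \<Rightarrow> ('a \<Rightarrow> 'b::real_normed_vector) \<Rightarrow>
   ('e \<Rightarrow> 'b) \<Rightarrow> 'a \<Rightarrow> bool" where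
  "has_mderiv M \<pi> f D p \<longleftrightarrow>
     (\<exists>W q. openin (top_of_set M) W \<and> p \<in> W \<and> open (\<pi> ` W) \<and> homeomorphism W (\<pi> ` W) \<pi> q \<and>
        ((f \<circ> q) has_derivative D) (at (\<pi> p)))"

definition mderiv ::
  "'a::topological_space set \<Rightarrow> ('a \<Rightarrow> 'e::euclidean_space) \<Rightarrow> ('a \<Rightarrow> 'b::real_normed_vector) \<Rightarrow>
   'a \<Rightarrow> 'e \<Rightarrow> 'b" where
  "mderiv M \<pi> f p = (SOME D. has_mderiv M \<pi> f D p)"

primrec mCk ::
  "'a::topological_space set \<Rightarrow> ('a \<Rightarrow> 'e::euclidean_space) \<Rightarrow> nat \<Rightarrow> ('a \<Rightarrow> 'b::real_normed_vector) \<Rightarrow> bool" where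
  "mCk M \<pi> 0 f \<longleftrightarrow> continuous_on M f"
| "mCk M \<pi> (Suc k) f \<longleftrightarrow>
     (\<forall>p\<in>M. \<exists>D. has_mderiv M \<pi> f D p) \<and> (\<forall>v. mCk M \<pi> k (\<lambda>p. mderiv M \<pi> f p v))"

definition msmooth ::
  "'a::topological_space set \<Rightarrow> ('a \<Rightarrow> 'e::euclidean_space) \<Rightarrow> ('a \<Rightarrow> 'b::real_normed_vector) \<Rightarrow> bool" where
  "msmooth M \<pi> f \<longleftrightarrow> (\<forall>k. mCk M \<pi> k f)"

definition linear_field ::
  "'a::topological_space set \<Rightarrow> ('a \<Rightarrow> 'e::euclidean_space) \<Rightarrow> ('a \<Rightarrow> 'e \<Rightarrow> 'b::real_normed_vector) \<Rightarrow> bool" where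
  "linear_field M \<pi> T \<longleftrightarrow> (\<forall>p\<in>M. linear (T p)) \<and> (\<forall>v. msmooth M \<pi> (\<lambda>p. T p v))"

definition bilinear_field ::
  "'a::topological_space set \<Rightarrow> ('a \<Rightarrow> 'e::euclidean_space) \<Rightarrow> ('a \<Rightarrow> 'e \<Rightarrow> 'e \<Rightarrow> real) \<Rightarrow> bool" where
  "bilinear_field M \<pi> b \<longleftrightarrow> (\<forall>p\<in>M. bilinear (b p)) \<and> (\<forall>v w. msmooth M \<pi> (\<lambda>p. b p v w))"

text \<open>The flat frame given by \<open>\<pi>\<close> consists of commuting vector fields, whence the formulas for the
  Lie bracket and for the exterior derivative of a 2-form.\<close>

definition lie_bracket ::
  "'a::topological_space set \<Rightarrow> ('a \<Rightarrow> 'e::euclidean_space) \<Rightarrow> ('a \<Rightarrow> 'e) \<Rightarrow> ('a \<Rightarrow> 'e) \<Rightarrow> 'a \<Rightarrow> 'e" where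
  "lie_bracket M \<pi> X Y p = mderiv M \<pi> Y p (X p) - mderiv M \<pi> X p (Y p)"

definition closed_2form ::
  "'a::topological_space set \<Rightarrow> ('a \<Rightarrow> 'e::euclidean_space) \<Rightarrow> ('a \<Rightarrow> 'e \<Rightarrow> 'e \<Rightarrow> real) \<Rightarrow> bool" where
  "closed_2form M \<pi> \<omega> \<longleftrightarrow>
     bilinear_field M \<pi> \<omega> \<and> (\<forall>p\<in>M. \<forall>v w. \<omega> p v w = - \<omega> p w v) \<and>
     (\<forall>p\<in>M. \<forall>u v w. mderiv M \<pi> (\<lambda>q. \<omega> q v w) p u + mderiv M \<pi> (\<lambda>q. \<omega> q w u) p v +
        mderiv M \<pi> (\<lambda>q. \<omega> q u v) p w = 0)"

definition pseudo_metric ::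
  "'a::topological_space set \<Rightarrow> ('a \<Rightarrow> 'e::euclidean_space) \<Rightarrow> ('a \<Rightarrow> 'e \<Rightarrow> 'e \<Rightarrow> real) \<Rightarrow> bool" where
  "pseudo_metric M \<pi> g \<longleftrightarrow>
     bilinear_field M \<pi> g \<and> (\<forall>p\<in>M. \<forall>v w. g p v w = g p w v) \<and>
     (\<forall>p\<in>M. \<forall>v. (\<forall>w. g p v w = 0) \<longrightarrow> v = 0)"

definition almost_complex ::
  "'a::topological_space set \<Rightarrow> ('a \<Rightarrow> 'e::euclidean_space) \<Rightarrow> ('a \<Rightarrow> 'e \<Rightarrow> 'e) \<Rightarrow> bool" where
  "almost_complex M \<pi> J \<longleftrightarrow> linear_field M \<pi> J \<and> (\<forall>p\<in>M. \<forall>v. J p (J p v) = - v)"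

section \<open>Affine connections\<close>

definition affine_connection ::
  "'a::topological_space set \<Rightarrow> ('a \<Rightarrow> 'e::euclidean_space) \<Rightarrow>
   (('a \<Rightarrow> 'e) \<Rightarrow> ('a \<Rightarrow> 'e) \<Rightarrow> 'a \<Rightarrow> 'e) \<Rightarrow> bool" where
  "affine_connection M \<pi> nabla \<longleftrightarrow>
     (\<forall>X Y. msmooth M \<pi> X \<and> msmooth M \<pi> Y \<longrightarrow> msmooth M \<pi> (nabla X Y)) \<and>
     (\<forall>X X' Y. msmooth M \<pi> X \<and> msmooth M \<pi> X' \<and> msmooth M \<pi> Y \<longrightarrow>
        (\<forall>p\<in>M. nabla (\<lambda>q. X q + X' q) Y p = nabla X Y p + nabla X' Y p)) \<and>
     (\<forall>f X Y. msmooth M \<pi> f \<and> msmooth M \<pi> X \<and> msmooth M \<pi> Y \<longrightarrow>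
        (\<forall>p\<in>M. nabla (\<lambda>q. f q *\<^sub>R X q) Y p = f p *\<^sub>R nabla X Y p)) \<and>
     (\<forall>X Y Y'. msmooth M \<pi> X \<and> msmooth M \<pi> Y \<and> msmooth M \<pi> Y' \<longrightarrow>
        (\<forall>p\<in>M. nabla X (\<lambda>q. Y q + Y' q) p = nabla X Y p + nabla X Y' p)) \<and>
     (\<forall>f X Y. msmooth M \<pi> f \<and> msmooth M \<pi> X \<and> msmooth M \<pi> Y \<longrightarrow>
        (\<forall>p\<in>M. nabla X (\<lambda>q. f q *\<^sub>R Y q) p = mderiv M \<pi> f p (X p) *\<^sub>R Y p + f p *\<^sub>R nabla X Y p))"

definition torsion_free ::
  "'a::topological_space set \<Rightarrow> ('a \<Rightarrow> 'e::euclidean_space) \<Rightarrow>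
   (('a \<Rightarrow> 'e) \<Rightarrow> ('a \<Rightarrow> 'e) \<Rightarrow> 'a \<Rightarrow> 'e) \<Rightarrow> bool" where
  "torsion_free M \<pi> nabla \<longleftrightarrow>
     (\<forall>X Y. msmooth M \<pi> X \<and> msmooth M \<pi> Y \<longrightarrow>
        (\<forall>p\<in>M. nabla X Y p - nabla Y X p = lie_bracket M \<pi> X Y p))"

definition flat_connection ::
  "'a::topological_space set \<Rightarrow> ('a \<Rightarrow> 'e::euclidean_space) \<Rightarrow>
   (('a \<Rightarrow> 'e) \<Rightarrow> ('a \<Rightarrow> 'e) \<Rightarrow> 'a \<Rightarrow> 'e) \<Rightarrow> bool" where
  "flat_connection M \<pi> nabla \<longleftrightarrow>
     (\<forall>X Y Z. msmooth M \<pi> X \<and> msmooth M \<pi> Y \<and> msmooth M \<pi> Z \<longrightarrow>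
        (\<forall>p\<in>M. nabla X (nabla Y Z) p - nabla Y (nabla X Z) p - nabla (lie_bracket M \<pi> X Y) Z p = 0))"

definition parallel_1form ::
  "'a::topological_space set \<Rightarrow> ('a \<Rightarrow> 'e::euclidean_space) \<Rightarrow>
   (('a \<Rightarrow> 'e) \<Rightarrow> ('a \<Rightarrow> 'e) \<Rightarrow> 'a \<Rightarrow> 'e) \<Rightarrow> ('a \<Rightarrow> 'e \<Rightarrow> real) \<Rightarrow> bool" where
  "parallel_1form M \<pi> nabla \<alpha> \<longleftrightarrow>
     (\<forall>X Y. msmooth M \<pi> X \<and> msmooth M \<pi> Y \<longrightarrow>
        (\<forall>p\<in>M. mderiv M \<pi> (\<lambda>q. \<alpha> q (Y q)) p (X p) - \<alpha> p (nabla X Y p) = 0))"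

definition parallel_2form ::
  "'a::topological_space set \<Rightarrow> ('a \<Rightarrow> 'e::euclidean_space) \<Rightarrow>
   (('a \<Rightarrow> 'e) \<Rightarrow> ('a \<Rightarrow> 'e) \<Rightarrow> 'a \<Rightarrow> 'e) \<Rightarrow> ('a \<Rightarrow> 'e \<Rightarrow> 'e \<Rightarrow> real) \<Rightarrow> bool" where
  "parallel_2form M \<pi> nabla \<omega> \<longleftrightarrow>
     (\<forall>X Y Z. msmooth M \<pi> X \<and> msmooth M \<pi> Y \<and> msmooth M \<pi> Z \<longrightarrow>
        (\<forall>p\<in>M. mderiv M \<pi> (\<lambda>q. \<omega> q (Y q) (Z q)) p (X p)
           - \<omega> p (nabla X Y p) (Z p) - \<omega> p (Y p) (nabla X Z p) = 0))"

text \<open>Top-degree forms take families of vectors labelled by a finite type \<open>'m\<close> whose cardinality is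
  the dimension; choosing an order of the labels gives the usual notion.\<close>

definition parallel_topform ::
  "'a::topological_space set \<Rightarrow> ('a \<Rightarrow> 'e::euclidean_space) \<Rightarrow>
   (('a \<Rightarrow> 'e) \<Rightarrow> ('a \<Rightarrow> 'e) \<Rightarrow> 'a \<Rightarrow> 'e) \<Rightarrow> ('a \<Rightarrow> ('m::finite \<Rightarrow> 'e) \<Rightarrow> real) \<Rightarrow> bool" where
  "parallel_topform M \<pi> nabla \<nu> \<longleftrightarrow>
     (\<forall>X Y. msmooth M \<pi> X \<and> (\<forall>i. msmooth M \<pi> (Y i)) \<longrightarrow>
        (\<forall>p\<in>M. mderiv M \<pi> (\<lambda>q. \<nu> q (\<lambda>j. Y j q)) p (X p)
           - (\<Sum>i\<in>UNIV. \<nu> p (\<lambda>j. if j = i then nabla X (Y i) p else Y j p)) = 0))"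

section \<open>Special Kaehler manifolds\<close>

text \<open>A complex structure is an almost complex structure for which there are holomorphic charts
  around every point.\<close>

definition complex_structure ::
  "'a::topological_space set \<Rightarrow> ('a \<Rightarrow> complex^'n) \<Rightarrow> ('a \<Rightarrow> complex^'n \<Rightarrow> complex^'n) \<Rightarrow> bool" where
  "complex_structure M \<pi> J \<longleftrightarrow> almost_complex M \<pi> J \<and>
     (\<forall>p\<in>M. \<exists>W (c :: 'a \<Rightarrow> complex^'n).
        openin (top_of_set M) W \<and> p \<in> W \<and> msmooth W \<pi> c \<and> inj_on c W \<and>
        (\<forall>q\<in>W. bij (mderiv W \<pi> c q) \<and> (\<forall>v. mderiv W \<pi> c q (J q v) = \<i> *s mderiv W \<pi> c q v)))"

definition kaehler_form :: "('a \<Rightarrow> 'e \<Rightarrow> 'e \<Rightarrow> real) \<Rightarrow> ('a \<Rightarrow> 'e \<Rightarrow> 'e) \<Rightarrow> 'a \<Rightarrow> 'e \<Rightarrow> 'e \<Rightarrow> real" where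
  "kaehler_form g J p v w = g p v (J p w)"

definition pseudo_kaehler ::
  "'a::topological_space set \<Rightarrow> ('a \<Rightarrow> complex^'n) \<Rightarrow> ('a \<Rightarrow> complex^'n \<Rightarrow> complex^'n) \<Rightarrow>
   ('a \<Rightarrow> complex^'n \<Rightarrow> complex^'n \<Rightarrow> real) \<Rightarrow> bool" where
  "pseudo_kaehler M \<pi> J g \<longleftrightarrow>
     etale_manifold M \<pi> \<and> complex_structure M \<pi> J \<and> pseudo_metric M \<pi> g \<and>
     (\<forall>p\<in>M. \<forall>v w. g p (J p v) (J p w) = g p v w) \<and> closed_2form M \<pi> (kaehler_form g J)"

definition special_kaehler ::
  "'a::topological_space set \<Rightarrow> ('a \<Rightarrow> complex^'n) \<Rightarrow> ('a \<Rightarrow> complex^'n \<Rightarrow> complex^'n) \<Rightarrow>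
   ('a \<Rightarrow> complex^'n \<Rightarrow> complex^'n \<Rightarrow> real) \<Rightarrow>
   (('a \<Rightarrow> complex^'n) \<Rightarrow> ('a \<Rightarrow> complex^'n) \<Rightarrow> 'a \<Rightarrow> complex^'n) \<Rightarrow> bool" where
  "special_kaehler M \<pi> J g nabla \<longleftrightarrow>
     pseudo_kaehler M \<pi> J g \<and>
     affine_connection M \<pi> nabla \<and> flat_connection M \<pi> nabla \<and> torsion_free M \<pi> nabla \<and>
     (\<forall>X Y. msmooth M \<pi> X \<and> msmooth M \<pi> Y \<longrightarrow>
        (\<forall>p\<in>M. nabla X (\<lambda>q. J q (Y q)) p - J p (nabla X Y p)
             = nabla Y (\<lambda>q. J q (X q)) p - J p (nabla Y X p))) \<and>
     parallel_2form M \<pi> nabla (kaehler_form g J)"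

section \<open>Affine hypersurfaces\<close>

text \<open>The ambient space of dimension \<open>m + 1\<close> is \<open>real^('m option)\<close>, where \<open>m\<close> is the cardinality of
  \<open>'m\<close> and \<open>None\<close> labels the last coordinate.\<close>

definition affine_hypersurface ::
  "'a::topological_space set \<Rightarrow> ('a \<Rightarrow> 'e::euclidean_space) \<Rightarrow> ('a \<Rightarrow> real^('m::finite option)) \<Rightarrow> bool" where
  "affine_hypersurface M \<pi> \<phi> \<longleftrightarrow>
     etale_manifold M \<pi> \<and> connected M \<and> CARD('m) = DIM('e) \<and> CARD('m) > 1 \<and>
     msmooth M \<pi> \<phi> \<and> (\<forall>p\<in>M. inj (mderiv M \<pi> \<phi> p))"

definition transversal ::
  "'a::topological_space set \<Rightarrow> ('a \<Rightarrow> 'e::euclidean_space) \<Rightarrow> ('a \<Rightarrow> real^('m::finite option)) \<Rightarrow>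
   ('a \<Rightarrow> real^('m option)) \<Rightarrow> bool" where
  "transversal M \<pi> \<phi> \<xi> \<longleftrightarrow> msmooth M \<pi> \<xi> \<and> (\<forall>p\<in>M. \<xi> p \<notin> range (mderiv M \<pi> \<phi> p))"

text \<open>Gauss formula: the left-hand side is the flat ambient derivative, along \<open>X\<close>, of the vector
  field \<open>Y\<close> pushed forward by \<open>\<phi>\<close>.\<close>

definition induced_data ::
  "'a::topological_space set \<Rightarrow> ('a \<Rightarrow> 'e::euclidean_space) \<Rightarrow> ('a \<Rightarrow> real^('m::finite option)) \<Rightarrow>
   ('a \<Rightarrow> real^('m option)) \<Rightarrow> (('a \<Rightarrow> 'e) \<Rightarrow> ('a \<Rightarrow> 'e) \<Rightarrow> 'a \<Rightarrow> 'e) \<Rightarrow>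
   ('a \<Rightarrow> 'e \<Rightarrow> 'e \<Rightarrow> real) \<Rightarrow> bool" where
  "induced_data M \<pi> \<phi> \<xi> nabla g \<longleftrightarrow>
     (\<forall>X Y. msmooth M \<pi> X \<and> msmooth M \<pi> Y \<longrightarrow>
        (\<forall>p\<in>M. mderiv M \<pi> (\<lambda>q. mderiv M \<pi> \<phi> q (Y q)) p (X p)
             = mderiv M \<pi> \<phi> p (nabla X Y p) + g p (X p) (Y p) *\<^sub>R \<xi> p))"

text \<open>\<open>vol (\<xi>, X\<^sub>1, \<dots>, X\<^sub>m)\<close>: the label \<open>None\<close> stands for the first argument of \<open>vol\<close>.\<close>

definition induced_volume ::
  "'a::topological_space set \<Rightarrow> ('a \<Rightarrow> 'e::euclidean_space) \<Rightarrow>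
   (('m::finite option \<Rightarrow> real^('m option)) \<Rightarrow> real) \<Rightarrow>
   ('a \<Rightarrow> real^('m option)) \<Rightarrow> ('a \<Rightarrow> real^('m option)) \<Rightarrow> 'a \<Rightarrow> ('m \<Rightarrow> 'e) \<Rightarrow> real" where
  "induced_volume M \<pi> vol \<phi> \<xi> p X = vol (case_option (\<xi> p) (\<lambda>i. mderiv M \<pi> \<phi> p (X i)))"

text \<open>An orientation is represented by a top-degree form \<open>\<mu>\<close> of which only the sign matters.\<close>

definition metric_volume ::
  "('a \<Rightarrow> ('m::finite \<Rightarrow> 'e) \<Rightarrow> real) \<Rightarrow> ('a \<Rightarrow> 'e \<Rightarrow> 'e \<Rightarrow> real) \<Rightarrow> 'a \<Rightarrow> ('m \<Rightarrow> 'e) \<Rightarrow> real" where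
  "metric_volume \<mu> g p X =
     sgn (\<mu> p X) * sqrt \<bar>det (\<chi> i j. g p (X i) (X j) :: real^'m^'m)\<bar>"

text \<open>\<open>\<xi>\<close> is the affine normal of the hypersurface \<open>\<phi>\<close>, with Blaschke metric \<open>g\<close> and induced
  connection \<open>nabla\<close>.\<close>

definition blaschke_structure ::
  "'a::topological_space set \<Rightarrow> ('a \<Rightarrow> 'e::euclidean_space) \<Rightarrow> ('a \<Rightarrow> ('m::finite \<Rightarrow> 'e) \<Rightarrow> real) \<Rightarrow>
   (('m option \<Rightarrow> real^('m option)) \<Rightarrow> real) \<Rightarrow> ('a \<Rightarrow> real^('m option)) \<Rightarrow> ('a \<Rightarrow> real^('m option)) \<Rightarrow>
   (('a \<Rightarrow> 'e) \<Rightarrow> ('a \<Rightarrow> 'e) \<Rightarrow> 'a \<Rightarrow> 'e) \<Rightarrow> ('a \<Rightarrow> 'e \<Rightarrow> 'e \<Rightarrow> real) \<Rightarrow> bool" where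
  "blaschke_structure M \<pi> \<mu> vol \<phi> \<xi> nabla g \<longleftrightarrow>
     affine_hypersurface M \<pi> \<phi> \<and> transversal M \<pi> \<phi> \<xi> \<and>
     affine_connection M \<pi> nabla \<and> torsion_free M \<pi> nabla \<and> pseudo_metric M \<pi> g \<and>
     induced_data M \<pi> \<phi> \<xi> nabla g \<and>
     (\<forall>p\<in>M. \<forall>X. induced_volume M \<pi> vol \<phi> \<xi> p X = metric_volume \<mu> g p X) \<and>
     parallel_topform M \<pi> nabla (induced_volume M \<pi> vol \<phi> \<xi>)"

definition parabolic_hypersphere ::
  "'a::topological_space set \<Rightarrow> ('a \<Rightarrow> 'e::euclidean_space) \<Rightarrow> ('a \<Rightarrow> ('m::finite \<Rightarrow> 'e) \<Rightarrow> real) \<Rightarrow>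
   (('m option \<Rightarrow> real^('m option)) \<Rightarrow> real) \<Rightarrow> ('a \<Rightarrow> real^('m option)) \<Rightarrow> ('a \<Rightarrow> real^('m option)) \<Rightarrow>
   (('a \<Rightarrow> 'e) \<Rightarrow> ('a \<Rightarrow> 'e) \<Rightarrow> 'a \<Rightarrow> 'e) \<Rightarrow> ('a \<Rightarrow> 'e \<Rightarrow> 'e \<Rightarrow> real) \<Rightarrow> bool" where
  "parabolic_hypersphere M \<pi> \<mu> vol \<phi> \<xi> nabla g \<longleftrightarrow>
     blaschke_structure M \<pi> \<mu> vol \<phi> \<xi> nabla g \<and> (\<forall>p\<in>M. \<forall>v. mderiv M \<pi> \<xi> p v = 0)"

definition special_parabolic_hypersphere ::
  "'a::topological_space set \<Rightarrow> ('a \<Rightarrow> 'e::euclidean_space) \<Rightarrow> ('a \<Rightarrow> ('m::finite \<Rightarrow> 'e) \<Rightarrow> real) \<Rightarrow>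
   (('m option \<Rightarrow> real^('m option)) \<Rightarrow> real) \<Rightarrow> ('a \<Rightarrow> real^('m option)) \<Rightarrow> ('a \<Rightarrow> real^('m option)) \<Rightarrow>
   (('a \<Rightarrow> 'e) \<Rightarrow> ('a \<Rightarrow> 'e) \<Rightarrow> 'a \<Rightarrow> 'e) \<Rightarrow> ('a \<Rightarrow> 'e \<Rightarrow> 'e \<Rightarrow> real) \<Rightarrow> ('a \<Rightarrow> 'e \<Rightarrow> 'e) \<Rightarrow> bool" where
  "special_parabolic_hypersphere M \<pi> \<mu> vol \<phi> \<xi> nabla g J \<longleftrightarrow>
     parabolic_hypersphere M \<pi> \<mu> vol \<phi> \<xi> nabla g \<and> almost_complex M \<pi> J \<and>
     (\<forall>p\<in>M. \<forall>v w. g p (J p v) w = - g p v (J p w)) \<and>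
     parallel_2form M \<pi> nabla (\<lambda>p v w. g p (J p v) w)"

section \<open>Objects attached to a holomorphic function on a Riemann domain\<close>

text \<open>The complex structure of \<open>M\<close> is the unique one for which the covering \<open>\<pi>\<close> is holomorphic.\<close>

definition riemann_domain :: "'a::topological_space set \<Rightarrow> ('a \<Rightarrow> complex^'n) \<Rightarrow> (complex^'n) set \<Rightarrow> bool" where
  "riemann_domain M \<pi> U \<longleftrightarrow> covering_space M \<pi> U \<and> connected M"

definition std_J :: "'a \<Rightarrow> complex^'n \<Rightarrow> complex^'n" where
  "std_J p v = \<i> *s v"

definition holomorphic_fun :: "'a::topological_space set \<Rightarrow> ('a \<Rightarrow> complex^'n) \<Rightarrow> ('a \<Rightarrow> complex) \<Rightarrow> bool" where
  "holomorphic_fun M \<pi> F \<longleftrightarrow>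
     (\<forall>p\<in>M. \<exists>D. has_mderiv M \<pi> F D p \<and> (\<forall>v. D (std_J p v) = \<i> * D v))"

text \<open>The derivative of a holomorphic function along the \<open>j\<close>-th unit vector is its complex partial
  derivative with respect to the \<open>j\<close>-th coordinate.\<close>

definition cpartial ::
  "'a::topological_space set \<Rightarrow> ('a \<Rightarrow> complex^'n) \<Rightarrow> ('a \<Rightarrow> complex) \<Rightarrow> 'n \<Rightarrow> 'a \<Rightarrow> complex" where
  "cpartial M \<pi> F j p = mderiv M \<pi> F p (axis j 1)"

definition nondegenerate_fun :: "'a::topological_space set \<Rightarrow> ('a \<Rightarrow> complex^'n) \<Rightarrow> ('a \<Rightarrow> complex) \<Rightarrow> bool" where
  "nondegenerate_fun M \<pi> F \<longleftrightarrow>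
     (\<forall>p\<in>M. invertible (\<chi> i j. Im (cpartial M \<pi> (cpartial M \<pi> F j) i p) :: real^'n^'n))"

text \<open>Points of the cotangent bundle are given by their canonical coordinates \<open>(z, w)\<close>; the value
  of \<open>lagr_imm\<close> at \<open>p\<close> is the differential of \<open>F\<close> at \<open>p\<close>, transported to the base by \<open>\<pi>\<close>.\<close>

definition lagr_imm ::
  "'a::topological_space set \<Rightarrow> ('a \<Rightarrow> complex^'n) \<Rightarrow> ('a \<Rightarrow> complex) \<Rightarrow> 'a \<Rightarrow> (complex^'n) \<times> (complex^'n)" where
  "lagr_imm M \<pi> F p = (\<pi> p, \<chi> j. cpartial M \<pi> F j p)"

definition herm_form :: "(complex^'n) \<times> (complex^'n) \<Rightarrow> (complex^'n) \<times> (complex^'n) \<Rightarrow> complex" where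
  "herm_form X Y = \<i> * (\<Sum>i\<in>UNIV. fst X $ i * cnj (snd Y $ i) - snd X $ i * cnj (fst Y $ i))"

definition metric_of ::
  "'a::topological_space set \<Rightarrow> ('a \<Rightarrow> complex^'n) \<Rightarrow> ('a \<Rightarrow> complex) \<Rightarrow>
   'a \<Rightarrow> complex^'n \<Rightarrow> complex^'n \<Rightarrow> real" where
  "metric_of M \<pi> F p v w =
     Re (herm_form (mderiv M \<pi> (lagr_imm M \<pi> F) p v) (mderiv M \<pi> (lagr_imm M \<pi> F) p w))"

definition x_coord ::
  "'a::topological_space set \<Rightarrow> ('a \<Rightarrow> complex^'n) \<Rightarrow> ('a \<Rightarrow> complex) \<Rightarrow> 'n \<Rightarrow> 'a \<Rightarrow> real" where
  "x_coord M \<pi> F i p = Re (fst (lagr_imm M \<pi> F p) $ i)"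

definition u_coord ::
  "'a::topological_space set \<Rightarrow> ('a \<Rightarrow> complex^'n) \<Rightarrow> ('a \<Rightarrow> complex) \<Rightarrow> 'n \<Rightarrow> 'a \<Rightarrow> real" where
  "u_coord M \<pi> F i p = Im (fst (lagr_imm M \<pi> F p) $ i)"

definition y_coord ::
  "'a::topological_space set \<Rightarrow> ('a \<Rightarrow> complex^'n) \<Rightarrow> ('a \<Rightarrow> complex) \<Rightarrow> 'n \<Rightarrow> 'a \<Rightarrow> real" where
  "y_coord M \<pi> F j p = Re (snd (lagr_imm M \<pi> F p) $ j)"

text \<open>The connection for which all \<open>x_coord i\<close> and \<open>y_coord j\<close> are affine: the equations below say
  that the covariant derivatives of the one-forms \<open>dx i\<close> and \<open>dy j\<close> vanish.\<close>

definition connection_of ::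
  "'a::topological_space set \<Rightarrow> ('a \<Rightarrow> complex^'n) \<Rightarrow> ('a \<Rightarrow> complex) \<Rightarrow>
   ('a \<Rightarrow> complex^'n) \<Rightarrow> ('a \<Rightarrow> complex^'n) \<Rightarrow> 'a \<Rightarrow> complex^'n" where
  "connection_of M \<pi> F X Y p = (THE v. \<forall>i.
     mderiv M \<pi> (\<lambda>q. mderiv M \<pi> (x_coord M \<pi> F i) q (Y q)) p (X p) - mderiv M \<pi> (x_coord M \<pi> F i) p v = 0 \<and>
     mderiv M \<pi> (\<lambda>q. mderiv M \<pi> (y_coord M \<pi> F i) q (Y q)) p (X p) - mderiv M \<pi> (y_coord M \<pi> F i) p v = 0)"

text \<open>Where the \<open>x_coord i\<close> and \<open>y_coord j\<close> form a coordinate system, that connection is well defined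
  and determined by this property.\<close>

definition xy_differential ::
  "'a::topological_space set \<Rightarrow> ('a \<Rightarrow> complex^'n) \<Rightarrow> ('a \<Rightarrow> complex) \<Rightarrow> 'a \<Rightarrow> complex^'n \<Rightarrow> real^('n + 'n)" where
  "xy_differential M \<pi> F p v =
     (\<chi> a. case a of Inl i \<Rightarrow> mderiv M \<pi> (x_coord M \<pi> F i) p v | Inr j \<Rightarrow> mderiv M \<pi> (y_coord M \<pi> F j) p v)"

lemma connection_of_parallel:
  fixes M :: "'a::topological_space set"
  assumes "\<forall>p\<in>M. bij (xy_differential M \<pi> F p)"
  shows "parallel_1form M \<pi> (connection_of M \<pi> F) (mderiv M \<pi> (x_coord M \<pi> F i))"
    and "parallel_1form M \<pi> (connection_of M \<pi> F) (mderiv M \<pi> (y_coord M \<pi> F i))"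
proof -
  define P where "P X Y p v \<longleftrightarrow> (\<forall>i.
     mderiv M \<pi> (\<lambda>q. mderiv M \<pi> (x_coord M \<pi> F i) q (Y q)) p (X p) - mderiv M \<pi> (x_coord M \<pi> F i) p v = 0 \<and>
     mderiv M \<pi> (\<lambda>q. mderiv M \<pi> (y_coord M \<pi> F i) q (Y q)) p (X p) - mderiv M \<pi> (y_coord M \<pi> F i) p v = 0)"
    for X Y p v
  have "P X Y p (connection_of M \<pi> F X Y p)" if "p \<in> M" for X Y p
  proof -
    have eq: "P X Y p v \<longleftrightarrow> xy_differential M \<pi> F p v =
      (\<chi> a. case a of Inl i \<Rightarrow> mderiv M \<pi> (\<lambda>q. mderiv M \<pi> (x_coord M \<pi> F i) q (Y q)) p (X p)
         | Inr j \<Rightarrow> mderiv M \<pi> (\<lambda>q. mderiv M \<pi> (y_coord M \<pi> F j) q (Y q)) p (X p))" for v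
      unfolding P_def xy_differential_def vec_eq_iff
      by (auto split: sum.splits)
    have "\<exists>!v. P X Y p v"
      unfolding eq using assms that by (auto simp: bij_iff)
    then have "P X Y p (THE v. P X Y p v)"
      by (rule theI')
    then show ?thesis
      unfolding connection_of_def P_def .
  qed
  then show "parallel_1form M \<pi> (connection_of M \<pi> F) (mderiv M \<pi> (x_coord M \<pi> F i))"
    and "parallel_1form M \<pi> (connection_of M \<pi> F) (mderiv M \<pi> (y_coord M \<pi> F i))"
    unfolding parallel_1form_def P_def by auto
qed

lemma connection_of_unique:
  fixes M :: "'a::topological_space set"
  assumes "p \<in> M" "inj (xy_differential M \<pi> F p)" "msmooth M \<pi> X" "msmooth M \<pi> Y"
    and "\<And>i. parallel_1form M \<pi> nabla (mderiv M \<pi> (x_coord M \<pi> F i))"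
    and "\<And>i. parallel_1form M \<pi> nabla (mderiv M \<pi> (y_coord M \<pi> F i))"
  shows "nabla X Y p = connection_of M \<pi> F X Y p"
  unfolding connection_of_def
proof (rule the_equality[symmetric], goal_cases)
  case 1
  show ?case using assms unfolding parallel_1form_def by blast
next
  case (2 v)
  have "xy_differential M \<pi> F p v = xy_differential M \<pi> F p (nabla X Y p)"
    using assms(1,3-) 2 unfolding xy_differential_def parallel_1form_def vec_eq_iff
    by (auto split: sum.splits)
  then show ?case using assms(2) by (auto dest: injD)
qed

text \<open>The form \<open>dx\<^sub>1 \<and> \<dots> \<and> dx\<^sub>n \<and> dy\<^sub>1 \<and> \<dots> \<and> dy\<^sub>n\<close>.\<close>

definition xy_orientation ::
  "'a::topological_space set \<Rightarrow> ('a \<Rightarrow> complex^'n) \<Rightarrow> ('a \<Rightarrow> complex) \<Rightarrow> 'a \<Rightarrow> ('n + 'n \<Rightarrow> complex^'n) \<Rightarrow> real" where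
  "xy_orientation M \<pi> F p X = det (\<chi> a b. xy_differential M \<pi> F p (X b) $ a)"

text \<open>The volume form \<open>2\<^sup>n det\<close> on the ambient space of dimension \<open>2n + 1\<close>. As an argument label
  \<open>None\<close> is the first one, as a coordinate label it is the last one; the two orders differ by a cyclic
  permutation of \<open>2n + 1\<close> elements, which is even, so the determinant of the matrix whose rows
  and columns carry the same labels has the correct sign.\<close>

definition ambient_volume :: "(('n::finite + 'n) option \<Rightarrow> real^(('n + 'n) option)) \<Rightarrow> real" where
  "ambient_volume X = 2 ^ CARD('n) * det (\<chi> a b. X b $ a)"

definition phi_F ::
  "'a::topological_space set \<Rightarrow> ('a \<Rightarrow> complex^'n) \<Rightarrow> ('a \<Rightarrow> complex) \<Rightarrow> 'a \<Rightarrow> real^(('n + 'n) option)" where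
  "phi_F M \<pi> F p = (\<chi> a. case a of
       Some (Inl i) \<Rightarrow> x_coord M \<pi> F i p
     | Some (Inr j) \<Rightarrow> y_coord M \<pi> F j p
     | None \<Rightarrow> 2 * Im (F p) - 2 * (\<Sum>k\<in>UNIV. y_coord M \<pi> F k p * u_coord M \<pi> F k p))"

definition unimodular_affine :: "(real^'k \<Rightarrow> real^'k) \<Rightarrow> bool" where
  "unimodular_affine A \<longleftrightarrow> (\<exists>B b. det B = 1 \<and> A = (\<lambda>x. B *v x + b))"

end

theory Submission
  imports Defs "HOL-Complex_Analysis.Cauchy_Integral_Formula"
begin

text \<open>
  Everything happens in the flat coordinates \<open>(x, y) = (Re z, Re F\<^sub>z)\<close>. Their differential is, with
  \<open>v = a + \<i> b\<close>, the map \<open>A p v = (a, Re (\<partial>\<^sup>2F) a - Im (\<partial>\<^sup>2F) b)\<close>, which is bijective exactly because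
  \<open>Im \<partial>\<^sup>2F\<close> is invertible (\<open>A_eq_iff\<close>). The connection is differentiation in these coordinates:
  \<open>A (\<nabla>\<^sub>X Y) = D\<^sub>X (A Y)\<close> (\<open>A_nabla\<close>). The only other ingredients are that the derivatives of \<open>F\<close> of orders
  two and three are symmetric and complex linear.

  For the special Kaehler structure, symmetry of \<open>\<partial>\<^sup>2F\<close> gives \<open>\<omega> = 2 \<Sum> dx \<and> dy\<close>
  (\<open>kaehler_form_eq\<close>), a form with constant coefficients, hence parallel and closed. The
  connection differs from differentiation in the holomorphic coordinates, in which \<open>J\<close> is constant, by
  a term linear in the third derivatives of \<open>F\<close>; their symmetry makes it torsion free and \<open>\<nabla>J\<close>
  symmetric. Flatness is the commutation of second derivatives.

  For the hypersurface, the height \<open>h = 2 Im F - 2 \<Sum> y u\<close> is a partial Legendre transform with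
  \<open>dh = 2 \<Sum> v dx - u dy\<close>, where \<open>u = Im z\<close> and \<open>v = Im F\<^sub>z\<close> (\<open>mderiv_phi_F\<close>). So the hypersurface is locally
  the graph of \<open>h\<close> over the flat coordinates, and the second derivative of \<open>h\<close> in them is
  \<open>2 \<Sum> dv dx - du dy\<close>, which is \<open>g\<close>. This is the Gauss formula with transversal field
  \<open>\<partial>\<^bsub>2n+1\<^esub>\<close> (\<open>gauss_formula_phi_F\<close>). The induced volume is \<open>2\<^sup>n\<close> times the coordinate volume, and so is
  the metric volume, since \<open>g\<close> arises from \<open>2 \<Sum> dx \<and> dy\<close> by inserting a complex structure
  (\<open>abs_det_metric\<close>).

  For uniqueness, any other such hypersurface \<open>\<psi>\<close> solves the same linear Gauss equation with a constant
  normal \<open>\<xi>\<close>. Along the parallel frame the vector \<open>d\<psi> - dh \<otimes> \<xi>\<close> is then constant, which provides a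
  linear map taking \<open>d\<phi>\<close> to \<open>d\<psi>\<close>; equality of volumes forces determinant one (\<open>affine_congruence\<close>).

  Underneath lies the regularity theory of holomorphic functions of several variables, whose
  derivatives are controlled by Cauchy's formula on complex lines
  (\<open>complex_differentiable_directional_derivative\<close>), and Schwarz's theorem
  (\<open>symmetric_second_derivative\<close>).
\<close>

section \<open>Symmetry of second derivatives\<close>

text \<open>Applying the mean value theorem once in direction \<open>u\<close> and once in direction \<open>v\<close> turns the
  second difference into a value of the iterated derivative, which is then compared with the one
  obtained in the opposite order, since the second difference itself is symmetric in \<open>u\<close> and \<open>v\<close>.\<close>

lemma second_difference_mean_value:
  fixes f :: "'e::real_normed_vector \<Rightarrow> real"
  assumes f: "\<And>x. x \<in> ball z r \<Longrightarrow> (f has_derivative D x) (at x)"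
    and Df: "\<And>x. x \<in> ball z r \<Longrightarrow> ((\<lambda>x. D x u) has_derivative D2 x) (at x)"
    and s: "s > 0" "s * (norm u + norm v) < r"
  obtains x where "x \<in> ball z r"
    "f (z + s *\<^sub>R u + s *\<^sub>R v) - f (z + s *\<^sub>R u) - f (z + s *\<^sub>R v) + f z = s\<^sup>2 * D2 x v"
proof -
  have in_ball: "z + a *\<^sub>R u + b *\<^sub>R v \<in> ball z r" if "0 \<le> a" "a \<le> s" "0 \<le> b" "b \<le> s" for a b
  proof -
    have "norm (a *\<^sub>R u + b *\<^sub>R v) \<le> a * norm u + b * norm v"
      using that by (intro norm_triangle_le) auto
    also have "\<dots> \<le> s * norm u + s * norm v"
      using that by (intro add_mono mult_right_mono) auto
    also have "\<dots> < r" using s(2) by (simp add: distrib_left)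
    finally have "norm (a *\<^sub>R u + b *\<^sub>R v) < r" .
    moreover have "dist z (z + w) = norm w" for w by (simp add: dist_norm)
    ultimately show ?thesis by (simp add: add.assoc)
  qed
  have "DERIV (\<lambda>a. f (z + a *\<^sub>R u + s *\<^sub>R v) - f (z + a *\<^sub>R u + 0 *\<^sub>R v)) a :>
      D (z + a *\<^sub>R u + s *\<^sub>R v) u - D (z + a *\<^sub>R u + 0 *\<^sub>R v) u" if a: "0 \<le> a" "a \<le> s" for a
  proof -
    have *: "((\<lambda>a. f (z + a *\<^sub>R u + b *\<^sub>R v)) has_real_derivative D (z + a *\<^sub>R u + b *\<^sub>R v) u) (at a)"
      if "0 \<le> b" "b \<le> s" for b
    proof -
      have lin: "linear (D (z + a *\<^sub>R u + b *\<^sub>R v))"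
        using f[OF in_ball[OF a that]] by (rule has_derivative_linear)
      have "((\<lambda>a. z + a *\<^sub>R u + b *\<^sub>R v) has_derivative (\<lambda>h. h *\<^sub>R u)) (at a)"
        by (auto intro!: derivative_eq_intros)
      from has_derivative_compose[OF this f[OF in_ball[OF a that]]]
      show ?thesis
        unfolding has_field_derivative_def
        by (rule has_derivative_eq_rhs) (auto simp: linear_cmul[OF lin])
    qed
    show ?thesis using s a by (intro derivative_intros *) auto
  qed
  from MVT2[OF s(1) this] obtain a where a: "0 < a" "a < s" and
    e1: "f (z + s *\<^sub>R u + s *\<^sub>R v) - f (z + s *\<^sub>R u) - (f (z + s *\<^sub>R v) - f z) =
      s * (D (z + a *\<^sub>R u + s *\<^sub>R v) u - D (z + a *\<^sub>R u) u)"
    by auto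
  have "DERIV (\<lambda>b. D (z + a *\<^sub>R u + b *\<^sub>R v) u) b :> D2 (z + a *\<^sub>R u + b *\<^sub>R v) v"
    if b: "0 \<le> b" "b \<le> s" for b
  proof -
    have mem: "z + a *\<^sub>R u + b *\<^sub>R v \<in> ball z r" using in_ball a b by auto
    have lin: "linear (D2 (z + a *\<^sub>R u + b *\<^sub>R v))"
      using Df[OF mem] by (rule has_derivative_linear)
    have "((\<lambda>b. z + a *\<^sub>R u + b *\<^sub>R v) has_derivative (\<lambda>h. h *\<^sub>R v)) (at b)"
      by (auto intro!: derivative_eq_intros)
    from has_derivative_compose[OF this Df[OF mem]]
    show ?thesis
      unfolding has_field_derivative_def
      by (rule has_derivative_eq_rhs) (auto simp: linear_cmul[OF lin])
  qed
  from MVT2[OF s(1) this] obtain b where b: "0 < b" "b < s" and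
    e2: "D (z + a *\<^sub>R u + s *\<^sub>R v) u - D (z + a *\<^sub>R u) u = s * D2 (z + a *\<^sub>R u + b *\<^sub>R v) v"
    by auto
  show thesis
  proof
    show "z + a *\<^sub>R u + b *\<^sub>R v \<in> ball z r" using in_ball a b by auto
    show "f (z + s *\<^sub>R u + s *\<^sub>R v) - f (z + s *\<^sub>R u) - f (z + s *\<^sub>R v) + f z
      = s\<^sup>2 * D2 (z + a *\<^sub>R u + b *\<^sub>R v) v"
      using e1 e2 by (simp add: power2_eq_square algebra_simps)
  qed
qed

lemma eq_if_attained_arbitrarily_close:
  fixes a b :: "'e::metric_space \<Rightarrow> real"
  assumes "isCont a z" "isCont b z"
    and close: "\<And>r. r > 0 \<Longrightarrow> \<exists>x y. dist x z < r \<and> dist y z < r \<and> a x = b y"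
  shows "a z = b z"
proof (rule ccontr)
  assume "a z \<noteq> b z"
  define e where "e = \<bar>a z - b z\<bar> / 2"
  have "e > 0" using \<open>a z \<noteq> b z\<close> by (auto simp: e_def)
  obtain d1 where d1: "d1 > 0" "\<And>x. dist x z < d1 \<Longrightarrow> dist (a x) (a z) < e"
    using assms(1) \<open>e > 0\<close> by (auto simp: continuous_at_eps_delta)
  obtain d2 where d2: "d2 > 0" "\<And>x. dist x z < d2 \<Longrightarrow> dist (b x) (b z) < e"
    using assms(2) \<open>e > 0\<close> by (auto simp: continuous_at_eps_delta)
  obtain x y where "dist x z < min d1 d2" "dist y z < min d1 d2" "a x = b y"
    using close[of "min d1 d2"] d1 d2 by auto
  with d1(2)[of x] d2(2)[of y] have "\<bar>b y - a z\<bar> < e" "\<bar>b y - b z\<bar> < e"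
    by (auto simp: dist_real_def)
  moreover have "\<bar>a z - b z\<bar> \<le> \<bar>b y - a z\<bar> + \<bar>b y - b z\<bar>" by arith
  moreover have "2 * e = \<bar>a z - b z\<bar>" by (simp add: e_def)
  ultimately show False by (smt (verit))
qed

text \<open>Schwarz's theorem: both iterated derivatives take, arbitrarily close to \<open>z\<close>, the value of one and
  the same second difference quotient, so continuity makes them equal at \<open>z\<close>.\<close>

lemma symmetric_second_derivative_real:
  fixes f :: "'e::real_normed_vector \<Rightarrow> real"
  assumes "open S" "z \<in> S"
    and f: "\<And>x. x \<in> S \<Longrightarrow> (f has_derivative D x) (at x)"
    and u: "\<And>x. x \<in> S \<Longrightarrow> ((\<lambda>x. D x u) has_derivative Du x) (at x)"
    and v: "\<And>x. x \<in> S \<Longrightarrow> ((\<lambda>x. D x v) has_derivative Dv x) (at x)"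
    and "isCont (\<lambda>x. Du x v) z" "isCont (\<lambda>x. Dv x u) z"
  shows "Du z v = Dv z u"
proof (rule eq_if_attained_arbitrarily_close[where a = "\<lambda>x. Du x v" and b = "\<lambda>x. Dv x u" and z = z])
  fix r :: real assume "r > 0"
  obtain r0 where r0: "r0 > 0" "ball z r0 \<subseteq> S"
    using assms(1,2) openE by blast
  define r' where "r' = min r r0"
  have r': "r' > 0" "ball z r' \<subseteq> S" "r' \<le> r" using r0 \<open>r > 0\<close> by (auto simp: r'_def)
  \<comment> \<open>the summand 1 avoids division by zero when both directions vanish\<close>
  define s where "s = r' / (2 * (norm u + norm v + 1))"
  have "norm u + norm v + 1 > 0" by (auto intro: add_nonneg_pos)
  then have "s > 0" using r' by (auto simp: s_def)
  have "s * (norm u + norm v) < s * (2 * (norm u + norm v + 1))"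
    using \<open>s > 0\<close> by (intro mult_strict_left_mono) (auto simp: add_nonneg_pos)
  also have "\<dots> = r'" using \<open>norm u + norm v + 1 > 0\<close> by (simp add: s_def)
  finally have s: "s * (norm u + norm v) < r'" .
  obtain x where x: "x \<in> ball z r'" and
    "f (z + s *\<^sub>R u + s *\<^sub>R v) - f (z + s *\<^sub>R u) - f (z + s *\<^sub>R v) + f z = s\<^sup>2 * Du x v"
    by (rule second_difference_mean_value[of z r' f D u Du s v]) (use f u r' s \<open>s > 0\<close> in auto)
  moreover obtain y where y: "y \<in> ball z r'" and
    "f (z + s *\<^sub>R v + s *\<^sub>R u) - f (z + s *\<^sub>R v) - f (z + s *\<^sub>R u) + f z = s\<^sup>2 * Dv y u"
    by (rule second_difference_mean_value[of z r' f D v Dv s u])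
       (use f v r' s \<open>s > 0\<close> in \<open>auto simp: add.commute\<close>)
  moreover have "f (z + s *\<^sub>R v + s *\<^sub>R u) = f (z + s *\<^sub>R u + s *\<^sub>R v)"
    by (simp add: algebra_simps)
  ultimately have "s\<^sup>2 * Du x v = s\<^sup>2 * Dv y u" by linarith
  with \<open>s > 0\<close> have "Du x v = Dv y u" by simp
  with x y r'(3) show "\<exists>x y. dist x z < r \<and> dist y z < r \<and> Du x v = Dv y u"
    by (force simp: dist_commute)
qed fact+

lemma symmetric_second_derivative:
  fixes f :: "'e::real_normed_vector \<Rightarrow> 'b::euclidean_space"
  assumes "open S" "z \<in> S"
    and f: "\<And>x. x \<in> S \<Longrightarrow> (f has_derivative D x) (at x)"
    and u: "\<And>x. x \<in> S \<Longrightarrow> ((\<lambda>x. D x u) has_derivative Du x) (at x)"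
    and v: "\<And>x. x \<in> S \<Longrightarrow> ((\<lambda>x. D x v) has_derivative Dv x) (at x)"
    and "isCont (\<lambda>x. Du x v) z" "isCont (\<lambda>x. Dv x u) z"
  shows "Du z v = Dv z u"
proof (rule euclidean_eqI)
  fix b :: 'b assume "b \<in> Basis"
  show "Du z v \<bullet> b = Dv z u \<bullet> b"
    by (rule symmetric_second_derivative_real[where S = S and f = "\<lambda>x. f x \<bullet> b" and D = "\<lambda>x h. D x h \<bullet> b"
        and Du = "\<lambda>x h. Du x h \<bullet> b" and Dv = "\<lambda>x h. Dv x h \<bullet> b"])
      (use assms in \<open>auto intro!: has_derivative_inner_left continuous_intros\<close>)
qed

section \<open>Directional derivatives of holomorphic functions\<close>

text \<open>Cauchy's formula for the first derivative at the centre of a circle, written as an integral over a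
  real parameter so that the theorems on parameter-dependent integrals apply to it.\<close>

lemma deriv_circle_mean:
  fixes f :: "complex \<Rightarrow> complex"
  assumes "continuous_on (cball 0 r) f" "f holomorphic_on ball 0 r" "r > 0"
  shows "((\<lambda>t. f (r * exp (2 * of_real pi * \<i> * of_real t)) / (r * exp (2 * of_real pi * \<i> * of_real t)))
    has_integral deriv f 0) {0..1}"
proof -
  have "((\<lambda>u. f u / (u - 0) ^ Suc 1) has_contour_integral (2 * pi * \<i> / fact 1 * (deriv ^^ 1) f 0)) (circlepath 0 r)"
    by (rule Cauchy_has_contour_integral_higher_derivative_circlepath) (use assms in auto)
  then have "((\<lambda>u. f u / u\<^sup>2) has_contour_integral (2 * pi * \<i> * deriv f 0)) (circlepath 0 r)"
    by (simp add: numeral_2_eq_2)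
  then have "((\<lambda>t. f (circlepath 0 r t) / (circlepath 0 r t)\<^sup>2 *
      vector_derivative (circlepath 0 r) (at t within {0..1})) has_integral 2 * pi * \<i> * deriv f 0) {0..1}"
    by (simp add: has_contour_integral_def)
  then have "((\<lambda>t. 1 / (2 * pi * \<i>) * (f (circlepath 0 r t) / (circlepath 0 r t)\<^sup>2 *
      vector_derivative (circlepath 0 r) (at t within {0..1}))) has_integral
      1 / (2 * pi * \<i>) * (2 * pi * \<i> * deriv f 0)) {0..1}"
    by (rule has_integral_mult_right)
  then have "((\<lambda>t. 1 / (2 * pi * \<i>) * (f (circlepath 0 r t) / (circlepath 0 r t)\<^sup>2 *
      vector_derivative (circlepath 0 r) (at t within {0..1}))) has_integral deriv f 0) {0..1}"
    by simp
  moreover have "1 / (2 * pi * \<i>) * (f (circlepath 0 r t) / (circlepath 0 r t)\<^sup>2 *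
      vector_derivative (circlepath 0 r) (at t within {0..1})) =
      f (r * exp (2 * of_real pi * \<i> * of_real t)) / (r * exp (2 * of_real pi * \<i> * of_real t))"
    if "t \<in> {0..1}" for t
  proof -
    have "vector_derivative (circlepath 0 r) (at t within {0..1}) = 2 * pi * \<i> * circlepath 0 r t"
      using that by (subst vector_derivative_circlepath01) (auto simp: circlepath)
    moreover have "circlepath 0 r t \<noteq> 0" using \<open>r > 0\<close> by (simp add: circlepath)
    ultimately have "1 / (2 * pi * \<i>) * (f (circlepath 0 r t) / (circlepath 0 r t)\<^sup>2 *
      vector_derivative (circlepath 0 r) (at t within {0..1})) = f (circlepath 0 r t) / circlepath 0 r t"
      by (simp add: power2_eq_square field_simps)
    then show ?thesis by (simp add: circlepath)
  qed
  ultimately show ?thesis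
    by (rule has_integral_eq[rotated])
qed

lemma complex_linear_scale:
  fixes L :: "complex^'n \<Rightarrow> complex"
  assumes "linear L" "\<And>v. L (\<i> *s v) = \<i> * L v"
  shows "L (a *s v) = a * L v"
proof -
  have "a *s v = Re a *\<^sub>R v + Im a *\<^sub>R (\<i> *s v)"
    by (auto simp: vec_eq_iff complex_eq_iff)
  then have "L (a *s v) = Re a *\<^sub>R L v + Im a *\<^sub>R (\<i> * L v)"
    using assms by (simp add: linear_add linear_cmul)
  also have "\<dots> = a * L v" by (auto simp: complex_eq_iff)
  finally show ?thesis .
qed

lemma complex_linear_expand:
  fixes L :: "complex^'n \<Rightarrow> complex"
  assumes "linear L" "\<And>v. L (\<i> *s v) = \<i> * L v"
  shows "L v = (\<Sum>k\<in>UNIV. v $ k * L (axis k 1))"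
proof -
  have "v = (\<Sum>k\<in>UNIV. v $ k *s axis k 1)" by (simp add: basis_expansion)
  then have "L v = L (\<Sum>k\<in>UNIV. v $ k *s axis k 1)" by simp
  also have "\<dots> = (\<Sum>k\<in>UNIV. L (v $ k *s axis k 1))" by (rule linear_sum[OF assms(1)])
  finally show ?thesis by (simp only: complex_linear_scale[OF assms])
qed

text \<open>The several-variable analogue of "derivatives of holomorphic functions are holomorphic", starting
  from mere differentiability. On every complex line Cauchy's formula expresses \<open>D x v\<close> as an
  integral of values of \<open>f\<close>. As \<open>f\<close> is continuous, all \<open>\<lambda>x. D x w\<close> are continuous; this in turn
  permits differentiation under the integral sign, and the resulting integral of the maps \<open>D x\<close> is
  again complex linear.\<close>

lemma complex_differentiable_directional_derivative:
  fixes f :: "complex^'n \<Rightarrow> complex"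
  assumes S: "open S"
    and f: "\<And>x. x \<in> S \<Longrightarrow> (f has_derivative D x) (at x)"
    and D: "\<And>x v. x \<in> S \<Longrightarrow> D x (\<i> *s v) = \<i> * D x v"
    and z: "z \<in> S"
  obtains D' where "((\<lambda>x. D x v) has_derivative D') (at z)" "\<And>w. D' (\<i> *s w) = \<i> * D' w"
proof -
  define c where "c t = exp (2 * of_real pi * \<i> * of_real t)" for t
  have c [simp]: "cmod (c t) = 1" "c t \<noteq> 0" for t
    by (auto simp: c_def)
  have c_cont [continuous_intros]: "continuous_on A g \<Longrightarrow> continuous_on A (\<lambda>x. c (g x))" for A and g :: "'b::topological_space \<Rightarrow> real"
    unfolding c_def by (intro continuous_intros)
  have lin: "linear (D x)" if "x \<in> S" for x
    using f[OF that] by (rule has_derivative_linear)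
  have D_scale: "D x (a *s v) = a * D x v" if "x \<in> S" for x a v
    by (rule complex_linear_scale[OF lin[OF that] D[OF that]])
  have norm_cv: "norm (a *s w) = cmod a * norm w" for a and w :: "complex^'n"
    by (simp add: norm_vec_def norm_mult L2_set_right_distrib)
  have bl: "bounded_linear (\<lambda>a. a *s w)" for w :: "complex^'n"
  proof (rule bounded_linear_intro[where K = "norm w"])
    show "norm (a *s w) \<le> norm a * norm w" for a by (simp add: norm_cv)
  qed (simp_all add: vec_eq_iff algebra_simps)
  note scont [continuous_intros] = bounded_linear.continuous_on[OF bl]
  have f_cont: "continuous_on S f"
    by (rule has_derivative_continuous_on, rule has_derivative_at_withinI, rule f)
  have key: "D x w = integral {0..1} (\<lambda>t. f (x + (r * c t) *s w) / (r * c t))"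
    "(\<lambda>t. f (x + (r * c t) *s w) / (r * c t)) integrable_on {0..1}"
    if "r > 0" "cball x (r * norm w) \<subseteq> S" for x w and r :: real
  proof -
    have mem: "x + a *s w \<in> S" if "cmod a \<le> r" for a
      using \<open>cball x (r * norm w) \<subseteq> S\<close> that
      by (intro subsetD[OF \<open>cball x _ \<subseteq> S\<close>]) (auto simp: dist_norm norm_cv mult_right_mono)
    have "((\<lambda>a. f (x + a *s w)) has_field_derivative D (x + a *s w) w) (at a)" if "cmod a \<le> r" for a
    proof -
      have "((\<lambda>a. x + a *s w) has_derivative (\<lambda>h. h *s w)) (at a)"
        using has_derivative_add[OF has_derivative_const bounded_linear_imp_has_derivative[OF bl]] by simp
      from has_derivative_compose[OF this f[OF mem[OF that]]]
      show ?thesis unfolding has_field_derivative_def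
        by (rule has_derivative_eq_rhs) (auto simp: D_scale[OF mem[OF that]] mult.commute)
    qed note der = this
    have "((\<lambda>t. f (x + (r * c t) *s w) / (r * c t)) has_integral deriv (\<lambda>a. f (x + a *s w)) 0) {0..1}"
      unfolding c_def
    proof (rule deriv_circle_mean[where f = "\<lambda>a. f (x + a *s w)"])
      show "continuous_on (cball 0 r) (\<lambda>a. f (x + a *s w))"
        by (rule DERIV_continuous_on, rule has_field_derivative_at_within, rule der) simp
      show "(\<lambda>a. f (x + a *s w)) holomorphic_on ball 0 r"
        unfolding holomorphic_on_def field_differentiable_def
        by (intro ballI exI, rule has_field_derivative_at_within, rule der) simp
    qed fact
    moreover have "deriv (\<lambda>a. f (x + a *s w)) 0 = D x w"
      using DERIV_imp_deriv[OF der[of 0]] \<open>r > 0\<close> by simp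
    ultimately show "D x w = integral {0..1} (\<lambda>t. f (x + (r * c t) *s w) / (r * c t))"
      "(\<lambda>t. f (x + (r * c t) *s w) / (r * c t)) integrable_on {0..1}"
      by (auto dest: integral_unique)
  qed
  have room: "\<exists>e r::real. e > 0 \<and> r > 0 \<and> (\<forall>x\<in>ball y e. cball x (r * norm w) \<subseteq> S)"
    if y: "y \<in> S" for y and w :: "complex^'n"
  proof -
    obtain d where d: "d > 0" "ball y d \<subseteq> S" using openE[OF S y] by blast
    \<comment> \<open>a radius such that the discs in direction \<open>w\<close> around all points near \<open>y\<close> stay in \<open>S\<close>\<close>
    define r where "r = d / 4 / (norm w + 1)"
    have "norm w + 1 > 0" by (auto intro: add_nonneg_pos)
    then have r: "r > 0" using d by (auto simp: r_def)
    have "r * norm w \<le> r * (norm w + 1)" using r by simp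
    also have "\<dots> = d / 4" using nonzero_eq_divide_eq[THEN iffD1, OF _ r_def] \<open>norm w + 1 > 0\<close> by simp
    finally have "r * norm w \<le> d / 4" .
    then have "cball x (r * norm w) \<subseteq> ball y d" if "x \<in> ball y (d/2)" for x
    proof -
      have "dist y u < d" if "dist x u \<le> r * norm w" for u
        using dist_triangle[of y u x] \<open>x \<in> ball y (d/2)\<close> that \<open>r * norm w \<le> d / 4\<close> \<open>d > 0\<close>
        by auto
      then show ?thesis by auto
    qed
    then have "\<forall>x\<in>ball y (d/2). cball x (r * norm w) \<subseteq> S"
      using d(2) by (meson order_trans)
    moreover have "d / 2 > 0" using d by simp
    ultimately show ?thesis using r by blast
  qed
  have D_cont: "continuous_on S (\<lambda>x. D x w)" for w
  proof -
    have "isCont (\<lambda>x. D x w) y" if y: "y \<in> S" for y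
    proof -
      obtain e r :: real where er: "e > 0" "r > 0" "\<And>x. x\<in>ball y e \<Longrightarrow> cball x (r * norm w) \<subseteq> S"
        using room[OF y, of w] by blast
      have mem: "x + (r * c t) *s w \<in> S" if "x \<in> ball y e" for x t
        using er(3)[OF that] \<open>r > 0\<close> by (auto simp: subset_iff dist_norm norm_cv norm_mult)
      have "continuous_on (ball y e) (\<lambda>x. integral (cbox 0 1) (\<lambda>t. f (x + (r * c t) *s w) / (r * c t)))"
        using \<open>r > 0\<close> mem
        unfolding split_beta
        by (intro integral_continuous_on_param) (auto simp: split_beta intro!: continuous_intros continuous_on_compose2[OF f_cont])
      then have "continuous_on (ball y e) (\<lambda>x. D x w)"
        by (rule continuous_on_eq) (use key(1) er in auto)
      then show ?thesis
        using er(1) by (simp add: continuous_on_eq_continuous_at)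
    qed
    then show ?thesis by (simp add: continuous_at_imp_continuous_on)
  qed
  obtain e r :: real where er: "e > 0" "r > 0" "\<And>x. x\<in>ball z e \<Longrightarrow> cball x (r * norm v) \<subseteq> S"
    using room[OF z, of v] by blast
  have mem: "x + (r * c t) *s v \<in> S" if "x \<in> ball z e" for x t
    using er(3)[OF that] \<open>r > 0\<close> by (auto simp: subset_iff dist_norm norm_cv norm_mult)
  define B where "B x = Blinfun (D x)" for x
  have B: "blinfun_apply (B x) = D x" if "x \<in> S" for x
    unfolding B_def using f[OF that]
    by (intro bounded_linear_Blinfun_apply has_derivative_bounded_linear)
  have B_cont: "continuous_on S B"
  proof (rule continuous_on_blinfun_componentwise)
    fix i :: "complex^'n"
    show "continuous_on S (\<lambda>x. blinfun_apply (B x) i)"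
      by (rule continuous_on_eq[OF D_cont[of i]]) (simp add: B)
  qed

  define G where "G x t = blinfun_mult_right (1 / (r * c t)) o\<^sub>L B (x + (r * c t) *s v)" for x t
  have G: "blinfun_apply (G x t) h = D (x + (r * c t) *s v) h / (r * c t)" if "x \<in> ball z e" for x t h
    using mem[OF that] by (simp add: G_def B)
  have G_cont: "continuous_on (ball z e \<times> cbox 0 1) (\<lambda>(x, t). G x t)"
    using \<open>r > 0\<close> mem unfolding split_beta G_def
    by (auto intro!: continuous_intros continuous_on_compose2[OF B_cont]
        bounded_linear.continuous_on[OF bounded_linear_blinfun_mult_right])
  have "((\<lambda>x. integral (cbox 0 1) (\<lambda>t. f (x + (r * c t) *s v) / (r * c t))) has_derivative
      blinfun_apply (integral (cbox 0 1) (G z))) (at z within ball z e)"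
  proof (rule leibniz_rule)
    fix x and t :: real assume x: "x \<in> ball z e"
    have "((\<lambda>x. x + (r * c t) *s v) has_derivative (\<lambda>h. h)) (at x)"
      by (auto intro!: derivative_eq_intros)
    from has_derivative_compose[OF this f[OF mem[OF x]]]
    have "((\<lambda>x. f (x + (r * c t) *s v)) has_derivative D (x + (r * c t) *s v)) (at x)" .
    then have "((\<lambda>x. f (x + (r * c t) *s v) / (r * c t)) has_derivative
      (\<lambda>h. D (x + (r * c t) *s v) h / (r * c t))) (at x)"
      unfolding divide_inverse by (rule has_derivative_mult_left)
    then show "((\<lambda>x. f (x + (r * c t) *s v) / (r * c t)) has_derivative blinfun_apply (G x t)) (at x within ball z e)"
      by (rule has_derivative_at_withinI[OF has_derivative_eq_rhs]) (simp add: G[OF x] fun_eq_iff)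
  next
    fix x assume "x \<in> ball z e"
    then show "(\<lambda>t. f (x + (r * c t) *s v) / (r * c t)) integrable_on cbox 0 1"
      using key(2) er by auto
  qed (use er(1) G_cont in auto)
  then have "((\<lambda>x. D x v) has_derivative blinfun_apply (integral (cbox 0 1) (G z))) (at z within ball z e)"
    by (rule has_derivative_transform[rotated 2]) (use key(1) er in auto)
  then have deriv: "((\<lambda>x. D x v) has_derivative blinfun_apply (integral (cbox 0 1) (G z))) (at z)"
    using er(1) by (simp add: at_within_open[of z "ball z e"])
  have "continuous_on (cbox 0 1) (G z)"
  proof -
    have "continuous_on (cbox 0 1) (\<lambda>t::real. (z, t))" by (intro continuous_intros)
    then have "continuous_on (cbox 0 1) (\<lambda>t. case (z, t) of (x, t) \<Rightarrow> G x t)"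
      by (rule continuous_on_compose2[OF G_cont]) (use er(1) in auto)
    then show ?thesis by simp
  qed
  then have int: "G z integrable_on cbox 0 1" by (rule integrable_continuous)
  have app: "blinfun_apply (integral (cbox 0 1) (G z)) w = integral (cbox 0 1) (\<lambda>t. G z t w)" for w
    using integral_linear[OF int, of "\<lambda>b. blinfun_apply b w"]
    by (simp add: o_def blinfun.bounded_linear_left)
  have z': "z \<in> ball z e" using er(1) by simp
  show thesis
  proof
    show "blinfun_apply (integral (cbox 0 1) (G z)) (\<i> *s w) =
        \<i> * blinfun_apply (integral (cbox 0 1) (G z)) w" for w
      unfolding app G[OF z'] D[OF mem[OF z']] times_divide_eq_right[symmetric]
      by (rule integral_mult_right)
  qed (rule deriv)
qed

section \<open>Determinants\<close>

text \<open>The determinant is multilinear in its columns, so the product rule of the Leibniz expansion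
  regroups into one determinant for each column.\<close>

lemma has_derivative_det:
  fixes W :: "'m::finite \<Rightarrow> 'e::real_normed_vector \<Rightarrow> real^'m"
  assumes "\<And>j. (W j has_derivative W' j) (at x)"
  shows "((\<lambda>x. det (\<chi> a b. W b x $ a)) has_derivative
    (\<lambda>h. \<Sum>i\<in>UNIV. det (\<chi> a b. (if b = i then W' i h else W b x) $ a))) (at x)"
proof -
  have tr: "det (\<chi> a b. V b $ a) = (\<Sum>p | p permutes UNIV. of_int (sign p) * (\<Prod>b\<in>UNIV. V b $ p b))"
    for V :: "'m \<Rightarrow> real^'m"
    by (subst det_transpose[symmetric]) (simp add: det_def transpose_def)
  have "((\<lambda>x. \<Sum>p | p permutes UNIV. of_int (sign p) * (\<Prod>b\<in>UNIV. W b x $ p b)) has_derivative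
    (\<lambda>h. \<Sum>p | p permutes UNIV. of_int (sign p) *
      (\<Sum>i\<in>UNIV. W' i h $ p i * (\<Prod>b\<in>UNIV - {i}. W b x $ p b)))) (at x)"
    by (intro has_derivative_sum has_derivative_mult_right has_derivative_prod
        bounded_linear.has_derivative[OF bounded_linear_vec_nth] assms)
  moreover have "W' i h $ p i * (\<Prod>b\<in>UNIV - {i}. W b x $ p b) =
      (\<Prod>b\<in>UNIV. (if b = i then W' i h else W b x) $ p b)" for i h p
    by (subst prod.remove[of _ i]) (auto intro!: prod.cong)
  ultimately show ?thesis
    unfolding tr sum_distrib_left by (subst sum.swap) simp
qed

lemma sign_map_option:
  fixes p :: "'m::finite \<Rightarrow> 'm"
  assumes "p permutes UNIV"
  shows "map_option p permutes UNIV \<and> sign (map_option p) = sign p"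
  using finite_class.finite_UNIV assms
proof (induction p rule: permutes_rev_induct)
  case id
  have "map_option (id :: 'm \<Rightarrow> 'm) = id" by (rule option.map_id0)
  then show ?case by (simp only: permutes_id sign_id)
next
  case (swap a b p)
  have tr: "map_option (Transposition.transpose a b) = Transposition.transpose (Some a) (Some b)"
    by (auto simp: fun_eq_iff Transposition.transpose_def map_option_case split: option.splits)
  have "map_option (p \<circ> Transposition.transpose a b) = map_option p \<circ> Transposition.transpose (Some a) (Some b)"
    by (simp add: tr[symmetric] option.map_comp fun_eq_iff)
  moreover have "permutation p" "permutation (map_option p)"
    using swap finite_class.finite_UNIV unfolding permutation_permutes by blast+
  moreover have "map_option p \<circ> Transposition.transpose (Some a) (Some b) permutes UNIV"
    using swap by (intro permutes_compose permutes_swap_id) auto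
  ultimately show ?case
    using swap by (simp del: comp_apply add: sign_compose permutation_swap_id sign_swap_id)
qed

text \<open>Expansion along a unit column. Only permutations fixing \<open>None\<close> contribute to the Leibniz formula,
  and these are the permutations of \<open>'m\<close> extended by \<open>map_option\<close>, with unchanged sign.\<close>

lemma det_option_unit_column:
  fixes X :: "'m::finite \<Rightarrow> real^('m option)"
  shows "det (\<chi> a b. case_option (axis None 1) X b $ a) = det (\<chi> a b. X b $ Some a)"
proof -
  define A where "A = (\<chi> a b. case_option (axis None 1) X b $ a)"
  let ?P = "{p :: 'm option \<Rightarrow> 'm option. p permutes UNIV}"
  let ?f = "\<lambda>p. of_int (sign p) * (\<Prod>i\<in>UNIV. A $ i $ p i)"
  have zero: "?f p = 0" if "p \<in> ?P - map_option ` {p. p permutes UNIV}" for p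
  proof -
    have p: "bij p" using that by (auto simp: permutes_bij)
    have "p None \<noteq> None"
    proof
      assume pN: "p None = None"
      have pS: "\<exists>y. p (Some x) = Some y" for x
        using bij_is_inj[OF p] pN by (metis injD not_None_eq option.simps(3))
      define q where "q x = the (p (Some x))" for x
      have q: "p (Some x) = Some (q x)" for x using pS[of x] by (auto simp: q_def)
      have "p = map_option q"
        using pN q by (auto simp: fun_eq_iff map_option_case split: option.splits)
      moreover have "inj q"
        using bij_is_inj[OF p] q by (metis injD injI option.inject)
      then have "q permutes UNIV"
        by (intro bij_imp_permutes) (auto simp: finite_UNIV_inj_surj bij_def)
      ultimately show False using that by auto
    qed
    moreover obtain i where i: "p i = None" using p by (metis bij_pointE)
    ultimately have "i \<noteq> None" by metis
    then have "A $ i $ p i = 0" by (simp add: A_def i axis_def)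
    then show ?thesis by (metis (no_types, lifting) finite_class.finite_UNIV iso_tuple_UNIV_I mult_zero_right prod_zero)
  qed
  have "det A = sum ?f ?P" by (simp add: det_def)
  also have "\<dots> = sum ?f (map_option ` {p. p permutes UNIV})"
    using zero sign_map_option by (intro sum.mono_neutral_right) auto
  also have "\<dots> = (\<Sum>p | p permutes UNIV. ?f (map_option p))"
  proof (subst sum.reindex)
    show "inj_on (map_option :: ('m \<Rightarrow> 'm) \<Rightarrow> _) {p. p permutes UNIV}"
      by (rule inj_onI, rule ext) (metis option.map(2) option.inject)
  qed simp
  also have "\<dots> = (\<Sum>p | p permutes UNIV. of_int (sign p) * (\<Prod>i\<in>UNIV. X (p i) $ Some i))"
  proof (intro sum.cong refl)
    fix p :: "'m \<Rightarrow> 'm" assume "p \<in> {p. p permutes UNIV}"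
    then have "sign (map_option p) = sign p" using sign_map_option by blast
    then show "?f (map_option p) = of_int (sign p) * (\<Prod>i\<in>UNIV. X (p i) $ Some i)"
      by (simp add: UNIV_option_conv prod.reindex A_def axis_def)
  qed
  finally show ?thesis by (simp add: A_def det_def)
qed

lemma matrix_mult_columns:
  fixes B :: "real^'m^'m" and V :: "'m \<Rightarrow> real^'m"
  shows "B ** (\<chi> a b. V b $ a) = (\<chi> a b. (B *v V b) $ a)"
  by (simp add: vec_eq_iff matrix_matrix_mult_def matrix_vector_mult_def)

lemma transpose_mult_columns:
  fixes U V :: "'m \<Rightarrow> real^'m"
  shows "transpose (\<chi> a b. U b $ a) ** (\<chi> a b. V b $ a) = (\<chi> i j. U i \<bullet> V j)"
  by (simp add: vec_eq_iff matrix_matrix_mult_def transpose_def inner_vec_def)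

section \<open>Differential calculus on manifolds etale over a Euclidean space\<close>

text \<open>The local condition in \<open>etale_manifold\<close>, on which differentiation rests; it passes to open
  subsets of \<open>M\<close>.\<close>

locale etale =
  fixes M :: "'a::topological_space set" and \<pi> :: "'a \<Rightarrow> 'e::euclidean_space"
  assumes local_chart:
    "\<And>p. p \<in> M \<Longrightarrow> \<exists>W q. openin (top_of_set M) W \<and> p \<in> W \<and> open (\<pi> ` W) \<and> homeomorphism W (\<pi> ` W) \<pi> q"
begin

text \<open>A single choice of local inverse for each point, independent of the function to be
  differentiated.\<close>

definition section_at :: "'a \<Rightarrow> 'e \<Rightarrow> 'a" where
  "section_at p = (SOME q. \<exists>W. openin (top_of_set M) W \<and> p \<in> W \<and> open (\<pi> ` W) \<and> homeomorphism W (\<pi> ` W) \<pi> q)"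

lemma section_at:
  assumes "p \<in> M"
  obtains W where "openin (top_of_set M) W" "p \<in> W" "open (\<pi> ` W)" "homeomorphism W (\<pi> ` W) \<pi> (section_at p)"
proof -
  let ?P = "\<lambda>q. \<exists>W. openin (top_of_set M) W \<and> p \<in> W \<and> open (\<pi> ` W) \<and> homeomorphism W (\<pi> ` W) \<pi> q"
  obtain W q where "openin (top_of_set M) W \<and> p \<in> W \<and> open (\<pi> ` W) \<and> homeomorphism W (\<pi> ` W) \<pi> q"
    using local_chart[OF assms] by (elim exE)
  then have "?P q" by (rule exI)
  then have "?P (section_at p)" unfolding section_at_def by (rule someI[of ?P])
  then show thesis by (elim exE conjE) (rule that)
qed

text \<open>Two local inverses of \<open>\<pi>\<close> through the same point agree on a neighbourhood, which makes
  \<open>has_mderiv\<close> independent of the chart occurring in its definition.\<close>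

lemma sections_agree:
  assumes W: "openin (top_of_set M) W" "p \<in> W" "homeomorphism W (\<pi> ` W) \<pi> q"
    and W': "openin (top_of_set M) W'" "p \<in> W'" "homeomorphism W' (\<pi> ` W') \<pi> q'" "open (\<pi> ` W')"
  shows "\<exists>V. open V \<and> \<pi> p \<in> V \<and> (\<forall>x\<in>V. q x = q' x \<and> q x \<in> W \<inter> W')"
proof (intro exI conjI ballI)
  have "openin (top_of_set W') (W \<inter> W')"
    using W(1) W'(1) by (metis inf_commute openin_Int openin_imp_subset openin_subset_trans inf_le1)
  then have "openin (top_of_set (\<pi> ` W')) (\<pi> ` (W \<inter> W'))"
    using homeomorphism_imp_open_map[OF W'(3)] by blast
  then show "open (\<pi> ` (W \<inter> W'))" using W'(4) by (meson openin_open_trans)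
  show "\<pi> p \<in> \<pi> ` (W \<inter> W')" using W(2) W'(2) by blast
  fix x assume "x \<in> \<pi> ` (W \<inter> W')"
  then obtain w where "w \<in> W" "w \<in> W'" "x = \<pi> w" by blast
  then show "q x = q' x" "q x \<in> W \<inter> W'"
    using W(3) W'(3) by (auto simp: homeomorphism_def)
qed

lemma has_mderiv_chart:
  assumes "openin (top_of_set M) W" "p \<in> W" "open (\<pi> ` W)" "homeomorphism W (\<pi> ` W) \<pi> q"
  shows "has_mderiv M \<pi> f D p \<longleftrightarrow> ((\<lambda>x. f (q x)) has_derivative D) (at (\<pi> p))"
proof
  assume "has_mderiv M \<pi> f D p"
  then obtain W' q' where W': "openin (top_of_set M) W'" "p \<in> W'" "open (\<pi> ` W')"
    "homeomorphism W' (\<pi> ` W') \<pi> q'" and D: "((f \<circ> q') has_derivative D) (at (\<pi> p))"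
    unfolding has_mderiv_def by blast
  obtain V where "open V" "\<pi> p \<in> V" "\<forall>x\<in>V. q' x = q x \<and> q' x \<in> W' \<inter> W"
    using sections_agree[OF W'(1,2,4) assms(1,2,4,3)] by blast
  then show "((\<lambda>x. f (q x)) has_derivative D) (at (\<pi> p))"
    by (intro has_derivative_transform_within_open[OF D]) auto
next
  assume "((\<lambda>x. f (q x)) has_derivative D) (at (\<pi> p))"
  with assms show "has_mderiv M \<pi> f D p"
    unfolding has_mderiv_def comp_def by blast
qed

text \<open>Fixing one section for each point reduces differentiation on \<open>M\<close> to ordinary differentiation, for
  functions with values in any type, so that sums, products and so on of several functions can be
  treated in one chart.\<close>

lemma has_mderiv_iff:
  "p \<in> M \<Longrightarrow> has_mderiv M \<pi> f D p \<longleftrightarrow> ((\<lambda>x. f (section_at p x)) has_derivative D) (at (\<pi> p))"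
  by (erule section_at) (rule has_mderiv_chart)

lemma section_at_base [simp]: "p \<in> M \<Longrightarrow> section_at p (\<pi> p) = p"
  by (erule section_at) (auto simp: homeomorphism_def)

lemma eventually_section:
  assumes "p \<in> M"
  shows "eventually (\<lambda>x. section_at p x \<in> M \<and> \<pi> (section_at p x) = x) (nhds (\<pi> p))"
proof -
  obtain W where W: "openin (top_of_set M) W" "p \<in> W" "open (\<pi> ` W)" "homeomorphism W (\<pi> ` W) \<pi> (section_at p)"
    using section_at[OF assms] .
  have "section_at p x \<in> M \<and> \<pi> (section_at p x) = x" if "x \<in> \<pi> ` W" for x
    using W that openin_imp_subset[OF W(1)] by (auto simp: homeomorphism_def)
  with W show ?thesis unfolding eventually_nhds by blast
qed

lemma has_mderiv_cong:
  assumes "p \<in> M" "\<And>q. q \<in> M \<Longrightarrow> f q = g q"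
  shows "has_mderiv M \<pi> f D p \<longleftrightarrow> has_mderiv M \<pi> g D p"
proof -
  have "has_mderiv M \<pi> g D p" if "has_mderiv M \<pi> f D p" "\<And>q. q \<in> M \<Longrightarrow> f q = g q" for f g :: "'a \<Rightarrow> 'b"
  proof -
    have ev: "eventually (\<lambda>x. f (section_at p x) = g (section_at p x)) (nhds (\<pi> p))"
      using eventually_section[OF assms(1)] by eventually_elim (auto simp: that(2))
    then have "eventually (\<lambda>x. f (section_at p x) = g (section_at p x)) (at (\<pi> p))"
      by (simp add: eventually_nhds_conv_at)
    with that(1) show ?thesis
      unfolding has_mderiv_iff[OF assms(1)]
      by (rule has_derivative_transform_eventually) (use assms that in auto)
  qed
  with assms(2) show ?thesis by metis
qed

lemma mderiv_cong:
  assumes "p \<in> M" "\<And>q. q \<in> M \<Longrightarrow> f q = g q"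
  shows "mderiv M \<pi> f p = mderiv M \<pi> g p"
  unfolding mderiv_def by (simp add: has_mderiv_cong[OF assms])

lemma has_mderiv_imp_mderiv:
  assumes "p \<in> M" "has_mderiv M \<pi> f D p" shows "mderiv M \<pi> f p = D"
  unfolding mderiv_def
proof (rule some_equality, fact)
  fix D' assume "has_mderiv M \<pi> f D' p"
  with assms show "D' = D" by (auto simp: has_mderiv_iff intro: has_derivative_unique)
qed

definition mdiff :: "('a \<Rightarrow> 'b::real_normed_vector) \<Rightarrow> 'a \<Rightarrow> bool" where
  "mdiff f p \<longleftrightarrow> (\<exists>D. has_mderiv M \<pi> f D p)"

lemma mdiff_has_mderiv: "mdiff f p \<Longrightarrow> has_mderiv M \<pi> f (mderiv M \<pi> f p) p"
  unfolding mdiff_def mderiv_def by (rule someI_ex[of "\<lambda>D. has_mderiv M \<pi> f D p"])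

lemma mdiff_has_derivative:
  "p \<in> M \<Longrightarrow> mdiff f p \<Longrightarrow> ((\<lambda>x. f (section_at p x)) has_derivative mderiv M \<pi> f p) (at (\<pi> p))"
  using mdiff_has_mderiv has_mderiv_iff by blast

lemma mderivI:
  assumes "p \<in> M" "((\<lambda>x. f (section_at p x)) has_derivative D) (at (\<pi> p))"
  shows "mdiff f p" "mderiv M \<pi> f p = D"
proof -
  have *: "has_mderiv M \<pi> f D p" using assms has_mderiv_iff by blast
  then show "mdiff f p" by (auto simp: mdiff_def)
  show "mderiv M \<pi> f p = D" using assms(1) * by (rule has_mderiv_imp_mderiv)
qed

lemma linear_mderiv: "p \<in> M \<Longrightarrow> mdiff f p \<Longrightarrow> linear (mderiv M \<pi> f p)"
  using mdiff_has_derivative has_derivative_linear by blast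

lemma mdiff_cong:
  assumes "p \<in> M" "\<And>q. q \<in> M \<Longrightarrow> f q = g q"
  shows "mdiff f p \<longleftrightarrow> mdiff g p"
  unfolding mdiff_def by (simp add: has_mderiv_cong[OF assms])

lemma mderiv_const: assumes "p \<in> M" shows "mdiff (\<lambda>_. c) p" "mderiv M \<pi> (\<lambda>_. c) p = (\<lambda>_. 0)"
  using mderivI[OF assms has_derivative_const] by auto

lemma mderiv_chart_map: assumes "p \<in> M" shows "mdiff \<pi> p" "mderiv M \<pi> \<pi> p = (\<lambda>v. v)"
proof -
  have "((\<lambda>x. x) has_derivative (\<lambda>v. v)) (at (\<pi> p))" by (rule has_derivative_ident)
  moreover have "eventually (\<lambda>x. x = \<pi> (section_at p x)) (at (\<pi> p))"
    using eventually_section[OF assms] unfolding eventually_nhds_conv_at by (auto elim: eventually_mono)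
  ultimately have "((\<lambda>x. \<pi> (section_at p x)) has_derivative (\<lambda>v. v)) (at (\<pi> p))"
    by (rule has_derivative_transform_eventually) (use assms in auto)
  from mderivI[OF assms this] show "mdiff \<pi> p" "mderiv M \<pi> \<pi> p = (\<lambda>v. v)" by auto
qed

lemma mderiv_bounded_linear:
  assumes "p \<in> M" "bounded_linear L" "mdiff f p"
  shows "mdiff (\<lambda>q. L (f q)) p" "mderiv M \<pi> (\<lambda>q. L (f q)) p = (\<lambda>v. L (mderiv M \<pi> f p v))"
  using mderivI[OF assms(1) bounded_linear.has_derivative[OF assms(2) mdiff_has_derivative[OF assms(1,3)]]]
  by auto

lemma mderiv_bilinear:
  assumes "p \<in> M" "bounded_bilinear B" "mdiff f p" "mdiff g p"
  shows "mdiff (\<lambda>q. B (f q) (g q)) p"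
    "mderiv M \<pi> (\<lambda>q. B (f q) (g q)) p = (\<lambda>v. B (f p) (mderiv M \<pi> g p v) + B (mderiv M \<pi> f p v) (g p))"
  using mderivI[OF assms(1) bounded_bilinear.FDERIV[OF assms(2) mdiff_has_derivative[OF assms(1,3)] mdiff_has_derivative[OF assms(1,4)]]]
    assms(1) by auto

lemma mderiv_add:
  assumes "p \<in> M" "mdiff f p" "mdiff g p"
  shows "mdiff (\<lambda>q. f q + g q) p"
    "mderiv M \<pi> (\<lambda>q. f q + g q) p = (\<lambda>v. mderiv M \<pi> f p v + mderiv M \<pi> g p v)"
  using mderivI[OF assms(1) has_derivative_add[OF mdiff_has_derivative[OF assms(1,2)] mdiff_has_derivative[OF assms(1,3)]]]
  by auto

lemma mderiv_sum:
  assumes "p \<in> M" "\<And>i. i \<in> I \<Longrightarrow> mdiff (f i) p"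
  shows "mdiff (\<lambda>q. \<Sum>i\<in>I. f i q) p"
    "mderiv M \<pi> (\<lambda>q. \<Sum>i\<in>I. f i q) p = (\<lambda>v. \<Sum>i\<in>I. mderiv M \<pi> (f i) p v)"
proof -
  have "((\<lambda>x. \<Sum>i\<in>I. f i (section_at p x)) has_derivative (\<lambda>v. \<Sum>i\<in>I. mderiv M \<pi> (f i) p v)) (at (\<pi> p))"
    by (intro has_derivative_sum mdiff_has_derivative assms)
  from mderivI[OF assms(1) this] show "mdiff (\<lambda>q. \<Sum>i\<in>I. f i q) p"
    "mderiv M \<pi> (\<lambda>q. \<Sum>i\<in>I. f i q) p = (\<lambda>v. \<Sum>i\<in>I. mderiv M \<pi> (f i) p v)" by auto
qed

lemma mderiv_inverse:
  fixes f :: "'a \<Rightarrow> real"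
  assumes "p \<in> M" "mdiff f p" "f p \<noteq> 0"
  shows "mdiff (\<lambda>q. inverse (f q)) p"
    "mderiv M \<pi> (\<lambda>q. inverse (f q)) p = (\<lambda>v. - (inverse (f p) * mderiv M \<pi> f p v * inverse (f p)))"
  using mderivI[OF assms(1) Deriv.has_derivative_inverse[OF _ mdiff_has_derivative[OF assms(1,2)]]] assms(1,3)
  by auto

lemma mderiv_vec_nth:
  fixes f :: "'a \<Rightarrow> 'b::euclidean_space^'k"
  assumes "p \<in> M" "mdiff f p"
  shows "mderiv M \<pi> (\<lambda>q. f q $ i) p v = mderiv M \<pi> f p v $ i"
  using mderiv_bounded_linear(2)[OF assms(1) bounded_linear_vec_nth assms(2)] by simp

lemma mderiv_det:
  fixes W :: "'m::finite \<Rightarrow> 'a \<Rightarrow> real^'m"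
  assumes "p \<in> M" "\<And>j. mdiff (W j) p"
  shows "mdiff (\<lambda>q. det (\<chi> a b. W b q $ a)) p"
    and "mderiv M \<pi> (\<lambda>q. det (\<chi> a b. W b q $ a)) p =
      (\<lambda>v. \<Sum>i\<in>UNIV. det (\<chi> a b. (if b = i then mderiv M \<pi> (W i) p v else W b p) $ a))"
proof -
  note d = has_derivative_det[of "\<lambda>j x. W j (section_at p x)", OF mdiff_has_derivative[OF assms]]
  show "mdiff (\<lambda>q. det (\<chi> a b. W b q $ a)) p"
    using mderivI(1)[OF assms(1) d] .
  show "mderiv M \<pi> (\<lambda>q. det (\<chi> a b. W b q $ a)) p =
      (\<lambda>v. \<Sum>i\<in>UNIV. det (\<chi> a b. (if b = i then mderiv M \<pi> (W i) p v else W b p) $ a))"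
    using mderivI(2)[OF assms(1) d] assms(1) by (simp cong: if_cong)
qed

lemma mdiff_continuous_on:
  assumes "\<And>p. p \<in> M \<Longrightarrow> mdiff f p"
  shows "continuous_on M f"
proof -
  have "(f \<longlongrightarrow> f p) (at p within M)" if p: "p \<in> M" for p
  proof -
    obtain W where W: "openin (top_of_set M) W" "p \<in> W" "open (\<pi> ` W)" "homeomorphism W (\<pi> ` W) \<pi> (section_at p)"
      using section_at[OF p] .
    have "isCont (\<lambda>x. f (section_at p x)) (\<pi> w)" if "w \<in> W" for w
    proof -
      have "w \<in> M" using W(1) that openin_imp_subset by blast
      then have "has_mderiv M \<pi> f (mderiv M \<pi> f w) w" using assms mdiff_has_mderiv by blast
      then show ?thesis
        using has_mderiv_chart[OF W(1) that W(3,4)] has_derivative_continuous by blast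
    qed
    then have "continuous_on (\<pi> ` W) (\<lambda>x. f (section_at p x))"
      by (auto intro: continuous_at_imp_continuous_on)
    moreover have "continuous_on W \<pi>" using W(4) by (simp add: homeomorphism_def)
    ultimately have "continuous_on W (\<lambda>w. f (section_at p (\<pi> w)))"
      by (rule continuous_on_compose2) simp
    then have "continuous_on W f"
      by (rule continuous_on_eq) (use W(4) in \<open>auto simp: homeomorphism_def\<close>)
    then have "(f \<longlongrightarrow> f p) (at p within W)"
      using W(2) by (simp add: continuous_on_def)
    moreover obtain T where "open T" "W = M \<inter> T" using W(1) by (auto simp: openin_open)
    then have "at p within W = at p within M"
      using W(2) by (intro at_within_nhd[of p T]) auto
    ultimately show ?thesis by simp
  qed
  then show ?thesis by (simp add: continuous_on_def)
qed

text \<open>In a chart the function is constant on balls, hence locally constant on the connected space \<open>M\<close>.\<close>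

lemma zero_mderiv_imp_constant:
  fixes f :: "'a \<Rightarrow> 'b::real_normed_vector"
  assumes "connected M" "\<And>p. p \<in> M \<Longrightarrow> mdiff f p" "\<And>p v. p \<in> M \<Longrightarrow> mderiv M \<pi> f p v = 0"
  shows "f constant_on M"
proof (rule locally_constant_imp_constant[OF assms(1)])
  fix p assume p: "p \<in> M"
  obtain W where W: "openin (top_of_set M) W" "p \<in> W" "open (\<pi> ` W)" "homeomorphism W (\<pi> ` W) \<pi> (section_at p)"
    using section_at[OF p] .
  obtain e where e: "e > 0" "ball (\<pi> p) e \<subseteq> \<pi> ` W" using W(2,3) openE by blast
  have inv: "section_at p (\<pi> w) = w" if "w \<in> W" for w
    using W(4) that by (simp add: homeomorphism_def)
  have "((\<lambda>x. f (section_at p x)) has_derivative (\<lambda>_. 0)) (at x within ball (\<pi> p) e)"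
    if "x \<in> ball (\<pi> p) e" for x
  proof -
    obtain w where w: "w \<in> W" "x = \<pi> w" using e(2) \<open>x \<in> ball (\<pi> p) e\<close> by blast
    then have "w \<in> M" using W(1) openin_imp_subset by blast
    then have "has_mderiv M \<pi> f (mderiv M \<pi> f w) w" using assms(2) mdiff_has_mderiv by blast
    then have "((\<lambda>x. f (section_at p x)) has_derivative mderiv M \<pi> f w) (at x)"
      using has_mderiv_chart[OF W(1) w(1) W(3,4)] w(2) by blast
    moreover have "mderiv M \<pi> f w = (\<lambda>_. 0)" using assms(3) \<open>w \<in> M\<close> by blast
    ultimately show ?thesis by (simp add: has_derivative_at_withinI)
  qed
  then obtain c where c: "\<And>x. x \<in> ball (\<pi> p) e \<Longrightarrow> f (section_at p x) = c"
    using has_derivative_zero_constant[OF convex_ball] by blast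
  show "\<exists>T. openin (top_of_set M) T \<and> p \<in> T \<and> (\<forall>x\<in>T. f x = f p)"
  proof (intro exI conjI ballI)
    have "continuous_on W \<pi>" using W(4) by (simp add: homeomorphism_def)
    then have "openin (top_of_set W) (W \<inter> \<pi> -` ball (\<pi> p) e)"
      by (simp add: continuous_openin_preimage_gen)
    then show "openin (top_of_set M) (W \<inter> \<pi> -` ball (\<pi> p) e)"
      using W(1) openin_trans by blast
    show "p \<in> W \<inter> \<pi> -` ball (\<pi> p) e" using W(2) e(1) by simp
    fix w assume "w \<in> W \<inter> \<pi> -` ball (\<pi> p) e"
    then show "f w = f p" using c[of "\<pi> w"] c[of "\<pi> p"] inv[of w] inv[of p] W(2) e(1) by auto
  qed
qed

lemma mCk_Suc_iff: "mCk M \<pi> (Suc k) f \<longleftrightarrow> (\<forall>p\<in>M. mdiff f p) \<and> (\<forall>v. mCk M \<pi> k (\<lambda>p. mderiv M \<pi> f p v))"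
  by (simp add: mdiff_def)

declare mCk.simps(2) [simp del]

lemma mCk_cong:
  assumes "\<And>q. q \<in> M \<Longrightarrow> f q = g q"
  shows "mCk M \<pi> k f \<longleftrightarrow> mCk M \<pi> k g"
  using assms
proof (induction k arbitrary: f g)
  case 0
  then show ?case by (auto cong: continuous_on_cong)
next
  case (Suc k)
  have "mdiff f p \<longleftrightarrow> mdiff g p" if "p \<in> M" for p
    by (rule mdiff_cong[OF that Suc.prems])
  moreover have "mCk M \<pi> k (\<lambda>p. mderiv M \<pi> f p v) \<longleftrightarrow> mCk M \<pi> k (\<lambda>p. mderiv M \<pi> g p v)" for v
    by (rule Suc.IH) (simp add: mderiv_cong[OF _ Suc.prems])
  ultimately show ?case by (simp add: mCk_Suc_iff)
qed

lemma mCk_SucD: "mCk M \<pi> (Suc k) f \<Longrightarrow> mCk M \<pi> k f"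
proof (induction k arbitrary: f)
  case 0
  then show ?case by (simp add: mCk_Suc_iff mdiff_continuous_on)
next
  case (Suc k)
  then show ?case unfolding mCk_Suc_iff[of "Suc k"] mCk_Suc_iff[of k] by blast
qed

lemma mCk_const: "mCk M \<pi> k (\<lambda>_. c)"
proof (induction k arbitrary: c)
  case (Suc k)
  have "mCk M \<pi> k (\<lambda>p. mderiv M \<pi> (\<lambda>_. c) p v)" for v
    using Suc[of 0] by (simp add: mderiv_const cong: mCk_cong)
  then show ?case by (simp add: mCk_Suc_iff mderiv_const)
qed simp

lemma mCk_add: "mCk M \<pi> k f \<Longrightarrow> mCk M \<pi> k g \<Longrightarrow> mCk M \<pi> k (\<lambda>p. f p + g p)"
proof (induction k arbitrary: f g)
  case 0
  then show ?case by (auto intro: continuous_on_add)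
next
  case (Suc k)
  then show ?case by (simp add: mCk_Suc_iff mderiv_add cong: mCk_cong)
qed

lemma mCk_bounded_linear: "bounded_linear L \<Longrightarrow> mCk M \<pi> k f \<Longrightarrow> mCk M \<pi> k (\<lambda>p. L (f p))"
proof (induction k arbitrary: f)
  case 0
  then show ?case by (auto intro: bounded_linear.continuous_on)
next
  case (Suc k)
  then show ?case by (simp add: mCk_Suc_iff mderiv_bounded_linear cong: mCk_cong)
qed

lemma mCk_bilinear:
  "bounded_bilinear B \<Longrightarrow> mCk M \<pi> k f \<Longrightarrow> mCk M \<pi> k g \<Longrightarrow> mCk M \<pi> k (\<lambda>p. B (f p) (g p))"
proof (induction k arbitrary: f g)
  case 0
  then show ?case by (auto intro: bounded_bilinear.continuous_on)
next
  case (Suc k)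
  have "mCk M \<pi> k (\<lambda>p. B (f p) (mderiv M \<pi> g p v) + B (mderiv M \<pi> f p v) (g p))" for v
    using Suc mCk_SucD[of k f] mCk_SucD[of k g] by (intro mCk_add Suc.IH) (auto simp: mCk_Suc_iff)
  with Suc.prems show ?case by (simp add: mCk_Suc_iff mderiv_bilinear cong: mCk_cong)
qed

lemma mCk_inverse:
  fixes f :: "'a \<Rightarrow> real"
  assumes nz: "\<And>p. p \<in> M \<Longrightarrow> f p \<noteq> 0"
  shows "mCk M \<pi> k f \<Longrightarrow> mCk M \<pi> k (\<lambda>p. inverse (f p))"
proof (induction k)
  case 0
  then show ?case using nz by (auto intro!: continuous_on_inverse)
next
  case (Suc k)
  have inv: "mCk M \<pi> k (\<lambda>p. inverse (f p))" using Suc mCk_SucD by blast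
  have "mCk M \<pi> k (\<lambda>p. - (inverse (f p) * mderiv M \<pi> f p v * inverse (f p)))" for v
    using Suc.prems inv
    by (intro mCk_bounded_linear[OF bounded_linear_minus[OF bounded_linear_ident]]
        mCk_bilinear[OF bounded_bilinear_mult]) (auto simp: mCk_Suc_iff)
  with Suc.prems nz show ?case by (simp add: mCk_Suc_iff mderiv_inverse cong: mCk_cong)
qed

text \<open>Smoothness as a coinductive property: a function is smooth iff it is differentiable and all its
  directional derivatives are smooth.\<close>

lemma msmooth_iff: "msmooth M \<pi> f \<longleftrightarrow> (\<forall>p\<in>M. mdiff f p) \<and> (\<forall>v. msmooth M \<pi> (\<lambda>p. mderiv M \<pi> f p v))"
  unfolding msmooth_def
proof (intro iffI conjI allI)
  fix k assume "(\<forall>p\<in>M. mdiff f p) \<and> (\<forall>v k. mCk M \<pi> k (\<lambda>p. mderiv M \<pi> f p v))"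
  then have "mCk M \<pi> (Suc k) f" by (simp add: mCk_Suc_iff)
  then show "mCk M \<pi> k f" by (rule mCk_SucD)
qed (metis mCk_Suc_iff)+

lemma msmooth_mdiff: "msmooth M \<pi> f \<Longrightarrow> p \<in> M \<Longrightarrow> mdiff f p"
  using msmooth_iff by blast

lemma msmooth_mderiv: "msmooth M \<pi> f \<Longrightarrow> msmooth M \<pi> (\<lambda>p. mderiv M \<pi> f p v)"
  using msmooth_iff by blast

lemma msmooth_cong: "(\<And>q. q \<in> M \<Longrightarrow> f q = g q) \<Longrightarrow> msmooth M \<pi> f \<longleftrightarrow> msmooth M \<pi> g"
  unfolding msmooth_def using mCk_cong by metis

lemma msmooth_const: "msmooth M \<pi> (\<lambda>_. c)"
  by (simp add: msmooth_def mCk_const)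

lemma msmooth_add: "msmooth M \<pi> f \<Longrightarrow> msmooth M \<pi> g \<Longrightarrow> msmooth M \<pi> (\<lambda>p. f p + g p)"
  by (simp add: msmooth_def mCk_add)

lemma msmooth_sum: "(\<And>i. i \<in> I \<Longrightarrow> msmooth M \<pi> (f i)) \<Longrightarrow> msmooth M \<pi> (\<lambda>p. \<Sum>i\<in>I. f i p)"
  by (induction I rule: infinite_finite_induct) (auto intro: msmooth_const msmooth_add)

lemma msmooth_bounded_linear: "bounded_linear L \<Longrightarrow> msmooth M \<pi> f \<Longrightarrow> msmooth M \<pi> (\<lambda>p. L (f p))"
  by (simp add: msmooth_def mCk_bounded_linear)

lemma msmooth_minus: "msmooth M \<pi> f \<Longrightarrow> msmooth M \<pi> (\<lambda>p. - f p)"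
  by (rule msmooth_bounded_linear[OF bounded_linear_minus[OF bounded_linear_ident]])

lemma msmooth_diff: "msmooth M \<pi> f \<Longrightarrow> msmooth M \<pi> g \<Longrightarrow> msmooth M \<pi> (\<lambda>p. f p - g p)"
  using msmooth_add[OF _ msmooth_minus, of f g] by simp

lemma msmooth_bilinear:
  "bounded_bilinear B \<Longrightarrow> msmooth M \<pi> f \<Longrightarrow> msmooth M \<pi> g \<Longrightarrow> msmooth M \<pi> (\<lambda>p. B (f p) (g p))"
  by (simp add: msmooth_def mCk_bilinear)

lemmas msmooth_mult = msmooth_bilinear[OF bounded_bilinear_mult]
lemmas msmooth_scaleR = msmooth_bilinear[OF bounded_bilinear_scaleR]

lemma msmooth_inverse:
  fixes f :: "'a \<Rightarrow> real"
  shows "msmooth M \<pi> f \<Longrightarrow> (\<And>p. p \<in> M \<Longrightarrow> f p \<noteq> 0) \<Longrightarrow> msmooth M \<pi> (\<lambda>p. inverse (f p))"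
  by (simp add: msmooth_def mCk_inverse)

lemma msmooth_prod:
  fixes f :: "'i \<Rightarrow> 'a \<Rightarrow> real"
  shows "(\<And>i. i \<in> I \<Longrightarrow> msmooth M \<pi> (f i)) \<Longrightarrow> msmooth M \<pi> (\<lambda>p. \<Prod>i\<in>I. f i p)"
  by (induction I rule: infinite_finite_induct) (auto intro: msmooth_const msmooth_mult)

lemma msmooth_vec:
  fixes f :: "'a \<Rightarrow> 'c::euclidean_space^'k"
  assumes "\<And>i. msmooth M \<pi> (\<lambda>p. f p $ i)"
  shows "msmooth M \<pi> f"
proof -
  have "bounded_linear (axis i :: 'c \<Rightarrow> 'c^'k)" for i
    by (rule linear_conv_bounded_linear[THEN iffD1])
       (auto intro!: linearI simp: axis_def vec_eq_iff)
  then have "msmooth M \<pi> (\<lambda>p. \<Sum>i\<in>UNIV. axis i (f p $ i))"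
    by (intro msmooth_sum msmooth_bounded_linear[of "axis _"] assms)
  moreover have "(\<lambda>p. \<Sum>i\<in>UNIV. axis i (f p $ i)) = f"
    by (auto simp: fun_eq_iff vec_eq_iff axis_def)
  ultimately show ?thesis by simp
qed

lemma msmooth_vec_nth: "msmooth M \<pi> f \<Longrightarrow> msmooth M \<pi> (\<lambda>p. f p $ i)"
  by (rule msmooth_bounded_linear[OF bounded_linear_vec_nth])

lemma msmooth_det:
  fixes A :: "'a \<Rightarrow> real^'k^'k"
  assumes "\<And>i j. msmooth M \<pi> (\<lambda>p. A p $ i $ j)"
  shows "msmooth M \<pi> (\<lambda>p. det (A p))"
  unfolding det_def by (intro msmooth_sum msmooth_mult msmooth_prod msmooth_const assms)

lemma msmooth_chart_map: "msmooth M \<pi> \<pi>"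
proof -
  have "msmooth M \<pi> (\<lambda>p. mderiv M \<pi> \<pi> p v)" for v
    using msmooth_const[of v] by (simp add: mderiv_chart_map cong: msmooth_cong)
  then show ?thesis using msmooth_iff[of \<pi>] mderiv_chart_map(1) by blast
qed

text \<open>The product rule for a tensor field applied to a vector field: expand \<open>Y\<close> in the constant basis
  fields. Taking \<open>T\<close> to be the differential of a function yields second derivatives along vector
  fields.\<close>

lemma linear_field_apply:
  fixes T :: "'a \<Rightarrow> 'c::euclidean_space \<Rightarrow> 'b::real_normed_vector"
  assumes T: "\<And>q. q \<in> M \<Longrightarrow> linear (T q)" and p: "p \<in> M"
    and Tv: "\<And>v. mdiff (\<lambda>q. T q v) p" and Y: "mdiff Y p"
  shows "mdiff (\<lambda>q. T q (Y q)) p"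
    and "mderiv M \<pi> (\<lambda>q. T q (Y q)) p h = mderiv M \<pi> (\<lambda>q. T q (Y p)) p h + T p (mderiv M \<pi> Y p h)"
proof -
  have expand: "T q y = (\<Sum>b\<in>Basis. (y \<bullet> b) *\<^sub>R T q b)" if "q \<in> M" for q y
    by (subst euclidean_representation[of y, symmetric], subst linear_sum[OF T[OF that]])
       (simp add: linear_cmul[OF T[OF that]])
  have d: "mdiff (\<lambda>q. \<Sum>b\<in>Basis. (Y q \<bullet> b) *\<^sub>R T q b) p"
    "mderiv M \<pi> (\<lambda>q. \<Sum>b\<in>Basis. (Y q \<bullet> b) *\<^sub>R T q b) p =
      (\<lambda>h. \<Sum>b\<in>Basis. (Y p \<bullet> b) *\<^sub>R mderiv M \<pi> (\<lambda>q. T q b) p h + (mderiv M \<pi> Y p h \<bullet> b) *\<^sub>R T p b)"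
    using Y Tv by (simp_all add: p mderiv_sum mderiv_bilinear[OF p bounded_bilinear_scaleR]
        mderiv_bounded_linear[OF p bounded_linear_inner_left])
  have c: "mdiff (\<lambda>q. \<Sum>b\<in>Basis. (Y p \<bullet> b) *\<^sub>R T q b) p"
    "mderiv M \<pi> (\<lambda>q. \<Sum>b\<in>Basis. (Y p \<bullet> b) *\<^sub>R T q b) p = (\<lambda>h. \<Sum>b\<in>Basis. (Y p \<bullet> b) *\<^sub>R mderiv M \<pi> (\<lambda>q. T q b) p h)"
    using Tv by (simp_all add: p mderiv_sum mderiv_bounded_linear[OF p bounded_linear_scaleR_right])
  show "mdiff (\<lambda>q. T q (Y q)) p"
    by (rule mdiff_cong[THEN iffD2, OF p _ d(1)]) (rule expand)
  show "mderiv M \<pi> (\<lambda>q. T q (Y q)) p h = mderiv M \<pi> (\<lambda>q. T q (Y p)) p h + T p (mderiv M \<pi> Y p h)"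
  proof -
    have "mderiv M \<pi> (\<lambda>q. T q (Y q)) p = mderiv M \<pi> (\<lambda>q. \<Sum>b\<in>Basis. (Y q \<bullet> b) *\<^sub>R T q b) p"
      "mderiv M \<pi> (\<lambda>q. T q (Y p)) p = mderiv M \<pi> (\<lambda>q. \<Sum>b\<in>Basis. (Y p \<bullet> b) *\<^sub>R T q b) p"
      by (rule mderiv_cong[OF p], rule expand, assumption)+
    then show ?thesis
      using d(2) c(2) expand[OF p, of "mderiv M \<pi> Y p h"] by (simp add: sum.distrib)
  qed
qed

lemma msmooth_apply_field:
  fixes T :: "'a \<Rightarrow> 'c::euclidean_space \<Rightarrow> 'b::real_normed_vector"
  assumes T: "\<And>q. q \<in> M \<Longrightarrow> linear (T q)"
    and Tv: "\<And>v. msmooth M \<pi> (\<lambda>q. T q v)" and Y: "msmooth M \<pi> Y"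
  shows "msmooth M \<pi> (\<lambda>q. T q (Y q))"
proof -
  have expand: "T q y = (\<Sum>b\<in>Basis. (y \<bullet> b) *\<^sub>R T q b)" if "q \<in> M" for q y
    by (subst euclidean_representation[of y, symmetric], subst linear_sum[OF T[OF that]])
       (simp add: linear_cmul[OF T[OF that]])
  have "msmooth M \<pi> (\<lambda>q. \<Sum>b\<in>Basis. (Y q \<bullet> b) *\<^sub>R T q b)"
    by (intro msmooth_sum msmooth_scaleR Tv msmooth_bounded_linear[OF bounded_linear_inner_left] Y)
  then show ?thesis by (rule msmooth_cong[THEN iffD2, rotated]) (rule expand)
qed

lemma msmooth_mderiv_field:
  assumes "msmooth M \<pi> f" "msmooth M \<pi> X"
  shows "msmooth M \<pi> (\<lambda>p. mderiv M \<pi> f p (X p))"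
  by (rule msmooth_apply_field[OF _ msmooth_mderiv[OF assms(1)] assms(2)])
    (rule linear_mderiv[OF _ msmooth_mdiff[OF assms(1)]])

lemma mderiv_mderiv_field:
  assumes "msmooth M \<pi> f" "msmooth M \<pi> Y" "p \<in> M"
  shows "mderiv M \<pi> (\<lambda>q. mderiv M \<pi> f q (Y q)) p h =
    mderiv M \<pi> (\<lambda>q. mderiv M \<pi> f q (Y p)) p h + mderiv M \<pi> f p (mderiv M \<pi> Y p h)"
  by (rule linear_field_apply(2)[OF _ assms(3) msmooth_mdiff[OF msmooth_mderiv[OF assms(1)] assms(3)]
        msmooth_mdiff[OF assms(2,3)]])
    (rule linear_mderiv[OF _ msmooth_mdiff[OF assms(1)]])

lemma mderiv_commute:
  fixes f :: "'a \<Rightarrow> 'b::euclidean_space"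
  assumes f: "msmooth M \<pi> f" and p: "p \<in> M"
  shows "mderiv M \<pi> (\<lambda>q. mderiv M \<pi> f q u) p v = mderiv M \<pi> (\<lambda>q. mderiv M \<pi> f q v) p u"
proof -
  obtain W where W: "openin (top_of_set M) W" "p \<in> W" "open (\<pi> ` W)" "homeomorphism W (\<pi> ` W) \<pi> (section_at p)"
    using section_at[OF p] .
  let ?s = "section_at p"
  have der: "((\<lambda>x. g (?s x)) has_derivative mderiv M \<pi> g (?s x)) (at x)"
    if "msmooth M \<pi> g" "x \<in> \<pi> ` W" for g :: "'a \<Rightarrow> 'b" and x
  proof -
    obtain w where w: "w \<in> W" "x = \<pi> w" "?s x = w" using W(4) \<open>x \<in> \<pi> ` W\<close> by (auto simp: homeomorphism_def)
    then have "w \<in> M" using W(1) openin_imp_subset by blast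
    then have "has_mderiv M \<pi> g (mderiv M \<pi> g w) w" using msmooth_mdiff \<open>msmooth M \<pi> g\<close> mdiff_has_mderiv by blast
    then show ?thesis using has_mderiv_chart[OF W(1) w(1) W(3,4)] w(2,3) by auto
  qed
  have cont: "isCont (\<lambda>x. g (?s x)) (\<pi> p)" if "msmooth M \<pi> g" for g :: "'a \<Rightarrow> 'b"
    using der[OF that, of "\<pi> p"] W(2) has_derivative_continuous by blast
  have "mderiv M \<pi> (\<lambda>q. mderiv M \<pi> f q u) (?s (\<pi> p)) v = mderiv M \<pi> (\<lambda>q. mderiv M \<pi> f q v) (?s (\<pi> p)) u"
  proof (rule symmetric_second_derivative[where f = "\<lambda>x. f (?s x)" and S = "\<pi> ` W"
        and D = "\<lambda>x. mderiv M \<pi> f (?s x)" and z = "\<pi> p"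
        and Du = "\<lambda>x. mderiv M \<pi> (\<lambda>q. mderiv M \<pi> f q u) (?s x)"
        and Dv = "\<lambda>x. mderiv M \<pi> (\<lambda>q. mderiv M \<pi> f q v) (?s x)"])
  qed (use W(2,3) der[OF f] der[OF msmooth_mderiv[OF f]]
      cont[OF msmooth_mderiv[OF msmooth_mderiv[OF f]]] in auto)
  then show ?thesis using p by simp
qed

end

section \<open>Coverings and holomorphic functions on them\<close>

text \<open>The sheets over evenly covered open sets are the charts. Points over different base points are
  separated by preimages of disjoint open sets, points of one fibre by the sheets that contain them.\<close>

lemma covering_space_imp_etale_manifold:
  fixes \<pi> :: "'a::topological_space \<Rightarrow> 'e::euclidean_space"
  assumes cov: "covering_space M \<pi> U" and U: "open U"
  shows "etale_manifold M \<pi>"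
proof -
  have cont: "continuous_on M \<pi>" and onto: "\<pi> ` M = U"
    using cov by (auto simp: covering_space_def)
  have sheets: "\<exists>T v. \<pi> p \<in> T \<and> open T \<and> \<Union>v = M \<inter> \<pi> -` T \<and> (\<forall>u\<in>v. openin (top_of_set M) u) \<and>
      pairwise disjnt v \<and> (\<forall>u\<in>v. \<exists>q. homeomorphism u T \<pi> q)" if "p \<in> M" for p
  proof -
    have "\<pi> p \<in> U" using that onto by blast
    with cov obtain T v where *: "\<pi> p \<in> T" "openin (top_of_set U) T" "\<Union>v = M \<inter> \<pi> -` T"
      "\<forall>u\<in>v. openin (top_of_set M) u" "pairwise disjnt v" "\<forall>u\<in>v. \<exists>q. homeomorphism u T \<pi> q"
      unfolding covering_space_def by (elim conjE) (drule (1) bspec, elim exE conjE, rule that)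
    moreover have "open T" using *(2) U openin_open_eq by blast
    ultimately show ?thesis by (intro exI conjI)
  qed
  have chart: "\<exists>W q. openin (top_of_set M) W \<and> p \<in> W \<and> open (\<pi> ` W) \<and> homeomorphism W (\<pi> ` W) \<pi> q"
    if p: "p \<in> M" for p
  proof -
    obtain T v where *: "\<pi> p \<in> T" "open T" "\<Union>v = M \<inter> \<pi> -` T"
      "\<forall>u\<in>v. openin (top_of_set M) u" "\<forall>u\<in>v. \<exists>q. homeomorphism u T \<pi> q"
      using sheets[OF p] by (elim exE conjE) (rule that)
    have "p \<in> \<Union>v" using *(1,3) p by simp
    then obtain W where W: "W \<in> v" "p \<in> W" by blast
    then obtain q where q: "homeomorphism W T \<pi> q" using *(5) by blast
    then have "\<pi> ` W = T" by (simp add: homeomorphism_def)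
    with * W q show ?thesis by blast
  qed
  have "\<exists>V W. openin (top_of_set M) V \<and> openin (top_of_set M) W \<and> x \<in> V \<and> y \<in> W \<and> disjnt V W"
    if x: "x \<in> M" and y: "y \<in> M" and "x \<noteq> y" for x y
  proof (cases "\<pi> x = \<pi> y")
    case True
    \<comment> \<open>two points of one fibre lie on different sheets\<close>
    obtain T v where *: "\<pi> x \<in> T" "\<Union>v = M \<inter> \<pi> -` T"
      "\<forall>u\<in>v. openin (top_of_set M) u" "pairwise disjnt v" "\<forall>u\<in>v. \<exists>q. homeomorphism u T \<pi> q"
      using sheets[OF x] by (elim exE conjE) (rule that)
    have "x \<in> \<Union>v" "y \<in> \<Union>v" using * x y True by auto
    then obtain V W where VW: "V \<in> v" "W \<in> v" "x \<in> V" "y \<in> W" by blast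
    obtain q where "homeomorphism V T \<pi> q" using VW(1) *(5) by blast
    then have "y \<notin> V" using VW(3) True \<open>x \<noteq> y\<close> by (metis homeomorphism_apply1)
    then have "V \<noteq> W" using VW(4) by blast
    then have "disjnt V W" using *(4) VW by (simp add: pairwise_def)
    with VW *(3) show ?thesis by blast
  next
    case False
    then obtain A B where AB: "open A" "open B" "\<pi> x \<in> A" "\<pi> y \<in> B" "A \<inter> B = {}"
      using hausdorff by metis
    have "openin (top_of_set M) (M \<inter> \<pi> -` A)" "openin (top_of_set M) (M \<inter> \<pi> -` B)"
      using cont AB by (auto intro: continuous_openin_preimage_gen)
    moreover have "disjnt (M \<inter> \<pi> -` A) (M \<inter> \<pi> -` B)" using AB(5) by (auto simp: disjnt_def)
    ultimately show ?thesis using x y AB by blast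
  qed
  then have "Hausdorff_space (top_of_set M)"
    by (simp add: Hausdorff_space_def)
  with chart show ?thesis by (simp add: etale_manifold_def)
qed

lemma etale_manifold_imp_etale: "etale_manifold M \<pi> \<Longrightarrow> etale M \<pi>"
  by (simp add: etale_manifold_def etale_def)

locale complex_etale = etale M \<pi> for M :: "'a::topological_space set" and \<pi> :: "'a \<Rightarrow> complex^'n"
begin

lemma holomorphic_fun_iff:
  "holomorphic_fun M \<pi> f \<longleftrightarrow>
    (\<forall>p\<in>M. mdiff f p \<and> (\<forall>v. mderiv M \<pi> f p (\<i> *s v) = \<i> * mderiv M \<pi> f p v))"
proof -
  have "(\<exists>D. has_mderiv M \<pi> f D p \<and> (\<forall>v. D (\<i> *s v) = \<i> * D v)) \<longleftrightarrow>
    mdiff f p \<and> (\<forall>v. mderiv M \<pi> f p (\<i> *s v) = \<i> * mderiv M \<pi> f p v)" if "p \<in> M" for p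
    using has_mderiv_imp_mderiv[OF that, of f] mdiff_has_mderiv[of f p] unfolding mdiff_def by blast
  then show ?thesis by (simp add: holomorphic_fun_def std_J_def)
qed

text \<open>This closure property makes holomorphic functions smooth by induction on the order of
  differentiability.\<close>

lemma holomorphic_directional_derivative:
  assumes "holomorphic_fun M \<pi> f"
  shows "holomorphic_fun M \<pi> (\<lambda>p. mderiv M \<pi> f p v)"
  unfolding holomorphic_fun_def
proof
  fix p assume p: "p \<in> M"
  obtain W where W: "openin (top_of_set M) W" "p \<in> W" "open (\<pi> ` W)" "homeomorphism W (\<pi> ` W) \<pi> (section_at p)"
    using section_at[OF p] .
  let ?s = "section_at p"
  have s: "?s x \<in> W" "\<pi> (?s x) = x" if "x \<in> \<pi> ` W" for x
    using W(4) that by (auto simp: homeomorphism_def)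
  have der: "((\<lambda>x. f (?s x)) has_derivative mderiv M \<pi> f (?s x)) (at x)"
    "\<And>v. mderiv M \<pi> f (?s x) (\<i> *s v) = \<i> * mderiv M \<pi> f (?s x) v" if "x \<in> \<pi> ` W" for x
  proof -
    have M: "?s x \<in> M" using s[OF that] W(1) openin_imp_subset by blast
    then have "has_mderiv M \<pi> f (mderiv M \<pi> f (?s x)) (?s x)"
      using assms unfolding holomorphic_fun_iff by (intro mdiff_has_mderiv) blast
    then show "((\<lambda>x. f (?s x)) has_derivative mderiv M \<pi> f (?s x)) (at x)"
      using has_mderiv_chart[OF W(1) s(1)[OF that] W(3,4)] s(2)[OF that] by auto
    show "\<And>v. mderiv M \<pi> f (?s x) (\<i> *s v) = \<i> * mderiv M \<pi> f (?s x) v"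
      using assms M by (simp add: holomorphic_fun_iff)
  qed
  obtain D' where "((\<lambda>x. mderiv M \<pi> f (?s x) v) has_derivative D') (at (\<pi> p))" "\<And>w. D' (\<i> *s w) = \<i> * D' w"
    by (rule complex_differentiable_directional_derivative[OF W(3) der, where z = "\<pi> p"])
      (use W(2) in auto)
  then show "\<exists>D. has_mderiv M \<pi> (\<lambda>p. mderiv M \<pi> f p v) D p \<and> (\<forall>v. D (std_J p v) = \<i> * D v)"
    using has_mderiv_iff[OF p] by (auto simp: std_J_def)
qed

lemma holomorphic_imp_msmooth:
  assumes "holomorphic_fun M \<pi> f"
  shows "msmooth M \<pi> f"
proof -
  have "holomorphic_fun M \<pi> f \<Longrightarrow> mCk M \<pi> k f" for k f
  proof (induction k arbitrary: f)
    case 0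
    then show ?case by (auto simp: holomorphic_fun_iff intro: mdiff_continuous_on)
  next
    case (Suc k)
    then show ?case
      using holomorphic_directional_derivative by (auto simp: mCk_Suc_iff holomorphic_fun_iff)
  qed
  with assms show ?thesis by (simp add: msmooth_def)
qed

end

section \<open>The symplectic vector space of flat coordinates\<close>

definition embed_x :: "complex^'n \<Rightarrow> real^('n + 'n)" where
  "embed_x v = (\<chi> a. case a of Inl i \<Rightarrow> Re (v $ i) | Inr j \<Rightarrow> 0)"

definition embed_y :: "complex^'n \<Rightarrow> real^('n + 'n)" where
  "embed_y v = (\<chi> a. case a of Inl i \<Rightarrow> 0 | Inr j \<Rightarrow> Re (v $ j))"

lemma embed_nth [simp]:
  "embed_x v $ Inl i = Re (v $ i)" "embed_x v $ Inr i = 0"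
  "embed_y v $ Inl i = 0" "embed_y v $ Inr i = Re (v $ i)"
  by (simp_all add: embed_x_def embed_y_def)

lemma sum_vec_eq_iff:
  fixes v w :: "'b^('n::finite + 'n)"
  shows "v = w \<longleftrightarrow> (\<forall>i. v $ Inl i = w $ Inl i \<and> v $ Inr i = w $ Inr i)"
  by (simp add: vec_eq_iff) (metis sum.exhaust)

lemma bounded_linear_embed: "bounded_linear embed_x" "bounded_linear embed_y"
  by (rule linear_conv_bounded_linear[THEN iffD1], rule linearI; simp add: sum_vec_eq_iff)+

definition sympl :: "real^('n::finite + 'n) \<Rightarrow> real^('n + 'n) \<Rightarrow> real" where
  "sympl a b = (\<Sum>i\<in>UNIV. a $ Inl i * b $ Inr i - a $ Inr i * b $ Inl i)"

lemma bilinear_sympl: "bilinear sympl"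
  by (auto simp: bilinear_def sympl_def intro!: linearI
      simp: sum.distrib[symmetric] sum_subtractf[symmetric] sum_distrib_left algebra_simps intro!: sum.cong)

lemma bounded_bilinear_sympl: "bounded_bilinear sympl"
  using bilinear_sympl by (simp add: bilinear_conv_bounded_bilinear)

lemma sympl_antisym: "sympl a b = - sympl b a"
  by (simp add: sympl_def sum_negf[symmetric] algebra_simps)

definition sympl_dual :: "real^('n::finite + 'n) \<Rightarrow> real^('n + 'n)" where
  "sympl_dual b = (\<chi> a. case a of Inl i \<Rightarrow> b $ Inr i | Inr i \<Rightarrow> - b $ Inl i)"

text \<open>Writing the symplectic form through the Euclidean inner product gives access to its Gram matrices.\<close>

lemma sympl_eq_inner: "sympl a b = a \<bullet> sympl_dual b"
proof -
  have "a \<bullet> sympl_dual b = (\<Sum>i\<in>UNIV. a $ i * sympl_dual b $ i)" by (simp add: inner_vec_def)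
  also have "\<dots> = (\<Sum>i\<in>UNIV. a $ Inl i * b $ Inr i) + (\<Sum>i\<in>UNIV. a $ Inr i * - b $ Inl i)"
    by (simp only: UNIV_Plus_UNIV[symmetric] sum.Plus finite) (simp add: sympl_dual_def)
  finally show ?thesis by (simp add: sympl_def sum_subtractf sum_negf)
qed

lemma linear_sympl_dual: "linear sympl_dual"
  by (rule linearI) (simp_all add: sum_vec_eq_iff sympl_dual_def)

lemma sympl_dual_sympl_dual: "sympl_dual (sympl_dual b) = - b"
  by (simp add: sum_vec_eq_iff sympl_dual_def)

lemma sympl_nondegenerate: "(\<And>b. sympl a b = 0) \<Longrightarrow> a = 0"
proof -
  assume "\<And>b. sympl a b = 0"
  then have "sympl a (- sympl_dual a) = 0" by blast
  then have "a \<bullet> a = 0"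
    by (simp add: sympl_eq_inner linear_neg[OF linear_sympl_dual] sympl_dual_sympl_dual)
  then show "a = 0" by simp
qed

text \<open>A complex structure has determinant of modulus one; it is applied to the symplectic duality and to
  the complex structure of a tangent space read in flat coordinates.\<close>

lemma abs_det_square_minus_id:
  fixes f :: "real^'m \<Rightarrow> real^'m"
  assumes f: "linear f" and sq: "\<And>x. f (f x) = - x"
  shows "\<bar>det (matrix f)\<bar> = 1"
proof -
  have "matrix f ** matrix f = matrix (f \<circ> f)" by (rule matrix_compose[OF f f, symmetric])
  also have "f \<circ> f = (*\<^sub>R) (-1)" by (simp add: fun_eq_iff sq)
  finally have "det (matrix f) * det (matrix f) = (-1) ^ CARD('m)"
    by (metis det_mul det_matrix_scaleR)
  then have "\<bar>det (matrix f) * det (matrix f)\<bar> = \<bar>(-1) ^ CARD('m)\<bar>" by (rule arg_cong)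
  then have "\<bar>det (matrix f)\<bar> * \<bar>det (matrix f)\<bar> = 1"
    by (simp only: abs_mult power_abs) simp
  then show ?thesis using abs_ge_zero[of "det (matrix f)"] by (metis abs_abs abs_mult_self_eq real_sqrt_abs2 real_sqrt_one)
qed

section \<open>Flat coordinates defined by a prepotential\<close>

locale prepotential = complex_etale M \<pi> for M :: "'a::topological_space set" and \<pi> :: "'a \<Rightarrow> complex^'n" +
  fixes F :: "'a \<Rightarrow> complex"
  assumes manifold: "etale_manifold M \<pi>"
    and holomorphic: "holomorphic_fun M \<pi> F"
    and nondegenerate: "nondegenerate_fun M \<pi> F"
begin

definition grad :: "'a \<Rightarrow> complex^'n" where
  "grad p = (\<chi> j. cpartial M \<pi> F j p)"

abbreviation hess :: "'a \<Rightarrow> complex^'n \<Rightarrow> complex^'n" where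
  "hess \<equiv> mderiv M \<pi> grad"

abbreviation third :: "'a \<Rightarrow> complex^'n \<Rightarrow> complex^'n \<Rightarrow> complex^'n" where
  "third p u v \<equiv> mderiv M \<pi> (\<lambda>q. hess q u) p v"

text \<open>The differential of the flat coordinates \<open>(x, y)\<close>.\<close>

abbreviation A :: "'a \<Rightarrow> complex^'n \<Rightarrow> real^('n + 'n)" where
  "A \<equiv> xy_differential M \<pi> F"

lemma holomorphic_grad: "holomorphic_fun M \<pi> (\<lambda>p. grad p $ j)"
  using holomorphic_directional_derivative[OF holomorphic] by (simp add: grad_def cpartial_def)

lemma msmooth_F: "msmooth M \<pi> F"
  by (rule holomorphic_imp_msmooth[OF holomorphic])

lemma msmooth_grad: "msmooth M \<pi> grad"
  by (rule msmooth_vec) (rule holomorphic_imp_msmooth[OF holomorphic_grad])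

lemmas msmooth_hess = msmooth_mderiv[OF msmooth_grad]

lemma hess_nth: "p \<in> M \<Longrightarrow> hess p v $ j = mderiv M \<pi> (cpartial M \<pi> F j) p v"
  using mderiv_vec_nth[OF _ msmooth_mdiff[OF msmooth_grad]] by (simp add: grad_def)

lemma linear_hess: "p \<in> M \<Longrightarrow> linear (hess p)"
  by (intro linear_mderiv msmooth_mdiff msmooth_grad)

lemma hess_times_i: "p \<in> M \<Longrightarrow> hess p (\<i> *s v) = \<i> *s hess p v"
  using holomorphic_grad by (simp add: vec_eq_iff hess_nth grad_def holomorphic_fun_iff)

lemma hess_expand:
  assumes "p \<in> M"
  shows "hess p v $ j = (\<Sum>k\<in>UNIV. v $ k * hess p (axis k 1) $ j)"
  by (rule complex_linear_expand[where L = "\<lambda>v. hess p v $ j"])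
    (use assms linear_hess in \<open>auto intro: linear_compose[OF _ bounded_linear.linear[OF bounded_linear_vec_nth], unfolded o_def] simp: hess_times_i\<close>)

lemma mderiv_F:
  assumes "p \<in> M"
  shows "mderiv M \<pi> F p v = (\<Sum>k\<in>UNIV. v $ k * grad p $ k)"
  using complex_linear_expand[of "mderiv M \<pi> F p" v] holomorphic assms
  by (simp add: holomorphic_fun_iff linear_mderiv grad_def cpartial_def)

text \<open>The Lagrangian condition: both sides are second derivatives of \<open>F\<close>, taken in the two possible
  orders.\<close>

lemma hess_symmetric:
  assumes p: "p \<in> M"
  shows "(\<Sum>j\<in>UNIV. hess p v $ j * u $ j) = (\<Sum>j\<in>UNIV. v $ j * hess p u $ j)"
proof -
  have *: "mderiv M \<pi> (\<lambda>q. mderiv M \<pi> F q u) p v = (\<Sum>j\<in>UNIV. u $ j * hess p v $ j)" for u v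
  proof -
    have "mderiv M \<pi> (\<lambda>q. mderiv M \<pi> F q u) p v = mderiv M \<pi> (\<lambda>q. \<Sum>k\<in>UNIV. u $ k * grad q $ k) p v"
      by (simp add: mderiv_F cong: mderiv_cong[OF p])
    also have "\<dots> = (\<Sum>j\<in>UNIV. u $ j * hess p v $ j)"
      using msmooth_mdiff[OF msmooth_vec_nth[OF msmooth_grad] p]
      by (simp add: mderiv_sum mderiv_bounded_linear[OF p bounded_linear_mult_right] p
          mderiv_vec_nth[OF p msmooth_mdiff[OF msmooth_grad p]])
    finally show ?thesis .
  qed
  show ?thesis
    using mderiv_commute[OF msmooth_F p, of u v] by (simp add: * mult.commute)
qed

text \<open>The third derivatives of \<open>F\<close> form a symmetric tensor. This is the reason why the connection is
  torsion free and why the covariant derivative of the complex structure is symmetric.\<close>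

lemma third_symmetric: "p \<in> M \<Longrightarrow> third p u v = third p v u"
  by (rule mderiv_commute[OF msmooth_grad])

lemma bounded_linear_times_i: "bounded_linear (\<lambda>v :: complex^'n. \<i> *s v)"
  by (rule linear_conv_bounded_linear[THEN iffD1], rule linearI) (simp_all add: vec_eq_iff algebra_simps)

lemma third_times_i: "p \<in> M \<Longrightarrow> third p (\<i> *s u) v = \<i> *s third p u v"
  by (simp add: hess_times_i mderiv_bounded_linear[OF _ bounded_linear_times_i msmooth_mdiff[OF msmooth_hess]]
      cong: mderiv_cong)

lemma x_coord_eq: "x_coord M \<pi> F i = (\<lambda>p. Re (\<pi> p $ i))"
  and u_coord_eq: "u_coord M \<pi> F i = (\<lambda>p. Im (\<pi> p $ i))"
  and y_coord_eq: "y_coord M \<pi> F i = (\<lambda>p. Re (grad p $ i))"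
  by (simp_all add: fun_eq_iff x_coord_def u_coord_def y_coord_def lagr_imm_def grad_def)

lemma mderiv_coords:
  assumes p: "p \<in> M"
  shows "mderiv M \<pi> (x_coord M \<pi> F i) p v = Re (v $ i)"
    and "mderiv M \<pi> (u_coord M \<pi> F i) p v = Im (v $ i)"
    and "mderiv M \<pi> (y_coord M \<pi> F i) p v = Re (hess p v $ i)"
  unfolding x_coord_eq u_coord_eq y_coord_eq
  using msmooth_mdiff[OF msmooth_vec_nth[OF msmooth_grad] p] msmooth_mdiff[OF msmooth_vec_nth[OF msmooth_chart_map] p]
  by (simp_all add: mderiv_bounded_linear[OF p bounded_linear_Re] mderiv_bounded_linear[OF p bounded_linear_Im]
      mderiv_vec_nth[OF p] msmooth_mdiff[OF msmooth_grad p] mderiv_chart_map[OF p])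

lemma A_eq: "p \<in> M \<Longrightarrow> A p v = embed_x v + embed_y (hess p v)"
  by (simp add: sum_vec_eq_iff xy_differential_def mderiv_coords)

lemma linear_A: "p \<in> M \<Longrightarrow> linear (A p)"
  by (intro linearI) (simp_all add: A_eq sum_vec_eq_iff linear_add[OF linear_hess] linear_cmul[OF linear_hess])

lemma msmooth_A: "msmooth M \<pi> (\<lambda>p. A p v)"
proof -
  have "msmooth M \<pi> (\<lambda>p. embed_x v + embed_y (hess p v))"
    by (intro msmooth_add msmooth_const msmooth_bounded_linear[OF bounded_linear_embed(2)] msmooth_hess)
  then show ?thesis by (simp add: A_eq cong: msmooth_cong)
qed

text \<open>The matrix of \<open>A\<close> varies only through \<open>\<partial>\<^sup>2F\<close>, that is, only in the \<open>y\<close>-components.\<close>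

lemma mderiv_A:
  assumes p: "p \<in> M"
  shows "mderiv M \<pi> (\<lambda>q. A q u) p v = embed_y (third p u v)"
proof -
  have "mderiv M \<pi> (\<lambda>q. A q u) p = mderiv M \<pi> (\<lambda>q. embed_x u + embed_y (hess q u)) p"
    by (rule mderiv_cong[OF p]) (rule A_eq)
  then show ?thesis
    using msmooth_mdiff[OF msmooth_hess p]
    by (simp add: mderiv_add[OF p] mderiv_const[OF p] mderiv_bounded_linear[OF p bounded_linear_embed(2)])
qed

lemma msmooth_A_field: "msmooth M \<pi> Y \<Longrightarrow> msmooth M \<pi> (\<lambda>p. A p (Y p))"
  by (rule msmooth_apply_field[OF linear_A msmooth_A])

lemma mderiv_A_field:
  "p \<in> M \<Longrightarrow> msmooth M \<pi> Y \<Longrightarrow>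
    mderiv M \<pi> (\<lambda>q. A q (Y q)) p h = embed_y (third p (Y p) h) + A p (mderiv M \<pi> Y p h)"
  using linear_field_apply(2)[OF linear_A _ msmooth_mdiff[OF msmooth_A] msmooth_mdiff, of p Y h]
  by (simp add: mderiv_A)

definition imhess :: "'a \<Rightarrow> real^'n^'n" where
  "imhess p = (\<chi> j i. Im (hess p (axis i 1) $ j))"

text \<open>The right-hand side of the linear equation for the imaginary part of a vector with flat
  coordinates \<open>w\<close>.\<close>

definition residual :: "'a \<Rightarrow> real^('n + 'n) \<Rightarrow> real^'n" where
  "residual p w = (\<chi> j. (\<Sum>k\<in>UNIV. w $ Inl k * Re (hess p (axis k 1) $ j)) - w $ Inr j)"

definition Ainv :: "'a \<Rightarrow> real^('n + 'n) \<Rightarrow> complex^'n" where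
  "Ainv p w = (\<chi> i. Complex (w $ Inl i)
     (det (\<chi> k l. if l = i then residual p w $ k else imhess p $ k $ l) / det (imhess p)))"

lemma det_imhess: "p \<in> M \<Longrightarrow> det (imhess p) \<noteq> 0"
proof -
  assume p: "p \<in> M"
  have "imhess p = transpose (\<chi> i j. Im (cpartial M \<pi> (cpartial M \<pi> F j) i p))"
    using p by (simp add: imhess_def vec_eq_iff transpose_def hess_nth cpartial_def[of M \<pi> "cpartial M \<pi> F _"])
  then show ?thesis
    using nondegenerate p by (simp add: nondegenerate_fun_def invertible_det_nz)
qed

text \<open>For \<open>v = a + \<i> b\<close>, the \<open>x\<close>-components of \<open>A p v\<close> are \<open>a\<close> and the \<open>y\<close>-components are
  \<open>Re (\<partial>\<^sup>2F) a - Im (\<partial>\<^sup>2F) b\<close>, so nondegeneracy is what determines \<open>b\<close>. Solving for \<open>b\<close> by Cramer's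
  rule keeps the dependence on \<open>p\<close> explicit, and thereby smooth.\<close>

lemma A_eq_iff:
  assumes p: "p \<in> M"
  shows "A p v = w \<longleftrightarrow> v = Ainv p w"
proof -
  have Re_hess: "Re (hess p v $ j) =
    (\<Sum>k\<in>UNIV. Re (v $ k) * Re (hess p (axis k 1) $ j)) - (imhess p *v (\<chi> i. Im (v $ i))) $ j" for j
    by (subst hess_expand[OF p]) (simp add: sum_subtractf imhess_def matrix_vector_mult_def mult.commute)
  have "A p v = w \<longleftrightarrow> (\<forall>i. Re (v $ i) = w $ Inl i) \<and> (\<forall>i. Re (hess p v $ i) = w $ Inr i)"
    using p by (auto simp: sum_vec_eq_iff A_eq)
  also have "\<dots> \<longleftrightarrow> (\<forall>i. Re (v $ i) = w $ Inl i) \<and> imhess p *v (\<chi> i. Im (v $ i)) = residual p w"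
    by (auto simp: Re_hess residual_def vec_eq_iff algebra_simps)
  also have "\<dots> \<longleftrightarrow> v = Ainv p w"
    unfolding cramer[OF det_imhess[OF p]] by (auto simp: Ainv_def vec_eq_iff complex_eq_iff)
  finally show ?thesis .
qed

lemma A_Ainv [simp]: "p \<in> M \<Longrightarrow> A p (Ainv p w) = w"
  and Ainv_A [simp]: "p \<in> M \<Longrightarrow> Ainv p (A p v) = v"
  using A_eq_iff by metis+

lemma A_inject: "p \<in> M \<Longrightarrow> A p v = A p w \<longleftrightarrow> v = w"
  by (metis Ainv_A)

lemma linear_Ainv:
  assumes "p \<in> M" shows "linear (Ainv p)"
  by (rule linearI; rule A_inject[OF assms, THEN iffD1])
    (simp_all add: assms linear_add[OF linear_A[OF assms]] linear_cmul[OF linear_A[OF assms]])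

lemma msmooth_Ainv:
  assumes w: "msmooth M \<pi> w"
  shows "msmooth M \<pi> (\<lambda>p. Ainv p (w p))"
proof (rule msmooth_vec)
  fix i
  have im: "msmooth M \<pi> (\<lambda>p. imhess p $ k $ l)" for k l
    unfolding imhess_def
    by (simp, intro msmooth_bounded_linear[OF bounded_linear_Im] msmooth_vec_nth msmooth_hess)
  have r: "msmooth M \<pi> (\<lambda>p. residual p (w p) $ k)" for k
    unfolding residual_def
    by (simp, intro msmooth_diff msmooth_sum msmooth_mult msmooth_vec_nth msmooth_bounded_linear[OF bounded_linear_Re] w msmooth_hess)
  let ?d = "\<lambda>p. det (\<chi> k l. if l = i then residual p (w p) $ k else imhess p $ k $ l) * inverse (det (imhess p))"
  have "msmooth M \<pi> ?d"
  proof (intro msmooth_mult msmooth_det msmooth_inverse im det_imhess)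
    show "msmooth M \<pi> (\<lambda>p. (\<chi> k l. if l = i then residual p (w p) $ k else imhess p $ k $ l) $ k' $ l')" for k' l'
      by (cases "l' = i") (simp_all add: im r)
  qed
  then have "msmooth M \<pi> (\<lambda>p. of_real (w p $ Inl i) + \<i> * of_real (?d p))"
    by (intro msmooth_add msmooth_bounded_linear[OF bounded_linear_of_real] msmooth_vec_nth w
        msmooth_bounded_linear[OF bounded_linear_mult_right])
  then show "msmooth M \<pi> (\<lambda>p. Ainv p (w p) $ i)"
    by (simp add: Ainv_def Complex_eq divide_inverse mult.commute)
qed

end

section \<open>The special Kaehler structure\<close>

context prepotential begin

abbreviation g where "g \<equiv> metric_of M \<pi> F"
abbreviation nabla where "nabla \<equiv> connection_of M \<pi> F"

lemma mderiv_lagr_imm: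
  assumes p: "p \<in> M"
  shows "mderiv M \<pi> (lagr_imm M \<pi> F) p v = (v, hess p v)"
proof -
  have eq: "lagr_imm M \<pi> F = (\<lambda>q. (\<pi> q, grad q))"
    by (simp add: fun_eq_iff lagr_imm_def grad_def)
  have "((\<lambda>x. (\<pi> (section_at p x), grad (section_at p x))) has_derivative
      (\<lambda>v. (mderiv M \<pi> \<pi> p v, hess p v))) (at (\<pi> p))"
    by (intro has_derivative_Pair mdiff_has_derivative p msmooth_mdiff msmooth_grad msmooth_chart_map)
  then show ?thesis
    using mderivI(2)[OF p, where f = "\<lambda>q. (\<pi> q, grad q)"] by (simp add: eq mderiv_chart_map[OF p])
qed

text \<open>Taking imaginary parts in the symmetry of the Hessian removes half of the terms of the Hermitian
  form. The remaining expression \<open>2 \<Sum> dv dx - du dy\<close> is the one produced by differentiating the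
  height of the hypersurface.\<close>

lemma metric_eq:
  assumes p: "p \<in> M"
  shows "g p v w = 2 * (\<Sum>k\<in>UNIV. Im (hess p v $ k) * Re (w $ k) - Im (v $ k) * Re (hess p w $ k))"
proof -
  have "(\<Sum>k\<in>UNIV. Im (hess p v $ k * w $ k)) = (\<Sum>k\<in>UNIV. Im (v $ k * hess p w $ k))"
    using arg_cong[OF hess_symmetric[OF p, of v w], of Im] by simp
  then show ?thesis
    by (simp add: metric_of_def mderiv_lagr_imm[OF p] herm_form_def sum.distrib sum_subtractf
        sum_negf algebra_simps)
qed

text \<open>The Kaehler form has constant coefficients in the flat coordinates; this is the source of all
  parallelism statements. It comes from the real part of the symmetry of the Hessian.\<close>

lemma kaehler_form_eq:
  assumes p: "p \<in> M"
  shows "kaehler_form g std_J p v w = 2 * sympl (A p v) (A p w)"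
proof -
  have "(\<Sum>k\<in>UNIV. Re (hess p v $ k * w $ k)) = (\<Sum>k\<in>UNIV. Re (v $ k * hess p w $ k))"
    using arg_cong[OF hess_symmetric[OF p, of v w], of Re] by simp
  then show ?thesis
    using p by (simp add: kaehler_form_def std_J_def metric_eq hess_times_i sympl_def A_eq sum_subtractf sum_negf algebra_simps)
qed

text \<open>Recovering the metric from the Kaehler form by inserting \<open>- J\<close>; the smoothness and the
  Gram determinant of the metric are read off from this form.\<close>

lemma metric_eq_sympl:
  assumes p: "p \<in> M"
  shows "g p v w = 2 * sympl (A p v) (A p (- (\<i> *s w)))"
proof -
  have "\<i> *s (- (\<i> *s w)) = w" by (simp add: vec_eq_iff)
  then have "g p v w = kaehler_form g std_J p v (- (\<i> *s w))"
    by (simp add: kaehler_form_def std_J_def)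
  then show ?thesis by (simp add: kaehler_form_eq[OF p])
qed

lemma metric_sym: "p \<in> M \<Longrightarrow> g p v w = g p w v"
proof -
  assume p: "p \<in> M"
  have "(\<Sum>k\<in>UNIV. Im (hess p v $ k * w $ k)) = (\<Sum>k\<in>UNIV. Im (v $ k * hess p w $ k))"
    using arg_cong[OF hess_symmetric[OF p, of v w], of Im] by simp
  then show ?thesis
    by (simp add: metric_eq[OF p] sum.distrib sum_subtractf algebra_simps)
qed

lemma metric_J_invariant: "p \<in> M \<Longrightarrow> g p (\<i> *s v) (\<i> *s w) = g p v w"
  by (simp add: metric_of_def mderiv_lagr_imm hess_times_i herm_form_def sum.distrib sum_subtractf sum_negf algebra_simps)

lemma metric_J_skew:
  assumes p: "p \<in> M" shows "g p (\<i> *s v) w = - g p v (\<i> *s w)"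
  by (simp add: metric_of_def mderiv_lagr_imm hess_times_i herm_form_def p sum.distrib sum_subtractf sum_negf algebra_simps)

lemma linear_minus_times_i: "linear (\<lambda>w :: complex^'n. - (\<i> *s w))"
  by (rule linearI) (simp_all add: vec_eq_iff algebra_simps)

lemma bilinear_sympl_A:
  assumes p: "p \<in> M" and L: "linear L"
  shows "bilinear (\<lambda>v w. 2 * sympl (A p v) (A p (L w)))"
  unfolding bilinear_def
  by (intro conjI allI linearI)
    (simp_all add: linear_add[OF linear_A[OF p]] linear_cmul[OF linear_A[OF p]] linear_add[OF L] linear_cmul[OF L]
      bilinear_ladd[OF bilinear_sympl] bilinear_radd[OF bilinear_sympl] bilinear_lmul[OF bilinear_sympl]
      bilinear_rmul[OF bilinear_sympl] algebra_simps)

lemma pseudo_metric_g: "pseudo_metric M \<pi> g"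
  unfolding pseudo_metric_def bilinear_field_def
proof (intro conjI ballI allI impI)
  fix p assume p: "p \<in> M"
  show "bilinear (g p)"
    using bilinear_sympl_A[OF p linear_minus_times_i] by (simp add: metric_eq_sympl[OF p, abs_def])
  show "g p v w = g p w v" for v w by (rule metric_sym[OF p])
  fix v assume v: "\<forall>w. g p v w = 0"
  have "sympl (A p v) b = 0" for b
  proof -
    have "g p v (\<i> *s Ainv p b) = 2 * sympl (A p v) b"
      using kaehler_form_eq[OF p, of v "Ainv p b"] p by (simp add: kaehler_form_def std_J_def)
    with v show ?thesis by simp
  qed
  then have "A p v = 0" by (rule sympl_nondegenerate)
  then have "A p v = A p 0" using linear_0[OF linear_A[OF p]] by simp
  then show "v = 0" using A_inject[OF p] by blast
next
  fix v w
  have "msmooth M \<pi> (\<lambda>p. 2 * sympl (A p v) (A p (- (\<i> *s w))))"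
    by (intro msmooth_mult msmooth_const msmooth_bilinear[OF bounded_bilinear_sympl] msmooth_A)
  then show "msmooth M \<pi> (\<lambda>p. g p v w)" by (simp add: metric_eq_sympl cong: msmooth_cong)
qed

text \<open>Differentiating the constant form \<open>sympl\<close> composed with \<open>A\<close> leaves terms with the third derivatives
  of \<open>F\<close>; in the cyclic sum these cancel in pairs because the tensor is symmetric and \<open>sympl\<close>
  antisymmetric.\<close>

lemma closed_kaehler_form: "closed_2form M \<pi> (kaehler_form g std_J)"
  unfolding closed_2form_def bilinear_field_def
proof (intro conjI ballI allI)
  fix p assume p: "p \<in> M"
  show "bilinear (kaehler_form g std_J p)"
    using bilinear_sympl_A[OF p linear_id] by (simp add: kaehler_form_eq[OF p, abs_def])
  show "kaehler_form g std_J p v w = - kaehler_form g std_J p w v" for v w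
    using sympl_antisym[of "A p v"] by (simp add: kaehler_form_eq[OF p])
  fix u v w
  have d: "mderiv M \<pi> (\<lambda>q. kaehler_form g std_J q v w) p u =
    2 * (sympl (A p v) (embed_y (third p w u)) + sympl (embed_y (third p v u)) (A p w))" for u v w
  proof -
    have "mderiv M \<pi> (\<lambda>q. kaehler_form g std_J q v w) p = mderiv M \<pi> (\<lambda>q. 2 * sympl (A q v) (A q w)) p"
      by (rule mderiv_cong[OF p]) (rule kaehler_form_eq)
    then show ?thesis
      using msmooth_mdiff[OF msmooth_A p]
      by (simp add: mderiv_bounded_linear[OF p bounded_linear_mult_right]
          mderiv_bilinear[OF p bounded_bilinear_sympl] mderiv_A[OF p])
  qed
  show "mderiv M \<pi> (\<lambda>q. kaehler_form g std_J q v w) p u +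
      mderiv M \<pi> (\<lambda>q. kaehler_form g std_J q w u) p v +
      mderiv M \<pi> (\<lambda>q. kaehler_form g std_J q u v) p w = 0"
    unfolding d third_symmetric[OF p, of v u] third_symmetric[OF p, of w v] third_symmetric[OF p, of u w]
    by (simp add: sympl_antisym[of "embed_y z" for z])
next
  fix v w
  have "msmooth M \<pi> (\<lambda>p. 2 * sympl (A p v) (A p w))"
    by (intro msmooth_mult msmooth_const msmooth_bilinear[OF bounded_bilinear_sympl] msmooth_A)
  then show "msmooth M \<pi> (\<lambda>p. kaehler_form g std_J p v w)" by (simp add: kaehler_form_eq cong: msmooth_cong)
qed

lemma almost_complex_std_J: "almost_complex M \<pi> std_J"
  using bounded_linear.linear[OF bounded_linear_times_i]
  by (simp add: almost_complex_def linear_field_def std_J_def[abs_def] msmooth_const vec_eq_iff)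

lemma complex_structure_std_J: "complex_structure M \<pi> std_J"
  unfolding complex_structure_def
proof (intro conjI ballI almost_complex_std_J)
  fix p assume p: "p \<in> M"
  obtain W where W: "openin (top_of_set M) W" "p \<in> W" "open (\<pi> ` W)" "homeomorphism W (\<pi> ` W) \<pi> (section_at p)"
    using section_at[OF p] .
  have "\<exists>V s. openin (top_of_set W) V \<and> q \<in> V \<and> open (\<pi> ` V) \<and> homeomorphism V (\<pi> ` V) \<pi> s"
    if "q \<in> W" for q
    using W(3,4) that openin_subtopology_self by blast
  then have W_etale: "etale W \<pi>" by (rule etale.intro)
  have "inj_on \<pi> W"
    by (rule inj_on_inverseI[of _ "section_at p"]) (use W(4) in \<open>simp add: homeomorphism_def\<close>)
  moreover have "msmooth W \<pi> \<pi> \<and> (\<forall>q\<in>W. bij (mderiv W \<pi> \<pi> q) \<and>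
      (\<forall>v. mderiv W \<pi> \<pi> q (std_J q v) = \<i> *s mderiv W \<pi> \<pi> q v))"
    by (simp add: etale.msmooth_chart_map[OF W_etale] etale.mderiv_chart_map[OF W_etale] std_J_def bij_def)
  ultimately show "\<exists>W c. openin (top_of_set M) W \<and> p \<in> W \<and> msmooth W \<pi> (c :: 'a \<Rightarrow> complex^'n) \<and> inj_on c W \<and>
        (\<forall>q\<in>W. bij (mderiv W \<pi> c q) \<and> (\<forall>v. mderiv W \<pi> c q (std_J q v) = \<i> *s mderiv W \<pi> c q v))"
    using W(1,2) by (intro exI[of _ W] exI[of _ \<pi>]) simp
qed

lemma pseudo_kaehler: "pseudo_kaehler M \<pi> std_J g"
  by (simp add: pseudo_kaehler_def manifold complex_structure_std_J pseudo_metric_g closed_kaehler_form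
      metric_J_invariant[unfolded] std_J_def)

text \<open>In flat coordinates the connection is plain differentiation. All properties of the connection
  are deduced from this identity and the injectivity of \<open>A p\<close>.\<close>

lemma A_nabla:
  assumes p: "p \<in> M" and Y: "msmooth M \<pi> Y"
  shows "A p (nabla X Y p) = mderiv M \<pi> (\<lambda>q. A q (Y q)) p (X p)"
proof -
  let ?w = "mderiv M \<pi> (\<lambda>q. A q (Y q)) p (X p)"
  have comp: "?w $ Inl i = mderiv M \<pi> (\<lambda>q. mderiv M \<pi> (x_coord M \<pi> F i) q (Y q)) p (X p)"
    "?w $ Inr i = mderiv M \<pi> (\<lambda>q. mderiv M \<pi> (y_coord M \<pi> F i) q (Y q)) p (X p)" for i
    unfolding mderiv_vec_nth[OF p msmooth_mdiff[OF msmooth_A_field[OF Y] p], symmetric]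
    by (simp_all add: xy_differential_def)
  have "nabla X Y p = (THE v. ?w = A p v)"
    unfolding connection_of_def comp[symmetric]
    by (simp add: sum_vec_eq_iff xy_differential_def)
  also have "\<dots> = Ainv p ?w"
    using A_eq_iff[OF p] by (intro the_equality) (auto simp: p)
  finally show ?thesis by (simp add: p)
qed

lemma nabla_eq_iff:
  assumes "p \<in> M" "msmooth M \<pi> Y"
  shows "nabla X Y p = v \<longleftrightarrow> mderiv M \<pi> (\<lambda>q. A q (Y q)) p (X p) = A p v"
  using A_inject[OF assms(1)] A_nabla[OF assms] by metis

lemma msmooth_nabla:
  assumes "msmooth M \<pi> X" "msmooth M \<pi> Y" shows "msmooth M \<pi> (nabla X Y)"
proof -
  have "msmooth M \<pi> (\<lambda>p. Ainv p (mderiv M \<pi> (\<lambda>q. A q (Y q)) p (X p)))"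
    by (intro msmooth_Ainv msmooth_mderiv_field msmooth_A_field assms)
  moreover have "nabla X Y p = Ainv p (mderiv M \<pi> (\<lambda>q. A q (Y q)) p (X p))" if "p \<in> M" for p
    using that assms(2) by (simp add: nabla_eq_iff)
  ultimately show ?thesis by (simp cong: msmooth_cong)
qed

lemma affine_connection_nabla: "affine_connection M \<pi> nabla"
  unfolding affine_connection_def
proof (intro conjI allI impI ballI; elim conjE)
  show "msmooth M \<pi> (nabla X Y)" if "msmooth M \<pi> X" "msmooth M \<pi> Y" for X Y
    using that by (rule msmooth_nabla)
next
  fix p assume p: "p \<in> M"
  note lin [simp] = linear_add[OF linear_A[OF p]] linear_cmul[OF linear_A[OF p]]
  have D: "linear (mderiv M \<pi> (\<lambda>q. A q (Y q)) p)" if "msmooth M \<pi> Y" for Y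
    using that by (intro linear_mderiv msmooth_mdiff msmooth_A_field p)
  show "nabla (\<lambda>q. X q + X' q) Y p = nabla X Y p + nabla X' Y p"
    if "msmooth M \<pi> Y" for X X' Y
    using that by (simp add: nabla_eq_iff p A_nabla linear_add[OF D])
  show "nabla (\<lambda>q. f q *\<^sub>R X q) Y p = f p *\<^sub>R nabla X Y p"
    if "msmooth M \<pi> Y" for f X Y
    using that by (simp add: nabla_eq_iff p A_nabla linear_cmul[OF D])
  show "nabla X (\<lambda>q. Y q + Y' q) p = nabla X Y p + nabla X Y' p"
    if "msmooth M \<pi> Y" "msmooth M \<pi> Y'" for X Y Y'
  proof -
    have "mderiv M \<pi> (\<lambda>q. A q (Y q + Y' q)) p = mderiv M \<pi> (\<lambda>q. A q (Y q) + A q (Y' q)) p"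
      by (rule mderiv_cong[OF p]) (rule linear_add[OF linear_A])
    then show ?thesis
      using that by (simp add: nabla_eq_iff msmooth_add p A_nabla mderiv_add msmooth_mdiff msmooth_A_field)
  qed
  show "nabla X (\<lambda>q. f q *\<^sub>R Y q) p = mderiv M \<pi> f p (X p) *\<^sub>R Y p + f p *\<^sub>R nabla X Y p"
    if "msmooth M \<pi> f" "msmooth M \<pi> Y" for f X Y
  proof -
    have "mderiv M \<pi> (\<lambda>q. A q (f q *\<^sub>R Y q)) p = mderiv M \<pi> (\<lambda>q. f q *\<^sub>R A q (Y q)) p"
      by (rule mderiv_cong[OF p]) (rule linear_cmul[OF linear_A])
    then show ?thesis
      using that by (simp add: nabla_eq_iff msmooth_scaleR p A_nabla msmooth_mdiff msmooth_A_field
          mderiv_bilinear[OF p bounded_bilinear_scaleR])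
  qed
qed

lemma torsion_free_nabla: "torsion_free M \<pi> nabla"
  unfolding torsion_free_def
proof (intro allI impI ballI, elim conjE)
  fix X Y :: "'a \<Rightarrow> complex^'n" and p assume X: "msmooth M \<pi> X" and Y: "msmooth M \<pi> Y" and p: "p \<in> M"
  have "A p (nabla X Y p - nabla Y X p) = A p (lie_bracket M \<pi> X Y p)"
    using third_symmetric[OF p, of "X p" "Y p"]
    by (simp add: linear_diff[OF linear_A[OF p]] A_nabla[OF p] X Y mderiv_A_field[OF p] lie_bracket_def)
  then show "nabla X Y p - nabla Y X p = lie_bracket M \<pi> X Y p"
    using A_inject[OF p] by blast
qed

text \<open>After reading \<open>Z\<close> in flat coordinates, curvature becomes the commutator of second derivatives of
  a vector-valued function.\<close>

lemma flat_connection_nabla: "flat_connection M \<pi> nabla"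
  unfolding flat_connection_def
proof (intro allI impI ballI, elim conjE)
  fix X Y Z :: "'a \<Rightarrow> complex^'n" and p assume X: "msmooth M \<pi> X" and Y: "msmooth M \<pi> Y" and Z: "msmooth M \<pi> Z" and p: "p \<in> M"
  define W where "W = (\<lambda>q. A q (Z q))"
  have W: "msmooth M \<pi> W" unfolding W_def by (rule msmooth_A_field[OF Z])
  have second: "A p (nabla X (nabla Y Z) p) =
    mderiv M \<pi> (\<lambda>q. mderiv M \<pi> W q (Y p)) p (X p) + mderiv M \<pi> W p (mderiv M \<pi> Y p (X p))"
    if "msmooth M \<pi> X" "msmooth M \<pi> Y" for X Y
  proof -
    have "A p (nabla X (nabla Y Z) p) = mderiv M \<pi> (\<lambda>q. A q (nabla Y Z q)) p (X p)"
      using that by (intro A_nabla[OF p] msmooth_nabla Z)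
    also have "mderiv M \<pi> (\<lambda>q. A q (nabla Y Z q)) p = mderiv M \<pi> (\<lambda>q. mderiv M \<pi> W q (Y q)) p"
      by (rule mderiv_cong[OF p]) (simp add: A_nabla Z W_def)
    finally show ?thesis by (simp add: mderiv_mderiv_field[OF W that(2) p])
  qed
  have "A p (nabla X (nabla Y Z) p - nabla Y (nabla X Z) p - nabla (lie_bracket M \<pi> X Y) Z p) = A p 0"
    using mderiv_commute[OF W p, of "X p" "Y p"] linear_diff[OF linear_mderiv[OF p msmooth_mdiff[OF W p]]]
    by (simp add: linear_diff[OF linear_A[OF p]] linear_0[OF linear_A[OF p]] second X Y A_nabla[OF p Z]
        W_def[symmetric] lie_bracket_def)
  then show "nabla X (nabla Y Z) p - nabla Y (nabla X Z) p - nabla (lie_bracket M \<pi> X Y) Z p = 0"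
    using A_inject[OF p] by blast
qed

lemma nabla_eq:
  assumes p: "p \<in> M" and Y: "msmooth M \<pi> Y"
  shows "nabla X Y p = mderiv M \<pi> Y p (X p) + Ainv p (embed_y (third p (Y p) (X p)))"
  using p Y by (simp add: nabla_eq_iff mderiv_A_field linear_add[OF linear_A[OF p]])

text \<open>The connection differs from differentiation in the frame of \<open>\<pi>\<close>, in which \<open>J\<close> is constant, by the
  image of the third derivatives of \<open>F\<close> under a linear map on each tangent space. These derivatives
  are symmetric and complex linear.\<close>

lemma nabla_J_symmetric:
  assumes X: "msmooth M \<pi> X" and Y: "msmooth M \<pi> Y" and p: "p \<in> M"
  shows "nabla X (\<lambda>q. std_J q (Y q)) p - std_J p (nabla X Y p) = nabla Y (\<lambda>q. std_J q (X q)) p - std_J p (nabla Y X p)"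
proof -
  have "nabla X (\<lambda>q. std_J q (Y q)) p - std_J p (nabla X Y p) =
    Ainv p (embed_y (\<i> *s third p (Y p) (X p))) - \<i> *s Ainv p (embed_y (third p (Y p) (X p)))"
    if X: "msmooth M \<pi> X" and Y: "msmooth M \<pi> Y" for X Y
    using msmooth_bounded_linear[OF bounded_linear_times_i Y]
      mderiv_bounded_linear[OF p bounded_linear_times_i msmooth_mdiff[OF Y p]]
    by (simp add: std_J_def nabla_eq[OF p] Y third_times_i[OF p] vec_eq_iff algebra_simps)
  then show ?thesis using X Y third_symmetric[OF p] by simp
qed

lemma parallel_kaehler_form: "parallel_2form M \<pi> nabla (kaehler_form g std_J)"
  unfolding parallel_2form_def
proof (intro allI impI ballI, elim conjE)
  fix X Y Z :: "'a \<Rightarrow> complex^'n" and p assume X: "msmooth M \<pi> X" and Y: "msmooth M \<pi> Y" and Z: "msmooth M \<pi> Z" and p: "p \<in> M"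
  have "mderiv M \<pi> (\<lambda>q. kaehler_form g std_J q (Y q) (Z q)) p = mderiv M \<pi> (\<lambda>q. 2 * sympl (A q (Y q)) (A q (Z q))) p"
    by (rule mderiv_cong[OF p]) (rule kaehler_form_eq)
  then show "mderiv M \<pi> (\<lambda>q. kaehler_form g std_J q (Y q) (Z q)) p (X p) - kaehler_form g std_J p (nabla X Y p) (Z p)
      - kaehler_form g std_J p (Y p) (nabla X Z p) = 0"
    using msmooth_mdiff[OF msmooth_A_field[OF Y] p] msmooth_mdiff[OF msmooth_A_field[OF Z] p]
    by (simp add: mderiv_bounded_linear[OF p bounded_linear_mult_right]
        mderiv_bilinear[OF p bounded_bilinear_sympl] kaehler_form_eq[OF p] A_nabla[OF p] Y Z)
qed

theorem special_kaehler: "special_kaehler M \<pi> std_J g nabla"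
  unfolding special_kaehler_def
  by (intro conjI allI impI ballI pseudo_kaehler affine_connection_nabla flat_connection_nabla torsion_free_nabla
      parallel_kaehler_form) (elim conjE, rule nabla_J_symmetric)

end

section \<open>The parabolic hypersphere\<close>

definition embed_hyperplane :: "real^'m \<Rightarrow> real^('m option)" where
  "embed_hyperplane w = (\<chi> a. case a of None \<Rightarrow> 0 | Some b \<Rightarrow> w $ b)"

lemma embed_hyperplane_nth [simp]:
  "embed_hyperplane w $ None = 0" "embed_hyperplane w $ Some b = w $ b"
  by (simp_all add: embed_hyperplane_def)

lemma option_vec_eq_iff:
  fixes v w :: "'b^('n::finite option)"
  shows "v = w \<longleftrightarrow> v $ None = w $ None \<and> (\<forall>b. v $ Some b = w $ Some b)"
  by (simp add: vec_eq_iff) (metis option.exhaust)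

lemma axis_option_nth [simp]:
  "axis None c $ None = c" "axis None c $ Some b = 0"
  by (simp_all add: axis_def)

lemma bounded_linear_embed_hyperplane: "bounded_linear embed_hyperplane"
  by (rule linear_conv_bounded_linear[THEN iffD1], rule linearI; simp add: option_vec_eq_iff)

context prepotential begin

text \<open>The covector \<open>2 \<Sum> v dx - u dy\<close> in flat coordinates, to become the differential of the height of
  the hypersurface.\<close>

definition conormal :: "'a \<Rightarrow> real^('n + 'n) \<Rightarrow> real" where
  "conormal p w = 2 * (\<Sum>k\<in>UNIV. Im (grad p $ k) * w $ Inl k - Im (\<pi> p $ k) * w $ Inr k)"

lemma linear_conormal: "linear (conormal p)"
  by (rule linearI) (simp_all add: conormal_def algebra_simps sum.distrib sum_subtractf sum_distrib_left)

lemma msmooth_conormal: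
  assumes "msmooth M \<pi> W" shows "msmooth M \<pi> (\<lambda>p. conormal p (W p))"
  unfolding conormal_def
  by (intro msmooth_mult msmooth_const msmooth_sum msmooth_diff msmooth_bounded_linear[OF bounded_linear_Im]
      msmooth_vec_nth msmooth_grad msmooth_chart_map assms)

lemma has_derivative_coordinates:
  assumes p: "p \<in> M"
  shows "((\<lambda>x. Im (grad (section_at p x) $ k)) has_derivative (\<lambda>h. Im (hess p h $ k))) (at (\<pi> p))"
    and "((\<lambda>x. Re (grad (section_at p x) $ k)) has_derivative (\<lambda>h. Re (hess p h $ k))) (at (\<pi> p))"
    and "((\<lambda>x. Im (\<pi> (section_at p x) $ k)) has_derivative (\<lambda>h. Im (h $ k))) (at (\<pi> p))"
proof -
  note G = bounded_linear.has_derivative[OF bounded_linear_vec_nth mdiff_has_derivative[OF p msmooth_mdiff[OF msmooth_grad p]]]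
  note C = bounded_linear.has_derivative[OF bounded_linear_vec_nth mdiff_has_derivative[OF p mderiv_chart_map(1)[OF p]]]
  show "((\<lambda>x. Im (grad (section_at p x) $ k)) has_derivative (\<lambda>h. Im (hess p h $ k))) (at (\<pi> p))"
    by (rule bounded_linear.has_derivative[OF bounded_linear_Im G])
  show "((\<lambda>x. Re (grad (section_at p x) $ k)) has_derivative (\<lambda>h. Re (hess p h $ k))) (at (\<pi> p))"
    by (rule bounded_linear.has_derivative[OF bounded_linear_Re G])
  show "((\<lambda>x. Im (\<pi> (section_at p x) $ k)) has_derivative (\<lambda>h. Im (h $ k))) (at (\<pi> p))"
    using bounded_linear.has_derivative[OF bounded_linear_Im C] by (simp add: mderiv_chart_map(2)[OF p])
qed

text \<open>The second term is where the metric enters: the derivative of the covector \<open>2 \<Sum> v dx - u dy\<close> has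
  coefficients \<open>2 (dv, - du)\<close>, and pairing them with \<open>(dx, dy)\<close> is the metric.\<close>

lemma mderiv_conormal:
  assumes p: "p \<in> M" and W: "mdiff W p"
  shows "mderiv M \<pi> (\<lambda>q. conormal q (W q)) p h = conormal p (mderiv M \<pi> W p h) + g p h (Ainv p (W p))"
proof -
  have W': "((\<lambda>x. W (section_at p x) $ a) has_derivative (\<lambda>h. mderiv M \<pi> W p h $ a)) (at (\<pi> p))" for a
    by (rule bounded_linear.has_derivative[OF bounded_linear_vec_nth mdiff_has_derivative[OF p W]])
  have "((\<lambda>x. conormal (section_at p x) (W (section_at p x))) has_derivative
     (\<lambda>h. 2 * (\<Sum>k\<in>UNIV. (Im (grad p $ k) * mderiv M \<pi> W p h $ Inl k + Im (hess p h $ k) * W p $ Inl k)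
         - (Im (\<pi> p $ k) * mderiv M \<pi> W p h $ Inr k + Im (h $ k) * W p $ Inr k)))) (at (\<pi> p))"
    unfolding conormal_def
  proof (intro has_derivative_mult_right has_derivative_sum)
    fix k
    show "((\<lambda>x. Im (grad (section_at p x) $ k) * W (section_at p x) $ Inl k - Im (\<pi> (section_at p x) $ k) * W (section_at p x) $ Inr k)
      has_derivative (\<lambda>h. (Im (grad p $ k) * mderiv M \<pi> W p h $ Inl k + Im (hess p h $ k) * W p $ Inl k)
         - (Im (\<pi> p $ k) * mderiv M \<pi> W p h $ Inr k + Im (h $ k) * W p $ Inr k))) (at (\<pi> p))"
      using has_derivative_diff[OF has_derivative_mult[OF has_derivative_coordinates(1)[OF p, of k] W'[of "Inl k"]]
          has_derivative_mult[OF has_derivative_coordinates(3)[OF p, of k] W'[of "Inr k"]]]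
      by (simp add: p)
  qed
  note d = mderivI(2)[where f = "\<lambda>q. conormal q (W q)", OF p this]
  have "W p $ Inl k = Re (Ainv p (W p) $ k)" "W p $ Inr k = Re (hess p (Ainv p (W p)) $ k)" for k
    using arg_cong[OF A_Ainv[OF p, of "W p"], of "\<lambda>w. w $ Inl k"] arg_cong[OF A_Ainv[OF p, of "W p"], of "\<lambda>w. w $ Inr k"]
    by (simp_all add: A_eq[OF p])
  then show ?thesis
    unfolding d unfolding metric_eq[OF p] conormal_def
    by (simp add: sum.distrib sum_subtractf algebra_simps)
qed

lemma phi_F_eq:
  "phi_F M \<pi> F p = embed_hyperplane (embed_x (\<pi> p) + embed_y (grad p)) +
    (2 * Im (F p) - 2 * (\<Sum>k\<in>UNIV. Re (grad p $ k) * Im (\<pi> p $ k))) *\<^sub>R axis None 1"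
  unfolding option_vec_eq_iff sum_vec_eq_iff
  by (auto simp: phi_F_def x_coord_eq y_coord_eq u_coord_eq embed_x_def embed_y_def split: sum.split)

lemma msmooth_phi_F: "msmooth M \<pi> (phi_F M \<pi> F)"
proof -
  have "msmooth M \<pi> (\<lambda>p. embed_hyperplane (embed_x (\<pi> p) + embed_y (grad p)) +
    (2 * Im (F p) - 2 * (\<Sum>k\<in>UNIV. Re (grad p $ k) * Im (\<pi> p $ k))) *\<^sub>R axis None 1)"
    by (intro msmooth_add msmooth_bounded_linear[OF bounded_linear_embed_hyperplane]
        msmooth_bounded_linear[OF bounded_linear_embed(1)] msmooth_bounded_linear[OF bounded_linear_embed(2)]
        msmooth_scaleR msmooth_diff msmooth_mult msmooth_const msmooth_sum
        msmooth_bounded_linear[OF bounded_linear_Im] msmooth_bounded_linear[OF bounded_linear_Re]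
        msmooth_vec_nth msmooth_grad msmooth_chart_map msmooth_F)
  then show ?thesis by (simp add: phi_F_eq[abs_def])
qed

text \<open>As \<open>dF = \<Sum> w dz\<close>, the terms \<open>y du\<close> of \<open>2 Im dF\<close> cancel against those of \<open>2 d(\<Sum> y u)\<close>. The height
  is thus a partial Legendre transform: its differential involves only \<open>dx\<close> and \<open>dy\<close>.\<close>

lemma mderiv_phi_F:
  assumes p: "p \<in> M"
  shows "mderiv M \<pi> (phi_F M \<pi> F) p v = embed_hyperplane (A p v) + conormal p (A p v) *\<^sub>R axis None 1"
proof -
  let ?h = "\<lambda>p. 2 * Im (F p) - 2 * (\<Sum>k\<in>UNIV. Re (grad p $ k) * Im (\<pi> p $ k))"
  let ?l = "\<lambda>p. embed_x (\<pi> p) + embed_y (grad p)"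
  have h: "((\<lambda>x. ?h (section_at p x)) has_derivative
     (\<lambda>v. 2 * Im (mderiv M \<pi> F p v) - 2 * (\<Sum>k\<in>UNIV. Re (grad p $ k) * Im (v $ k) + Re (hess p v $ k) * Im (\<pi> p $ k)))) (at (\<pi> p))"
    using has_derivative_diff[OF has_derivative_mult_right[OF bounded_linear.has_derivative[OF bounded_linear_Im
        mdiff_has_derivative[OF p msmooth_mdiff[OF msmooth_F p]]]]
      has_derivative_mult_right[OF has_derivative_sum[OF
        has_derivative_mult[OF has_derivative_coordinates(2)[OF p] has_derivative_coordinates(3)[OF p]]]], of 2 2 "\<lambda>k. k" "\<lambda>k. k" UNIV]
    by (simp add: p)
  have l: "mdiff ?l p" "mderiv M \<pi> ?l p v = A p v"
    using mderiv_bounded_linear[OF p bounded_linear_embed(1) mderiv_chart_map(1)[OF p]]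
      mderiv_bounded_linear[OF p bounded_linear_embed(2) msmooth_mdiff[OF msmooth_grad p]]
    by (simp_all add: mderiv_add[OF p] mderiv_chart_map[OF p] A_eq[OF p])
  have "2 * Im (mderiv M \<pi> F p v) - 2 * (\<Sum>k\<in>UNIV. Re (grad p $ k) * Im (v $ k) + Re (hess p v $ k) * Im (\<pi> p $ k)) =
    conormal p (A p v)"
    by (simp add: mderiv_F[OF p] conormal_def A_eq[OF p] sum.distrib sum_subtractf algebra_simps)
  then have h': "mdiff ?h p" "mderiv M \<pi> ?h p v = conormal p (A p v)"
    using mderivI[OF p h] by simp_all
  show ?thesis
    using mderiv_bounded_linear[OF p bounded_linear_embed_hyperplane l(1)]
      mderiv_bounded_linear[OF p bounded_linear_scaleR_left h'(1), of "axis None 1 :: real^(('n + 'n) option)"]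
    by (simp add: phi_F_eq[abs_def] mderiv_add[OF p] l h')
qed

text \<open>The first \<open>2n\<close> coordinates of the hypersurface are the flat coordinates, so their second
  derivatives are those of the connection; the metric is what is left over in the last coordinate.\<close>

lemma gauss_formula_phi_F: "induced_data M \<pi> (phi_F M \<pi> F) (\<lambda>p. axis None 1) nabla g"
  unfolding induced_data_def
proof (intro allI impI ballI, elim conjE)
  fix X Y :: "'a \<Rightarrow> complex^'n" and p assume Y: "msmooth M \<pi> Y" and p: "p \<in> M"
  let ?W = "\<lambda>q. A q (Y q)"
  note W = msmooth_mdiff[OF msmooth_A_field[OF Y] p]
  note c = msmooth_mdiff[OF msmooth_conormal[OF msmooth_A_field[OF Y]] p]
  have "mderiv M \<pi> (\<lambda>q. mderiv M \<pi> (phi_F M \<pi> F) q (Y q)) p =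
    mderiv M \<pi> (\<lambda>q. embed_hyperplane (?W q) + conormal q (?W q) *\<^sub>R axis None 1) p"
    by (rule mderiv_cong[OF p]) (rule mderiv_phi_F)
  then show "mderiv M \<pi> (\<lambda>q. mderiv M \<pi> (phi_F M \<pi> F) q (Y q)) p (X p) =
      mderiv M \<pi> (phi_F M \<pi> F) p (nabla X Y p) + g p (X p) (Y p) *\<^sub>R axis None 1"
    using mderiv_bounded_linear[OF p bounded_linear_embed_hyperplane W]
      mderiv_bounded_linear[OF p bounded_linear_scaleR_left c, of "axis None 1 :: real^(('n + 'n) option)"]
    by (simp add: mderiv_add[OF p] mderiv_phi_F[OF p] A_nabla[OF p Y] mderiv_conormal[OF p W] p algebra_simps)
qed

lemma induced_volume_phi_F:
  assumes p: "p \<in> M"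
  shows "induced_volume M \<pi> ambient_volume (phi_F M \<pi> F) (\<lambda>p. axis None 1) p X =
    2 ^ CARD('n) * det (\<chi> a b. A p (X b) $ a)"
  unfolding induced_volume_def ambient_volume_def
  by (simp add: det_option_unit_column mderiv_phi_F[OF p])

text \<open>With respect to the symplectic form, the metric is twice the product of the duality and a complex
  structure, both of determinant \<open>\<plusminus> 1\<close>. Hence its Gram determinant is \<open>2\<^sup>2\<^sup>n\<close> times the square of the
  coordinate volume, which explains the factor \<open>2\<^sup>n\<close> in the ambient volume form.\<close>

lemma abs_det_metric:
  assumes p: "p \<in> M"
  shows "\<bar>det (\<chi> i j. g p (X i) (X j) :: real^('n + 'n)^('n + 'n))\<bar> = (2 ^ CARD('n) * det (\<chi> a b. A p (X b) $ a))\<^sup>2"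
proof -
  define P where "P = (\<chi> a b. A p (X b) $ a)"
  \<comment> \<open>minus the complex structure of the tangent space, read in flat coordinates\<close>
  define B where "B w = A p (- (\<i> *s Ainv p w))" for w
  have B: "linear B"
    unfolding B_def using linear_compose[OF linear_compose[OF linear_Ainv[OF p] linear_minus_times_i] linear_A[OF p]]
    by (simp add: o_def)
  have BB: "B (B w) = - w" for w
  proof -
    have "- (\<i> *s (- (\<i> *s v))) = - v" for v :: "complex^'n" by (simp add: vec_eq_iff)
    then have "B (B w) = A p (- Ainv p w)" by (simp only: B_def Ainv_A[OF p])
    then show ?thesis by (simp add: p linear_neg[OF linear_A[OF p]])
  qed
  have cols: "matrix f ** (\<chi> a b. V b $ a) = (\<chi> a b. f (V b) $ a)" if "linear f"
    for f :: "real^('n + 'n) \<Rightarrow> real^('n + 'n)" and V :: "'n + 'n \<Rightarrow> _"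
    by (simp add: matrix_mult_columns matrix_vector_mul(2)[OF that])
  have two: "linear ((*\<^sub>R) (2::real) :: real^('n+'n) \<Rightarrow> real^('n+'n))" by (simp add: linear_scaleR)
  have sd: "\<bar>det (matrix (sympl_dual :: real^('n + 'n) \<Rightarrow> _))\<bar> = 1"
    by (rule abs_det_square_minus_id[OF linear_sympl_dual sympl_dual_sympl_dual])
  have "(\<chi> i j. g p (X i) (X j)) = (\<chi> i j. A p (X i) \<bullet> (2 *\<^sub>R sympl_dual (B (A p (X j)))))"
    by (simp add: metric_eq_sympl[OF p] sympl_eq_inner B_def p)
  also have "\<dots> = transpose P ** (matrix ((*\<^sub>R) 2) ** (matrix sympl_dual ** (matrix B ** P)))"
    unfolding P_def cols[OF B] cols[OF linear_sympl_dual] cols[OF two] by (rule transpose_mult_columns[symmetric])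
  finally have "\<bar>det (\<chi> i j. g p (X i) (X j) :: real^('n + 'n)^('n + 'n))\<bar> = \<bar>det P\<bar> * (2 ^ CARD('n + 'n) * \<bar>det P\<bar>)"
    using abs_det_square_minus_id[OF B BB] sd
    by (simp add: det_mul abs_mult)
  also have "\<dots> = (2 ^ CARD('n) * det P)\<^sup>2"
    by (simp add: power2_eq_square power_add algebra_simps flip: abs_mult)
  finally show ?thesis by (simp add: P_def)
qed

lemma induced_volume_eq_metric_volume:
  assumes p: "p \<in> M"
  shows "induced_volume M \<pi> ambient_volume (phi_F M \<pi> F) (\<lambda>p. axis None 1) p X =
    metric_volume (xy_orientation M \<pi> F) g p X"
  by (simp add: induced_volume_phi_F[OF p] metric_volume_def abs_det_metric[OF p] xy_orientation_def
      real_sqrt_abs abs_mult sgn_mult_abs)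

lemma parallel_induced_volume:
  "parallel_topform M \<pi> nabla (induced_volume M \<pi> ambient_volume (phi_F M \<pi> F) (\<lambda>p. axis None 1))"
  unfolding parallel_topform_def
proof (intro allI impI ballI, elim conjE)
  fix X :: "'a \<Rightarrow> complex^'n" and Y :: "'n + 'n \<Rightarrow> 'a \<Rightarrow> complex^'n" and p
  assume Y: "\<forall>i. msmooth M \<pi> (Y i)" and p: "p \<in> M"
  have W: "mdiff (\<lambda>q. A q (Y i q)) p" for i
    using Y by (intro msmooth_mdiff msmooth_A_field p) blast
  have "mderiv M \<pi> (\<lambda>q. induced_volume M \<pi> ambient_volume (phi_F M \<pi> F) (\<lambda>p. axis None 1) q (\<lambda>j. Y j q)) p =
    mderiv M \<pi> (\<lambda>q. 2 ^ CARD('n) * det (\<chi> a b. A q (Y b q) $ a)) p"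
    by (rule mderiv_cong[OF p]) (rule induced_volume_phi_F)
  also have "\<dots> = (\<lambda>v. 2 ^ CARD('n) * mderiv M \<pi> (\<lambda>q. det (\<chi> a b. A q (Y b q) $ a)) p v)"
    by (intro mderiv_bounded_linear(2) bounded_linear_mult_right p mderiv_det(1) W)
  also have "\<dots> = (\<lambda>v. \<Sum>i\<in>UNIV. 2 ^ CARD('n) *
      det (\<chi> a b. (if b = i then mderiv M \<pi> (\<lambda>q. A q (Y i q)) p v else A p (Y b p)) $ a))"
    by (simp add: mderiv_det(2)[OF p W] sum_distrib_left)
  finally show "mderiv M \<pi> (\<lambda>q. induced_volume M \<pi> ambient_volume (phi_F M \<pi> F) (\<lambda>p. axis None 1) q (\<lambda>j. Y j q)) p (X p) -
      (\<Sum>i\<in>UNIV. induced_volume M \<pi> ambient_volume (phi_F M \<pi> F) (\<lambda>p. axis None 1) p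
         (\<lambda>j. if j = i then nabla X (Y i) p else Y j p)) = 0"
    using Y by (simp add: induced_volume_phi_F[OF p] A_nabla[OF p] if_distrib[of "A p"] cong: if_cong)
qed

lemma affine_hypersurface_phi_F:
  assumes "connected M"
  shows "affine_hypersurface M \<pi> (phi_F M \<pi> F)"
  unfolding affine_hypersurface_def
proof (intro conjI ballI manifold assms msmooth_phi_F)
  show "CARD('n + 'n) = DIM(complex^'n)" by simp
  have "0 < CARD('n)" by simp
  moreover have "CARD('n + 'n) = CARD('n) + CARD('n)" by simp
  ultimately show "1 < CARD('n + 'n)" by linarith
  fix p assume p: "p \<in> M"
  show "inj (mderiv M \<pi> (phi_F M \<pi> F) p)"
  proof (rule injI)
    fix v w assume "mderiv M \<pi> (phi_F M \<pi> F) p v = mderiv M \<pi> (phi_F M \<pi> F) p w"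
    then have "A p v = A p w" by (simp add: mderiv_phi_F[OF p] option_vec_eq_iff vec_eq_iff)
    then show "v = w" using A_inject[OF p] by blast
  qed
qed

lemma transversal_phi_F: "transversal M \<pi> (phi_F M \<pi> F) (\<lambda>p. axis None 1)"
  unfolding transversal_def
proof (intro conjI ballI msmooth_const notI)
  fix p assume p: "p \<in> M"
  assume "axis None 1 \<in> range (mderiv M \<pi> (phi_F M \<pi> F) p)"
  then obtain v where v: "axis None 1 = mderiv M \<pi> (phi_F M \<pi> F) p v" by blast
  then have "A p v = 0" by (simp add: mderiv_phi_F[OF p] option_vec_eq_iff vec_eq_iff)
  with v show False by (simp add: mderiv_phi_F[OF p] option_vec_eq_iff linear_0[OF linear_conormal])
qed

theorem special_parabolic_hypersphere_phi_F:
  assumes "connected M"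
  shows "special_parabolic_hypersphere M \<pi> (xy_orientation M \<pi> F) ambient_volume
    (phi_F M \<pi> F) (\<lambda>p. axis None 1) nabla g std_J"
  unfolding special_parabolic_hypersphere_def parabolic_hypersphere_def blaschke_structure_def
proof (intro conjI ballI allI)
  show "mderiv M \<pi> (\<lambda>p. axis None 1 :: real^(('n + 'n) option)) p v = 0" if "p \<in> M" for p v
    by (simp add: mderiv_const[OF that])
  show skew: "g p (std_J p v) w = - g p v (std_J p w)" if "p \<in> M" for p v w
    using metric_J_skew[OF that] by (simp add: std_J_def)
  show "parallel_2form M \<pi> nabla (\<lambda>p v w. g p (std_J p v) w)"
    unfolding parallel_2form_def
  proof (intro allI impI ballI, elim conjE)
    fix X Y Z :: "'a \<Rightarrow> complex^'n" and p
    assume X: "msmooth M \<pi> X" and Y: "msmooth M \<pi> Y" and Z: "msmooth M \<pi> Z" and p: "p \<in> M"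
    have "msmooth M \<pi> (\<lambda>q. kaehler_form g std_J q (Y q) (Z q))"
    proof -
      have "msmooth M \<pi> (\<lambda>q. 2 * sympl (A q (Y q)) (A q (Z q)))"
        by (intro msmooth_mult msmooth_const msmooth_bilinear[OF bounded_bilinear_sympl] msmooth_A_field Y Z)
      then show ?thesis by (simp add: kaehler_form_eq cong: msmooth_cong)
    qed
    moreover have "mderiv M \<pi> (\<lambda>q. g q (std_J q (Y q)) (Z q)) p = mderiv M \<pi> (\<lambda>q. - kaehler_form g std_J q (Y q) (Z q)) p"
      by (rule mderiv_cong[OF p]) (simp add: kaehler_form_def skew)
    ultimately show "mderiv M \<pi> (\<lambda>q. g q (std_J q (Y q)) (Z q)) p (X p) - g p (std_J p (nabla X Y p)) (Z p)
        - g p (std_J p (Y p)) (nabla X Z p) = 0"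
      using parallel_kaehler_form[unfolded parallel_2form_def, rule_format, OF conjI[OF X conjI[OF Y Z]] p] p
        mderiv_bounded_linear[OF p bounded_linear_minus[OF bounded_linear_ident], of "\<lambda>q. kaehler_form g std_J q (Y q) (Z q)"]
      by (simp add: kaehler_form_def skew msmooth_mdiff)
  qed
qed (simp_all add: affine_hypersurface_phi_F[OF assms] transversal_phi_F affine_connection_nabla torsion_free_nabla
    pseudo_metric_g gauss_formula_phi_F induced_volume_eq_metric_volume parallel_induced_volume almost_complex_std_J)

section \<open>Uniqueness of the hypersurface\<close>

text \<open>Let \<open>E b\<close> be the parallel frame dual to the flat coordinates. By the Gauss formula the derivative
  of \<open>d\<psi> (E b)\<close> is \<open>g(_, E b) \<xi>\<close> with constant \<open>\<xi>\<close>, and the height of \<open>phi_F\<close> satisfies the same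
  equation; so \<open>d\<psi> (E b)\<close> minus \<open>\<xi>\<close> times the differential of the height is a constant vector. The
  matrix \<open>B\<close> made of these vectors and \<open>\<xi>\<close> maps \<open>d(phi_F)\<close> to \<open>d\<psi>\<close>, and equality of the two induced
  volumes, both being the metric volume, gives it determinant one.\<close>

lemma affine_congruence:
  assumes conn: "connected M"
    and \<psi>: "special_parabolic_hypersphere M \<pi> (xy_orientation M \<pi> F) ambient_volume \<psi> \<xi> nabla g std_J"
  shows "\<exists>T. unimodular_affine T \<and> (\<forall>p\<in>M. \<psi> p = T (phi_F M \<pi> F p))"
proof (cases "M = {}")
  case True
  have "unimodular_affine (\<lambda>x :: real^(('n + 'n) option). mat 1 *v x + 0)"
    unfolding unimodular_affine_def using det_I by blast
  with True show ?thesis by blast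
next
  case False
  then obtain p0 where p0: "p0 \<in> M" by blast
  have smooth: "msmooth M \<pi> \<psi>" and gauss: "induced_data M \<pi> \<psi> \<xi> nabla g"
    and vol: "\<And>p X. p \<in> M \<Longrightarrow> induced_volume M \<pi> ambient_volume \<psi> \<xi> p X = metric_volume (xy_orientation M \<pi> F) g p X"
    and \<xi>: "msmooth M \<pi> \<xi>" "\<And>p v. p \<in> M \<Longrightarrow> mderiv M \<pi> \<xi> p v = 0"
    using \<psi> by (auto simp: special_parabolic_hypersphere_def parabolic_hypersphere_def blaschke_structure_def
        affine_hypersurface_def transversal_def)
  obtain \<xi>0 where \<xi>0: "\<And>p. p \<in> M \<Longrightarrow> \<xi> p = \<xi>0"
    using zero_mderiv_imp_constant[OF conn msmooth_mdiff[OF \<xi>(1)] \<xi>(2)] by (auto simp: constant_on_def)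
  define E where "E b p = Ainv p (axis b 1)" for b p
  have E: "msmooth M \<pi> (E b)" for b
    unfolding E_def[abs_def] by (intro msmooth_Ainv msmooth_const)
  have AE: "A p (E b p) = axis b 1" if "p \<in> M" for b p
    by (simp add: E_def that)
  have parallel: "nabla X (E b) p = 0" if p: "p \<in> M" for X b p
  proof -
    have "mderiv M \<pi> (\<lambda>q. A q (E b q)) p = mderiv M \<pi> (\<lambda>q. axis b 1) p"
      by (rule mderiv_cong[OF p]) (rule AE)
    then show ?thesis
      by (simp add: nabla_eq_iff[OF p E] mderiv_const[OF p] linear_0[OF linear_A[OF p]])
  qed
  let ?f = "\<lambda>b q. mderiv M \<pi> \<psi> q (E b q) - conormal q (axis b 1) *\<^sub>R \<xi>0"
  have "?f b constant_on M" for b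
  proof (rule zero_mderiv_imp_constant[OF conn])
    fix p assume p: "p \<in> M"
    have d1: "mdiff (\<lambda>q. mderiv M \<pi> \<psi> q (E b q)) p"
      by (intro msmooth_mdiff msmooth_mderiv_field smooth E p)
    have c: "mdiff (\<lambda>q. conormal q (axis b 1)) p"
      by (intro msmooth_mdiff msmooth_conormal msmooth_const p)
    note d2 = mderiv_bounded_linear[OF p bounded_linear_minus[OF bounded_linear_scaleR_left] c, of \<xi>0]
    show "mdiff (?f b) p" using mderiv_add(1)[OF p d1 d2(1)] by simp
    fix v
    have "mderiv M \<pi> (\<lambda>q. mderiv M \<pi> \<psi> q (E b q)) p v = mderiv M \<pi> \<psi> p (nabla (\<lambda>_. v) (E b) p) + g p v (E b p) *\<^sub>R \<xi> p"
      by (rule gauss[unfolded induced_data_def, rule_format, OF conjI[OF msmooth_const E] p])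
    also have "\<dots> = g p v (E b p) *\<^sub>R \<xi>0"
      by (simp add: parallel[OF p] linear_0[OF linear_mderiv[OF p msmooth_mdiff[OF smooth p]]] \<xi>0[OF p])
    finally show "mderiv M \<pi> (?f b) p v = 0"
      using mderiv_add(2)[OF p d1 d2(1)] d2(2)
      by (simp add: mderiv_conormal[OF p mderiv_const(1)[OF p]] mderiv_const[OF p] linear_0[OF linear_conormal] E_def)
  qed
  then have "\<exists>c. \<forall>q\<in>M. ?f b q = c" for b by (simp add: constant_on_def)
  then obtain c where c: "\<And>b q. q \<in> M \<Longrightarrow> ?f b q = c b" by metis
  define B :: "real^(('n + 'n) option)^(('n + 'n) option)"
    \<comment> \<open>the columns are \<open>\<xi>0\<close> and the constants \<open>c b\<close>\<close>
    where "B = (\<chi> i a. case_option \<xi>0 c a $ i)"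
  have B_None: "B *v axis None 1 = \<xi>0" and B_Some: "B *v axis (Some b) 1 = c b" for b
    by (simp_all add: B_def matrix_vector_mult_basis column_def vec_eq_iff)
  have d\<psi>: "mderiv M \<pi> \<psi> p v = B *v mderiv M \<pi> (phi_F M \<pi> F) p v" if p: "p \<in> M" for p v
  proof -
    have "(\<lambda>w. mderiv M \<pi> \<psi> p (Ainv p w)) = (\<lambda>w. B *v mderiv M \<pi> (phi_F M \<pi> F) p (Ainv p w))"
    proof (rule linear_eq_stdbasis)
      show "linear (\<lambda>w. mderiv M \<pi> \<psi> p (Ainv p w))"
        using linear_compose[OF linear_Ainv[OF p] linear_mderiv[OF p msmooth_mdiff[OF smooth p]]] by (simp add: o_def)
      show "linear (\<lambda>w. B *v mderiv M \<pi> (phi_F M \<pi> F) p (Ainv p w))"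
        using linear_compose[OF linear_compose[OF linear_Ainv[OF p] linear_mderiv[OF p msmooth_mdiff[OF msmooth_phi_F p]]]
          matrix_vector_mul_linear[of B]] by (simp add: o_def)
      fix w :: "real^('n + 'n)" assume "w \<in> Basis"
      then obtain b where w: "w = axis b 1" by (auto simp: Basis_vec_def)
      have "embed_hyperplane (axis b 1) = axis (Some b) 1"
        by (simp add: option_vec_eq_iff axis_def)
      then have "B *v mderiv M \<pi> (phi_F M \<pi> F) p (E b p) = c b + conormal p (axis b 1) *\<^sub>R \<xi>0"
        by (simp add: mderiv_phi_F[OF p] AE[OF p] matrix_vector_right_distrib matrix_vector_mult_scaleR B_None B_Some)
      then show "mderiv M \<pi> \<psi> p (Ainv p w) = B *v mderiv M \<pi> (phi_F M \<pi> F) p (Ainv p w)"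
        using c[OF p, of b] by (simp add: w E_def algebra_simps)
    qed
    from fun_cong[OF this, of "A p v"] show ?thesis by (simp add: p)
  qed
  let ?d = "\<lambda>q. \<psi> q - B *v phi_F M \<pi> F q"
  have "?d constant_on M"
  proof (rule zero_mderiv_imp_constant[OF conn])
    fix p assume p: "p \<in> M"
    note s = msmooth_mdiff[OF smooth p]
    have "bounded_linear (\<lambda>x. - (B *v x))"
      by (intro bounded_linear_minus linear_conv_bounded_linear[THEN iffD1] matrix_vector_mul_linear)
    note m = mderiv_bounded_linear[OF p this msmooth_mdiff[OF msmooth_phi_F p]]
    show "mdiff ?d p" using mderiv_add(1)[OF p s m(1)] by simp
    show "mderiv M \<pi> ?d p v = 0" for v
      using mderiv_add(2)[OF p s m(1)] m(2) d\<psi>[OF p] by simp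
  qed
  then obtain t where t: "\<And>p. p \<in> M \<Longrightarrow> \<psi> p - B *v phi_F M \<pi> F p = t" by (auto simp: constant_on_def)
  have "det B = 1"
  proof -
    let ?X = "\<lambda>b. E b p0"
    let ?V = "case_option (axis None 1) (\<lambda>b. mderiv M \<pi> (phi_F M \<pi> F) p0 (?X b))"
    have "case_option (\<xi> p0) (\<lambda>b. mderiv M \<pi> \<psi> p0 (?X b)) = (\<lambda>a. B *v ?V a)"
      by (auto simp: fun_eq_iff B_None \<xi>0[OF p0] d\<psi>[OF p0] split: option.split)
    then have "induced_volume M \<pi> ambient_volume \<psi> \<xi> p0 ?X = 2 ^ CARD('n) * det (B ** (\<chi> a b. ?V b $ a))"
      by (simp add: induced_volume_def ambient_volume_def matrix_mult_columns)
    also have "\<dots> = det B * induced_volume M \<pi> ambient_volume (phi_F M \<pi> F) (\<lambda>p. axis None 1) p0 ?X"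
      by (simp add: induced_volume_def ambient_volume_def det_mul)
    finally have "induced_volume M \<pi> ambient_volume (phi_F M \<pi> F) (\<lambda>p. axis None 1) p0 ?X =
      det B * induced_volume M \<pi> ambient_volume (phi_F M \<pi> F) (\<lambda>p. axis None 1) p0 ?X"
      by (simp add: vol[OF p0] induced_volume_eq_metric_volume[OF p0])
    moreover have "(\<chi> a b. A p0 (?X b) $ a) = mat 1"
      by (simp add: AE[OF p0] vec_eq_iff mat_def axis_def)
    then have "induced_volume M \<pi> ambient_volume (phi_F M \<pi> F) (\<lambda>p. axis None 1) p0 ?X \<noteq> 0"
      by (simp add: induced_volume_phi_F[OF p0])
    ultimately show ?thesis by simp
  qed
  then have "unimodular_affine (\<lambda>x. B *v x + t)" unfolding unimodular_affine_def by blast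
  moreover have "\<psi> p = B *v phi_F M \<pi> F p + t" if "p \<in> M" for p
    using t[OF that] by (simp add: algebra_simps)
  ultimately show ?thesis by blast
qed

end

section \<open>The theorem on prepotentials\<close>

theorem theorem3:
  fixes U :: "(complex^'n) set"
    and M :: "'a::topological_space set"
    and \<pi> :: "'a \<Rightarrow> complex^'n"
    and F :: "'a \<Rightarrow> complex"
  assumes "open U" and "connected U"
    and "riemann_domain M \<pi> U"
    and "holomorphic_fun M \<pi> F"
    and "nondegenerate_fun M \<pi> F"
  shows "(special_kaehler M \<pi> std_J (metric_of M \<pi> F) (connection_of M \<pi> F) \<and>
      (\<forall>p\<in>M. \<forall>v w. kaehler_form (metric_of M \<pi> F) std_J p v w =
         2 * (\<Sum>i\<in>UNIV. mderiv M \<pi> (x_coord M \<pi> F i) p v * mderiv M \<pi> (y_coord M \<pi> F i) p w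
                       - mderiv M \<pi> (y_coord M \<pi> F i) p v * mderiv M \<pi> (x_coord M \<pi> F i) p w)))
    \<and> special_parabolic_hypersphere M \<pi> (xy_orientation M \<pi> F) ambient_volume
         (phi_F M \<pi> F) (\<lambda>p. axis None 1) (connection_of M \<pi> F) (metric_of M \<pi> F) std_J
    \<and> (\<forall>\<psi> :: 'a \<Rightarrow> real^(('n + 'n) option).
         (\<exists>\<xi>. special_parabolic_hypersphere M \<pi> (xy_orientation M \<pi> F) ambient_volume
                \<psi> \<xi> (connection_of M \<pi> F) (metric_of M \<pi> F) std_J) \<longrightarrow>
         (\<exists>A. unimodular_affine A \<and> (\<forall>p\<in>M. \<psi> p = A (phi_F M \<pi> F p))))"
proof -
  have cov: "covering_space M \<pi> U" and conn: "connected M"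
    using assms(3) by (auto simp: riemann_domain_def)
  have man: "etale_manifold M \<pi>"
    by (rule covering_space_imp_etale_manifold[OF cov assms(1)])
  interpret prepotential M \<pi> F
    using etale_manifold_imp_etale[OF man] man assms(4,5)
    by (simp add: prepotential_def complex_etale_def prepotential_axioms_def)
  have "kaehler_form g std_J p v w =
      2 * (\<Sum>i\<in>UNIV. mderiv M \<pi> (x_coord M \<pi> F i) p v * mderiv M \<pi> (y_coord M \<pi> F i) p w
                    - mderiv M \<pi> (y_coord M \<pi> F i) p v * mderiv M \<pi> (x_coord M \<pi> F i) p w)"
    if "p \<in> M" for p v w
    by (simp add: kaehler_form_eq[OF that] sympl_def xy_differential_def)
  then show ?thesis
    using special_kaehler special_parabolic_hypersphere_phi_F[OF conn] affine_congruence[OF conn] by blast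
qed

end
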